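(* Let $0<\epsilon_0$, let $n,k$ be integers with $n\ge 2$ and $0\le k\le n-1$, let $0<\gamma$, and let $Q(x,y)=|y|^{\gamma}$ for $(x,y)\in\mathbb{R}^k\times\mathbb{R}^{n-k}=\mathbb{R}^n$. Let $u$ be an $\epsilon_0$-local minimizer of $J_Q(\cdot,B_2^n(0,0))$. Then $\Sigma=\emptyset$, where $$\Sigma:=\left\{p\in\partial\{u>0\}\cap B_2^n(0,0): \Theta^n_{\{u>0\}}(p)=0\right\}.$$
   Context: Write $\mathbb{R}^n=\mathbb{R}^k\times\mathbb{R}^{n-k}$ with points $(x,y)$, and $B_r^m(p)$ for the ball in $\mathbb{R}^m$ of radius $r$ centered at $p$. Let $\Gamma=\{(x,0)\in\mathbb{R}^k\times\mathbb{R}^{n-k}\}$, so $Q(x,y)=|y|^\gamma=\operatorname{dist}((x,y),\Gamma)^\gamma$. For an open set $\Omega\subset\mathbb{R}^n$ with Lipschitz boundary and continuous $Q\ge 0$, put $$J_Q(v,\Omega)=\int_\Omega |\nabla v|^2+Q^2(x)\chi_{\{v>0\}}\,dx .$$ For $u_0\in W^{1,2}(\Omega)$ let $K_{u_0,\Omega}=\{u\in W^{1,2}(\Omega): u-u_0\in W^{1,2}_0(\Omega)\}$. An $\epsilon_0$-local minimizer of $J_Q(\cdot,\Omega)$ is a function $u\in K_{u_0,\Omega}$, for some $u_0\in W^{1,2}(\Omega)$ with $u_0\ge 0$, such that $J_Q(u,\Omega)\le J_Q(v,\Omega)$ for every $v\in K_{u,\Omega}$ satisfying $$\|\nabla(u-v)\|_{L^2(\Omega)}^2+\|\chi_{\{u>0\}}-\chi_{\{v>0\}}\|_{L^1(\Omega)}<\epsilon_0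 .$$ Such $u$ is identified with its continuous representative. The density of $\{u>0\}$ at $p$ is $\Theta^n_{\{u>0\}}(p)=\lim_{r\to0^+}\frac{\mathcal{H}^n(\{u>0\}\cap B_r^n(p))}{\omega_n r^n}$, where $\omega_n$ is the volume of the unit ball in $\mathbb{R}^n$. *)

theory Defs
  imports "HOL-Analysis.Analysis"
begin

section \<open>Test functions\<close>

definition partial_deriv :: "'n \<Rightarrow> (real^'n::finite \<Rightarrow> real) \<Rightarrow> real^'n \<Rightarrow> real" where
  "partial_deriv i f x = frechet_derivative f (at x) (axis i 1)"

primrec C_times :: "nat \<Rightarrow> (real^'n::finite \<Rightarrow> real) \<Rightarrow> bool" where
  "C_times 0 f \<longleftrightarrow> continuous_on UNIV f"
| "C_times (Suc m) f \<longleftrightarrow>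
     (\<forall>x. f differentiable (at x)) \<and> (\<forall>i. C_times m (partial_deriv i f))"

definition test_functions :: "(real^'n::finite) set \<Rightarrow> (real^'n \<Rightarrow> real) set" where
  "test_functions \<Omega> =
     {\<phi>. (\<forall>m. C_times m \<phi>) \<and> compact (closure {x. \<phi> x \<noteq> 0}) \<and> closure {x. \<phi> x \<noteq> 0} \<subseteq> \<Omega>}"

section \<open>The Sobolev spaces \<open>W\<^sup>1\<^sup>,\<^sup>2\<close> and \<open>W\<^sub>0\<^sup>1\<^sup>,\<^sup>2\<close>\<close>

text \<open>Elements of the function spaces are functions rather than classes modulo null sets.
  Only their values on \<open>\<Omega>\<close> matter.\<close>

definition L2 :: "(real^'n::finite) set \<Rightarrow> (real^'n \<Rightarrow> 'b::euclidean_space) set" where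
  "L2 \<Omega> = {f. f \<in> borel_measurable (lebesgue_on \<Omega>) \<and>
               integrable (lebesgue_on \<Omega>) (\<lambda>x. (norm (f x))\<^sup>2)}"

text \<open>This is only meaningful for locally integrable \<open>u\<close> and \<open>g\<close>. Below it is always combined
  with membership in \<open>L2 \<Omega>\<close>.\<close>

definition is_weak_grad ::
  "(real^'n::finite) set \<Rightarrow> (real^'n \<Rightarrow> real) \<Rightarrow> (real^'n \<Rightarrow> real^'n) \<Rightarrow> bool" where
  "is_weak_grad \<Omega> u g \<longleftrightarrow>
     (\<forall>\<phi>\<in>test_functions \<Omega>. \<forall>i.
        (\<integral>x. u x * partial_deriv i \<phi> x \<partial>lebesgue_on \<Omega>) = - (\<integral>x. g x $ i * \<phi> x \<partial>lebesgue_on \<Omega>))"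

definition W12 :: "(real^'n::finite) set \<Rightarrow> (real^'n \<Rightarrow> real) set" where
  "W12 \<Omega> = {u. u \<in> L2 \<Omega> \<and> (\<exists>g. g \<in> L2 \<Omega> \<and> is_weak_grad \<Omega> u g)}"

text \<open>For open \<open>\<Omega>\<close> the weak gradient is unique up to null sets, so the choice of representative
  does not affect any of the integrals below.\<close>

definition weak_grad :: "(real^'n::finite) set \<Rightarrow> (real^'n \<Rightarrow> real) \<Rightarrow> real^'n \<Rightarrow> real^'n" where
  "weak_grad \<Omega> u = (SOME g. g \<in> L2 \<Omega> \<and> is_weak_grad \<Omega> u g)"

definition W12_norm :: "(real^'n::finite) set \<Rightarrow> (real^'n \<Rightarrow> real) \<Rightarrow> real" where
  "W12_norm \<Omega> u =
     sqrt ((\<integral>x. (u x)\<^sup>2 \<partial>lebesgue_on \<Omega>) + (\<integral>x. (norm (weak_grad \<Omega> u x))\<^sup>2 \<partial>lebesgue_on \<Omega>))"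

text \<open>The closure of the test functions in the \<open>W12\<close> norm.\<close>

definition W12_0 :: "(real^'n::finite) set \<Rightarrow> (real^'n \<Rightarrow> real) set" where
  "W12_0 \<Omega> = {u \<in> W12 \<Omega>. \<exists>\<phi>. (\<forall>j. \<phi> j \<in> test_functions \<Omega>) \<and>
                 (\<lambda>j. W12_norm \<Omega> (\<lambda>x. u x - \<phi> j x)) \<longlonglongrightarrow> 0}"

section \<open>The functional and its local minimizers\<close>

text \<open>The integrals of nonnegative functions are taken in \<open>ennreal\<close>, so that they are not
  silently \<open>0\<close> when infinite.\<close>

definition J_functional ::
  "(real^'n::finite \<Rightarrow> real) \<Rightarrow> (real^'n \<Rightarrow> real) \<Rightarrow> (real^'n) set \<Rightarrow> ennreal" where
  "J_functional Q v \<Omega> =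
     (\<integral>\<^sup>+x. ennreal ((norm (weak_grad \<Omega> v x))\<^sup>2 + (Q x)\<^sup>2 * indicator {z. v z > 0} x) \<partial>lebesgue_on \<Omega>)"

definition K_class :: "(real^'n::finite \<Rightarrow> real) \<Rightarrow> (real^'n) set \<Rightarrow> (real^'n \<Rightarrow> real) set" where
  "K_class u0 \<Omega> = {u \<in> W12 \<Omega>. (\<lambda>x. u x - u0 x) \<in> W12_0 \<Omega>}"

definition local_minimizer ::
  "real \<Rightarrow> (real^'n::finite \<Rightarrow> real) \<Rightarrow> (real^'n) set \<Rightarrow> (real^'n \<Rightarrow> real) \<Rightarrow> bool" where
  "local_minimizer \<epsilon> Q \<Omega> u \<longleftrightarrow>
     (\<exists>u0\<in>W12 \<Omega>. (AE x in lebesgue_on \<Omega>. u0 x \<ge> 0) \<and> u \<in> K_class u0 \<Omega>) \<and>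
     (\<forall>v\<in>K_class u \<Omega>.
        (\<integral>\<^sup>+x. ennreal ((norm (weak_grad \<Omega> (\<lambda>z. u z - v z) x))\<^sup>2) \<partial>lebesgue_on \<Omega>) +
        (\<integral>\<^sup>+x. ennreal \<bar>indicator {z. u z > 0} x - indicator {z. v z > 0} x\<bar> \<partial>lebesgue_on \<Omega>)
          < ennreal \<epsilon>
        \<longrightarrow> J_functional Q u \<Omega> \<le> J_functional Q v \<Omega>)"

section \<open>The weight and the zero-density set\<close>

text \<open>The splitting of \<open>real^'n\<close> into \<open>k\<close> plus \<open>n - k\<close> coordinates is given by the set \<open>I\<close> of the
  \<open>k\<close> indices that make up \<open>x\<close>; the remaining indices make up \<open>y\<close>. This allows \<open>k = 0\<close>, which a
  product of two types \<open>real^'k\<close> and \<open>real^'m\<close> would not.\<close>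

definition y_part :: "'n set \<Rightarrow> real^'n::finite \<Rightarrow> real^'n" where
  "y_part I p = (\<chi> i. if i \<in> I then 0 else p $ i)"

definition Q_power :: "'n set \<Rightarrow> real \<Rightarrow> real^'n::finite \<Rightarrow> real" where
  "Q_power I \<gamma> p = norm (y_part I p) powr \<gamma>"

text \<open>\<open>\<H>\<^sup>n\<close> in n-dimensional space is Lebesgue measure. The limit is stated as convergence, so its
  existence is part of the assertion.\<close>

definition has_density :: "(real^'n::finite) set \<Rightarrow> real^'n \<Rightarrow> real \<Rightarrow> bool" where
  "has_density A p \<theta> \<longleftrightarrow>
     ((\<lambda>r. measure lebesgue (A \<inter> ball p r) / (unit_ball_vol (real CARD('n)) * r ^ CARD('n)))
        \<longlongrightarrow> \<theta>) (at_right 0)"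

text \<open>\<open>u\<close> is only meaningful on \<open>\<Omega>\<close>.\<close>

definition pos_set :: "(real^'n::finite) set \<Rightarrow> (real^'n \<Rightarrow> real) \<Rightarrow> (real^'n) set" where
  "pos_set \<Omega> u = {p \<in> \<Omega>. u p > 0}"

definition Sigma_set :: "(real^'n::finite) set \<Rightarrow> (real^'n \<Rightarrow> real) \<Rightarrow> (real^'n) set" where
  "Sigma_set \<Omega> u = {p \<in> frontier (pos_set \<Omega> u) \<inter> \<Omega>. has_density (pos_set \<Omega> u) p 0}"

end

theory Submission
  imports Defs
begin

text \<open>Near a point \<open>q\<close> write \<open>V(s)\<close> for the volume of \<open>{u > 0}\<close> in \<open>ball q s\<close>, \<open>E(s)\<close> for the energy
\<open>\<integral> |\<nabla>u|\<^sup>2 + Q\<^sup>2\<close> over that set, \<open>X(s)\<close> for \<open>\<integral> u\<^sup>2\<close> over it, and \<open>H(s) = E(s) + X(s)/s\<^sup>2\<close>. Let \<open>n\<close> be the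
dimension. Three facts drive the argument.

\<^item> \<^bold>\<open>Faber-Krahn\<close>: a function that lives on a set of small volume has small \<open>L\<^sup>2\<close> norm compared with its
  gradient. Applied to a cut-off of \<open>u\<^sup>+\<close>, it makes \<open>X(s/2)/s\<^sup>2\<close> a small multiple of \<open>H(s)\<close> as soon as
  \<open>V(s)/s\<^sup>n\<close> is small (\<open>mass_decay\<close>).

\<^item> \<^bold>\<open>Comparison\<close>: the competitor \<open>u - max 0 (\<eta> u)\<close>, where \<open>\<eta>\<close> is a cut-off equal to \<open>1\<close> on the half ball,
  is not positive on the half ball. Minimality therefore bounds \<open>E(s/2)\<close> by a small multiple of \<open>E(s)\<close>
  plus a large multiple of \<open>X(s)/s\<^sup>2\<close> (\<open>energy_decay\<close>). Together with the first fact, \<open>H(s/4) \<le> \<tau> H(s)\<close>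
  for any prescribed \<open>\<tau>\<close>, provided that the density \<open>V(s)/s\<^sup>n\<close> is small enough and that \<open>V(s)\<close> and
  \<open>H(s)\<close> are so small that the competitor is admissible (\<open>decay\<close>).

\<^item> \<^bold>\<open>Return from energy to density\<close>: where \<open>Q\<close> is not small, Chebyshev's inequality bounds the volume of
  \<open>{u > 0}\<close> by the energy, and \<open>Q < (l s)\<^sup>\<gamma>\<close> holds only on the part of the ball inside a slab of thickness
  comparable to \<open>l s\<close>, which has volume at most \<open>C l s\<^sup>n\<close> wherever the centre is (\<open>vol_le_energy\<close>). So
  \<open>H(s) \<le> e\<^sub>0 s\<^bsup>n+2\<gamma>\<^esup>\<close> forces \<open>V(s)/s\<^sup>n\<close> to be small.

Taking \<open>\<tau> < 4\<^bsup>-(n+2\<gamma>)\<^esup>\<close>, the bound \<open>H(s) \<le> e\<^sub>0 s\<^bsup>n+2\<gamma>\<^esup>\<close> reproduces itself at the scale \<open>s/4\<close>, hence at all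
scales \<open>s/4\<^sup>j\<close>, and the density at \<open>q\<close> stays below that of a full ball. As \<open>{u > 0}\<close> is open, \<open>q\<close> cannot lie
in it. If \<open>p\<close> has density zero, then \<open>H(s)/s\<^bsup>n+2\<gamma>\<^esup>\<close> tends to zero along \<open>s = r/4\<^sup>j\<close> by the same decay, so
that the bound holds at some scale around \<^emph>\<open>every\<close> point near \<open>p\<close>. Thus \<open>u \<le> 0\<close> in a neighbourhood of \<open>p\<close>,
and \<open>p\<close> is not a boundary point of \<open>{u > 0}\<close>.

The Sobolev theory behind the first two facts is developed for the predicate \<open>approximable\<close>: a function
with a gradient field that is a limit of test functions, uniformly and in \<open>L\<^sup>2\<close> of the gradients. This
class is closed under positive parts (\<open>approximable_pos_part\<close>), satisfies the Faber-Krahn inequality, and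
contains \<open>\<eta> u\<close> by mollification (\<open>approximable_of_weak_grad\<close>). The lemma \<open>minimality\<close> translates between it
and the definitions of the function spaces.\<close>

section \<open>Smooth functions, bumps and mollifiers\<close>

definition smooth :: "(real^'n::finite \<Rightarrow> real) \<Rightarrow> bool" where
  "smooth f \<longleftrightarrow> (\<forall>m. C_times m f)"

definition grad :: "(real^'n::finite \<Rightarrow> real) \<Rightarrow> real^'n \<Rightarrow> real^'n" where
  "grad f x = (\<chi> i. partial_deriv i f x)"

lemma grad_nth [simp]: "grad f x $ i = partial_deriv i f x"
  by (simp add: grad_def)

lemma C_times_SucD: "C_times (Suc m) f \<Longrightarrow> C_times m f"
proof (induction m arbitrary: f)
  case 0
  then show ?case
    by (auto intro!: continuous_at_imp_continuous_on differentiable_imp_continuous_within)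
qed auto

lemma smooth_differentiable: "smooth f \<Longrightarrow> f differentiable (at x)"
  unfolding smooth_def using C_times.simps(2) by blast

lemma smooth_partial: "smooth f \<Longrightarrow> smooth (partial_deriv i f)"
  unfolding smooth_def using C_times.simps(2) by blast

lemma smooth_continuous: "smooth f \<Longrightarrow> continuous_on UNIV f"
  unfolding smooth_def using C_times.simps(1) by blast

lemma partial_deriv_eqI:
  "(f has_derivative f') (at x) \<Longrightarrow> partial_deriv i f x = f' (axis i 1)"
  unfolding partial_deriv_def using frechet_derivative_at by metis

text \<open>A differential is determined by its values on the coordinate vectors, so the partial derivatives that occur
in the definition of test functions give the whole derivative.\<close>

lemma has_derivative_grad:
  assumes "f differentiable (at x)"
  shows "(f has_derivative (\<lambda>h. grad f x \<bullet> h)) (at x)"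
proof -
  let ?D = "frechet_derivative f (at x)"
  have D: "(f has_derivative ?D) (at x)"
    using assms frechet_derivative_works by blast
  then have lin: "linear ?D" by (rule has_derivative_linear)
  have "?D h = grad f x \<bullet> h" for h
  proof -
    have "?D h = ?D (\<Sum>i\<in>UNIV. (h $ i) *\<^sub>R axis i 1)"
      using basis_expansion[of h] by (simp add: scalar_mult_eq_scaleR)
    also have "\<dots> = (\<Sum>i\<in>UNIV. (h $ i) * ?D (axis i 1))"
      by (simp add: linear_sum[OF lin] linear_scale[OF lin])
    also have "\<dots> = grad f x \<bullet> h"
      by (simp add: inner_vec_def partial_deriv_def mult.commute)
    finally show ?thesis .
  qed
  then have "?D = (\<lambda>h. grad f x \<bullet> h)" by auto
  with D show ?thesis by simp
qed

lemma grad_eqI: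
  assumes "(f has_derivative (\<lambda>h. v \<bullet> h)) (at x)"
  shows "grad f x = v"
  by (simp add: vec_eq_iff partial_deriv_eqI[OF assms] inner_axis)

lemma partial_deriv_const [simp]: "partial_deriv i (\<lambda>x. c) = (\<lambda>x. 0)"
  by (rule ext, rule partial_deriv_eqI) (auto intro!: derivative_eq_intros)

lemma partial_deriv_add:
  assumes "\<And>x. f differentiable (at x)" "\<And>x. g differentiable (at x)"
  shows "partial_deriv i (\<lambda>x. f x + g x) = (\<lambda>x. partial_deriv i f x + partial_deriv i g x)"
proof
  fix x
  show "partial_deriv i (\<lambda>x. f x + g x) x = partial_deriv i f x + partial_deriv i g x"
    using partial_deriv_eqI[OF has_derivative_add[OF has_derivative_grad has_derivative_grad],
        OF assms(1)[of x] assms(2)[of x], of i]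
    by (simp add: inner_axis)
qed

lemma partial_deriv_mult:
  assumes "\<And>x. f differentiable (at x)" "\<And>x. g differentiable (at x)"
  shows "partial_deriv i (\<lambda>x. f x * g x)
    = (\<lambda>x. f x * partial_deriv i g x + partial_deriv i f x * g x)"
proof
  fix x
  show "partial_deriv i (\<lambda>x. f x * g x) x = f x * partial_deriv i g x + partial_deriv i f x * g x"
    using partial_deriv_eqI[OF has_derivative_mult[OF has_derivative_grad has_derivative_grad],
        OF assms(1)[of x] assms(2)[of x], of i]
    by (simp add: inner_axis)
qed

lemma C_times_const: "C_times m (\<lambda>x. c)"
  by (induction m arbitrary: c) auto

lemma C_times_add: "C_times m f \<Longrightarrow> C_times m g \<Longrightarrow> C_times m (\<lambda>x. f x + g x)"
  by (induction m arbitrary: f g)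
     (auto intro!: continuous_intros derivative_intros simp: partial_deriv_add)

lemma C_times_mult: "C_times m f \<Longrightarrow> C_times m g \<Longrightarrow> C_times m (\<lambda>x. f x * g x)"
proof (induction m arbitrary: f g)
  case (Suc m)
  have "C_times m f" "C_times m g" using Suc.prems C_times_SucD by blast+
  with Suc show ?case
    by (auto intro!: derivative_intros C_times_add simp: partial_deriv_mult)
qed (auto intro!: continuous_intros)

lemma smooth_const [simp]: "smooth (\<lambda>x. c)"
  by (simp add: smooth_def C_times_const)

lemma smooth_add: "smooth f \<Longrightarrow> smooth g \<Longrightarrow> smooth (\<lambda>x. f x + g x)"
  by (simp add: smooth_def C_times_add)

lemma smooth_mult: "smooth f \<Longrightarrow> smooth g \<Longrightarrow> smooth (\<lambda>x. f x * g x)"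
  by (simp add: smooth_def C_times_mult)

lemma smooth_diff: "smooth f \<Longrightarrow> smooth g \<Longrightarrow> smooth (\<lambda>x. f x - g x)"
  using smooth_add[OF _ smooth_mult[OF smooth_const[of "-1"]], of f g] by simp

lemma smooth_divide: "smooth f \<Longrightarrow> smooth (\<lambda>x. f x / c)"
  using smooth_mult[OF smooth_const[of "1 / c"], of f] by simp

lemma smooth_nth: "smooth (\<lambda>x. x $ i)"
proof -
  have hd: "((\<lambda>x. x $ i) has_derivative (\<lambda>h. h $ i)) (at x)" for x :: "real^'a"
    by (rule bounded_linear_imp_has_derivative[OF bounded_linear_vec_nth])
  have "partial_deriv j (\<lambda>x. x $ i) = (\<lambda>x. axis j 1 $ i)" for j
    by (rule ext) (rule partial_deriv_eqI[OF hd])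
  moreover have "(\<lambda>x. x $ i) differentiable (at x)" for x :: "real^'a"
    using hd differentiable_def by blast
  ultimately have "C_times m (\<lambda>x. x $ i)" for m
    by (cases m) (auto simp: C_times_const intro!: continuous_intros)
  then show ?thesis by (simp add: smooth_def)
qed

lemma smooth_sum: "(\<And>i. i \<in> A \<Longrightarrow> smooth (f i)) \<Longrightarrow> smooth (\<lambda>x. \<Sum>i\<in>A. f i x)"
  by (induction A rule: infinite_finite_induct) (auto intro!: smooth_add)

lemma smooth_norm_square: "smooth (\<lambda>x. (norm x)\<^sup>2)"
proof -
  have "(\<lambda>x::real^'a. (norm x)\<^sup>2) = (\<lambda>x. \<Sum>i\<in>UNIV. x $ i * x $ i)"
    by (auto simp: power2_norm_eq_inner inner_vec_def)
  then show ?thesis by (simp add: smooth_sum smooth_mult smooth_nth)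
qed

lemma partial_deriv_affine:
  assumes "\<And>x. f differentiable (at x)"
  shows "partial_deriv i (\<lambda>x. f (c *\<^sub>R x + a)) = (\<lambda>x. c * partial_deriv i f (c *\<^sub>R x + a))"
proof
  fix x
  have "((\<lambda>x. f (c *\<^sub>R x + a)) has_derivative (\<lambda>h. grad f (c *\<^sub>R x + a) \<bullet> (c *\<^sub>R h))) (at x)"
    by (rule has_derivative_compose[OF _ has_derivative_grad[OF assms]])
      (auto intro!: derivative_eq_intros)
  from partial_deriv_eqI[OF this, of i]
  show "partial_deriv i (\<lambda>x. f (c *\<^sub>R x + a)) x = c * partial_deriv i f (c *\<^sub>R x + a)"
    by (simp add: inner_axis)
qed

lemma differentiable_affine:
  fixes f :: "real^'n::finite \<Rightarrow> real"
  assumes "\<And>x. f differentiable (at x)"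
  shows "(\<lambda>x. f (c *\<^sub>R x + a)) differentiable (at x)"
proof -
  have "((\<lambda>x. f (c *\<^sub>R x + a)) has_derivative (\<lambda>h. grad f (c *\<^sub>R x + a) \<bullet> (c *\<^sub>R h))) (at x)"
    by (rule has_derivative_compose[OF _ has_derivative_grad[OF assms]])
      (auto intro!: derivative_eq_intros)
  then show ?thesis using differentiable_def by blast
qed

lemma C_times_affine: "C_times m f \<Longrightarrow> C_times m (\<lambda>x. f (c *\<^sub>R x + a))"
proof (induction m arbitrary: f)
  case 0
  then show ?case
    by (auto intro!: continuous_on_compose2[of UNIV f] continuous_intros)
next
  case (Suc m)
  then show ?case
    by (auto intro!: differentiable_affine C_times_mult C_times_const simp: partial_deriv_affine)
qed

lemma smooth_affine: "smooth f \<Longrightarrow> smooth (\<lambda>x. f (c *\<^sub>R x + a))"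
  by (simp add: smooth_def C_times_affine)

text \<open>The derivatives of \<open>exp (-1/t)\<close> are combinations of \<open>exp (-1/t) / t\<^sup>k\<close>. Treating the whole family at once
makes it closed under differentiation, so that smoothness follows by induction on the order.\<close>

definition flat_exp :: "nat \<Rightarrow> real \<Rightarrow> real" where
  "flat_exp k t = (if t > 0 then exp (- 1 / t) / t ^ k else 0)"

lemma flat_exp_nonneg: "flat_exp k t \<ge> 0"
  by (simp add: flat_exp_def)

lemma flat_exp_tendsto_0: "(flat_exp k \<longlongrightarrow> 0) (at 0)"
proof -
  have "((\<lambda>t::real. inverse t ^ k / exp (inverse t)) \<longlongrightarrow> 0) (at_right 0)"
    by (rule filterlim_compose[OF tendsto_power_div_exp_0 filterlim_inverse_at_top_right])
  moreover have "\<forall>\<^sub>F t in at_right (0::real). inverse t ^ k / exp (inverse t) = flat_exp k t"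
    using eventually_at_right_less[of 0]
    by eventually_elim (auto simp: flat_exp_def exp_minus field_simps power_inverse)
  ultimately have "(flat_exp k \<longlongrightarrow> 0) (at_right 0)"
    using Lim_transform_eventually by blast
  moreover have "(flat_exp k \<longlongrightarrow> 0) (at_left 0)"
    by (rule tendsto_eventually) (auto simp: eventually_at_filter flat_exp_def)
  ultimately show ?thesis by (simp add: filterlim_split_at)
qed

lemma flat_exp_deriv: "(flat_exp k has_real_derivative flat_exp (k+2) t - k * flat_exp (k+1) t) (at t)"
proof -
  consider "t > 0" | "t < 0" | "t = 0" by linarith
  then show ?thesis
  proof cases
    case 1
    have key: "real k * t ^ (k - Suc 0) = real k * t ^ k / t"
      using 1 by (cases k) auto
    have pw: "((\<lambda>t. t ^ k) has_real_derivative real k * t ^ k / t) (at t)"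
      using DERIV_pow[of k t] by (simp add: key)
    have ex: "((\<lambda>t. exp (- 1 / t)) has_real_derivative exp (- 1 / t) / t\<^sup>2) (at t)"
      using 1 by (auto intro!: derivative_eq_intros simp: power2_eq_square)
    have alg: "(E / t\<^sup>2 * p - E * (real k * p / t)) / (p * p) = E / (p * t\<^sup>2) - k * (E / (p * t))"
      if "p \<noteq> 0" for E p :: real
      using that 1 by (simp add: field_simps power2_eq_square)
    have "((\<lambda>t. exp (- 1 / t) / t ^ k) has_real_derivative flat_exp (k+2) t - k * flat_exp (k+1) t) (at t)"
    proof (rule DERIV_cong[OF DERIV_divide[OF ex pw]])
      have "flat_exp (k+2) t = exp (- 1 / t) / (t ^ k * t\<^sup>2)" "flat_exp (k+1) t = exp (- 1 / t) / (t ^ k * t)"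
        using 1 by (simp_all add: flat_exp_def power_add power2_eq_square)
      then show "(exp (- 1 / t) / t\<^sup>2 * t ^ k - exp (- 1 / t) * (real k * t ^ k / t)) / (t ^ k * t ^ k)
          = flat_exp (k+2) t - k * flat_exp (k+1) t"
        using alg[of "t ^ k" "exp (- 1 / t)"] 1 by (simp only:) simp
    qed (use 1 in simp)
    moreover have "\<forall>\<^sub>F t in nhds t. exp (- 1 / t) / t ^ k = flat_exp k t"
      using eventually_nhds_in_open[of "{0<..}" t] 1
      by (auto elim!: eventually_mono simp: flat_exp_def)
    ultimately show ?thesis
      using DERIV_cong_ev[OF refl _ refl] by fastforce
  next
    case 2
    have "((\<lambda>t. 0) has_real_derivative flat_exp (k+2) t - k * flat_exp (k+1) t) (at t)"
      using 2 by (auto simp: flat_exp_def)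
    moreover have "\<forall>\<^sub>F t in nhds t. 0 = flat_exp k t"
      using eventually_nhds_in_open[of "{..<0}" t] 2
      by (auto elim!: eventually_mono simp: flat_exp_def)
    ultimately show ?thesis
      using DERIV_cong_ev[OF refl _ refl] by fastforce
  next
    case 3
    have quot: "\<forall>\<^sub>F h in at 0. flat_exp (Suc k) h = (flat_exp k (0 + h) - flat_exp k 0) / h"
      by (auto simp: eventually_at_filter flat_exp_def field_simps)
    have "((\<lambda>h. (flat_exp k (0 + h) - flat_exp k 0) / h) \<longlongrightarrow> 0) (at 0)"
      by (rule Lim_transform_eventually[OF flat_exp_tendsto_0 quot])
    then show ?thesis using 3 by (simp add: DERIV_def) (simp add: flat_exp_def)
  qed
qed

lemma flat_exp_comp_has_derivative:
  assumes "f differentiable (at x)"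
  shows "((\<lambda>x. flat_exp k (f x)) has_derivative (\<lambda>h. ((flat_exp (k+2) (f x) - k * flat_exp (k+1) (f x)) *\<^sub>R grad f x) \<bullet> h)) (at x)"
  using has_derivative_compose[OF has_derivative_grad[OF assms]
      flat_exp_deriv[of k "f x", unfolded has_field_derivative_def]]
  by simp


lemma flat_exp_continuous: "continuous_on UNIV (flat_exp k)"
  using flat_exp_deriv DERIV_isCont continuous_at_imp_continuous_on by blast

text \<open>Each derivative raises the index \<open>k\<close>, hence the induction has to be uniform in \<open>k\<close>.\<close>

lemma C_times_flat_exp_comp: "smooth f \<Longrightarrow> C_times m (\<lambda>x. flat_exp k (f x))"
proof (induction m arbitrary: k)
  case 0
  then show ?case
    using continuous_on_compose2[OF flat_exp_continuous smooth_continuous[OF 0]] by simp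
next
  case (Suc m)
  have "partial_deriv i (\<lambda>x. flat_exp k (f x)) = (\<lambda>x. (flat_exp (k+2) (f x) + (- real k) * flat_exp (k+1) (f x)) * partial_deriv i f x)" for i
    using partial_deriv_eqI[OF flat_exp_comp_has_derivative[OF smooth_differentiable[OF Suc.prems]]]
    by (auto simp: inner_axis fun_eq_iff)
  moreover have "C_times m (partial_deriv i f)" for i
    using smooth_partial[OF Suc.prems] by (simp add: smooth_def)
  moreover have "C_times m (\<lambda>x. flat_exp (k+2) (f x) + (- real k) * flat_exp (k+1) (f x))"
    by (intro C_times_mult C_times_add C_times_const Suc)
  moreover have "(\<lambda>x. flat_exp k (f x)) differentiable (at x)" for x
    using flat_exp_comp_has_derivative[OF smooth_differentiable[OF Suc.prems]]
    unfolding differentiable_def by blast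
  ultimately show ?case by (simp only: C_times.simps simp_thms) (intro allI C_times_mult; simp)
qed

lemma smooth_flat_exp_comp: "smooth f \<Longrightarrow> smooth (\<lambda>x. flat_exp k (f x))"
  proof -
  assume "smooth f"
  then have "\<forall>m. C_times m (\<lambda>x. flat_exp k (f x))" using C_times_flat_exp_comp by fast
  then show ?thesis unfolding smooth_def .
qed

lemma test_functionsI:
  assumes "smooth f" "compact K" "K \<subseteq> \<Omega>" "\<And>x. x \<notin> K \<Longrightarrow> f x = 0"
  shows "f \<in> test_functions \<Omega>"
proof -
  have "closure {x. f x \<noteq> 0} \<subseteq> K"
    using assms(2,4) compact_imp_closed by (intro closure_minimal) auto
  moreover from this have "compact (closure {x. f x \<noteq> 0})"
    using assms(2) compact_Int_closed[OF assms(2) closed_closure, of "{x. f x \<noteq> 0}"]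
    by (simp add: Int_absorb1)
  ultimately show ?thesis
    using assms by (auto simp: test_functions_def smooth_def)
qed

lemma test_functions_smooth: "f \<in> test_functions \<Omega> \<Longrightarrow> smooth f"
  by (simp add: test_functions_def smooth_def)

lemma test_functionsE:
  assumes "f \<in> test_functions \<Omega>"
  obtains K where "compact K" "K \<subseteq> \<Omega>" "\<And>x. x \<notin> K \<Longrightarrow> f x = 0"
proof
  show "compact (closure {x. f x \<noteq> 0})" "closure {x. f x \<noteq> 0} \<subseteq> \<Omega>"
    using assms by (auto simp: test_functions_def)
  show "x \<notin> closure {x. f x \<noteq> 0} \<Longrightarrow> f x = 0" for x
    using closure_subset[of "{x. f x \<noteq> 0}"] by auto
qed

lemma test_functions_mult:
  assumes "f \<in> test_functions \<Omega>" "smooth g"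
  shows "(\<lambda>x. f x * g x) \<in> test_functions \<Omega>"
proof -
  obtain K where "compact K" "K \<subseteq> \<Omega>" "\<And>x. x \<notin> K \<Longrightarrow> f x = 0"
    using test_functionsE[OF assms(1)] by blast
  then show ?thesis
    by (intro test_functionsI[of _ K] smooth_mult test_functions_smooth[OF assms(1)] assms(2)) auto
qed

lemma test_functions_mono: "\<Omega> \<subseteq> \<Omega>' \<Longrightarrow> f \<in> test_functions \<Omega> \<Longrightarrow> f \<in> test_functions \<Omega>'"
  by (auto simp: test_functions_def)

lemma partial_deriv_locally_zero:
  assumes "open U" "x \<in> U" "\<And>y. y \<in> U \<Longrightarrow> f y = c"
  shows "partial_deriv i f x = 0"
proof -
  have "(f has_derivative (\<lambda>h. 0)) (at x)"
    by (rule has_derivative_transform_within_open[of "\<lambda>x. c" _ _ _ U]) (use assms in auto)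
  then show ?thesis by (rule partial_deriv_eqI)
qed

lemma partial_deriv_zero_outside:
  assumes "compact K" "x \<notin> K" "\<And>x. x \<notin> K \<Longrightarrow> f x = 0"
  shows "partial_deriv i f x = 0"
  using partial_deriv_locally_zero[of "-K" x f 0] assms compact_imp_closed by (auto simp: open_Compl)

lemma test_functions_partial:
  assumes "f \<in> test_functions \<Omega>"
  shows "partial_deriv i f \<in> test_functions \<Omega>"
proof -
  obtain K where "compact K" "K \<subseteq> \<Omega>" "\<And>x. x \<notin> K \<Longrightarrow> f x = 0"
    using test_functionsE[OF assms(1)] by blast
  then show ?thesis
    by (intro test_functionsI[of _ K] smooth_partial test_functions_smooth[OF assms(1)]
        partial_deriv_zero_outside) auto
qed

definition mollifier :: "real \<Rightarrow> (real^'n::finite \<Rightarrow> real) \<Rightarrow> bool" where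
  "mollifier d \<rho> \<longleftrightarrow> smooth \<rho> \<and> (\<forall>x. 0 \<le> \<rho> x) \<and> (\<forall>x. d \<le> norm x \<longrightarrow> \<rho> x = 0) \<and>
     integrable lborel \<rho> \<and> (\<integral>x. \<rho> x \<partial>lborel) = 1"

lemma integrable_continuous_compact_support:
  fixes f :: "real^'n::finite \<Rightarrow> real"
  assumes "continuous_on UNIV f" "compact K" "\<And>x. x \<notin> K \<Longrightarrow> f x = 0"
  shows "integrable lborel f"
proof -
  have "integrable lborel (\<lambda>x. indicator K x *\<^sub>R f x)"
    by (rule borel_integrable_compact[OF assms(2)]) (use assms(1) continuous_on_subset in blast)
  moreover have "(\<lambda>x. indicator K x *\<^sub>R f x) = f"
    using assms(3) by (auto simp: indicator_def fun_eq_iff)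
  ultimately show ?thesis by simp
qed

text \<open>The function \<open>exp (-1/(d\<^sup>2 - |x|\<^sup>2))\<close> on the ball of radius \<open>d\<close>, divided by its integral.\<close>

lemma mollifier_exists:
  assumes "d > 0" shows "\<exists>\<rho>::real^'n::finite \<Rightarrow> real. mollifier d \<rho>"
proof -
  define b :: "real^'n \<Rightarrow> real" where "b = (\<lambda>x. flat_exp 0 (d\<^sup>2 - (norm x)\<^sup>2))"
  have sm: "smooth b" unfolding b_def
    by (intro smooth_flat_exp_comp smooth_diff smooth_const smooth_norm_square)
  have z: "b x = 0" if "d \<le> norm x" for x
    using that assms by (simp add: b_def flat_exp_def not_less power_mono)
  have int: "integrable lborel b"
    by (rule integrable_continuous_compact_support[of _ "cball 0 d"])
      (use sm z in \<open>auto intro: smooth_continuous\<close>)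
  have nn: "0 \<le> b x" for x by (simp add: b_def flat_exp_nonneg)
  have "(\<integral>x. b x \<partial>lborel) \<noteq> 0"
  proof
    assume "(\<integral>x. b x \<partial>lborel) = 0"
    then have "AE x in lborel. b x = 0"
      using integral_nonneg_eq_0_iff_AE[OF int] nn by simp
    then have "emeasure lborel {x\<in>space lborel. \<not> b x = 0} = 0"
      using AE_iff_measurable[OF _ refl, of lborel "\<lambda>x. b x = 0"] int by auto
    moreover have "ball 0 d \<subseteq> {x\<in>space lborel. \<not> b x = 0}"
    proof
      fix x :: "real^'n" assume "x \<in> ball 0 d"
      then have "(norm x)\<^sup>2 < d\<^sup>2" by (intro power_strict_mono) auto
      then show "x \<in> {x\<in>space lborel. \<not> b x = 0}" by (simp add: b_def flat_exp_def)
    qed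
    ultimately have "emeasure lborel (ball 0 d :: (real^'n) set) = 0"
      using emeasure_mono[of "ball 0 d" "{x\<in>space lborel. \<not> b x = 0}" lborel] int by fastforce
    then show False
      using assms emeasure_ball[of d "0::real^'n"] by (simp add: unit_ball_vol_pos zero_less_power less_imp_neq[symmetric])
  qed
  moreover have "(\<integral>x. b x \<partial>lborel) \<ge> 0" using nn by simp
  ultimately have pos: "(\<integral>x. b x \<partial>lborel) > 0" by simp
  have "mollifier d (\<lambda>x. b x / (\<integral>x. b x \<partial>lborel))"
    unfolding mollifier_def using sm z int nn pos by (auto intro!: smooth_divide)
  then show ?thesis by blast
qed

section \<open>Convolution with a mollifier\<close>

text \<open>With values in \<open>ennreal\<close>, so that no integrability has to be checked before estimates are combined.\<close>

definition sqnorm :: "(real^'n::finite \<Rightarrow> 'b::euclidean_space) \<Rightarrow> ennreal" where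
  "sqnorm f = (\<integral>\<^sup>+x. ennreal ((norm (f x))\<^sup>2) \<partial>lborel)"

definition conv :: "(real^'n::finite \<Rightarrow> real) \<Rightarrow> (real^'n \<Rightarrow> real) \<Rightarrow> real^'n \<Rightarrow> real" where
  "conv f \<rho> x = (\<integral>y. f y * \<rho> (x - y) \<partial>lborel)"

lemma lborel_distr_reflect: "distr lborel borel (\<lambda>y. a - y) = (lborel :: (real^'n::finite) measure)"
proof -
  have "density (distr lborel borel (\<lambda>y. a - y)) (\<lambda>_. 1) = (lborel :: (real^'n) measure)"
    using lborel_affine[of "-1" a] by (simp add: one_ennreal_def)
  then show ?thesis by (simp add: density_1)
qed

lemma nn_integral_lborel_shift:
  fixes f :: "real^'n::finite \<Rightarrow> ennreal"
  assumes [measurable]: "f \<in> borel_measurable borel"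
  shows "(\<integral>\<^sup>+y. f (y + a) \<partial>lborel) = (\<integral>\<^sup>+y. f y \<partial>lborel)"
  using nn_integral_distr[of "\<lambda>y. a + y" lborel borel f] by (simp add: lborel_distr_plus) (simp add: add.commute)

lemma integral_lborel_reflect:
  fixes f :: "real^'n::finite \<Rightarrow> real"
  assumes [measurable]: "f \<in> borel_measurable borel"
  shows "(\<integral>y. f (a - y) \<partial>lborel) = (\<integral>y. f y \<partial>lborel)"
  using integral_distr[of "\<lambda>y. a - y" lborel borel f] by (simp add: lborel_distr_reflect)

lemma integral_lborel_shift:
  fixes f :: "real^'n::finite \<Rightarrow> real"
  assumes [measurable]: "f \<in> borel_measurable borel"
  shows "(\<integral>y. f (y + a) \<partial>lborel) = (\<integral>y. f y \<partial>lborel)"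
  using integral_distr[of "\<lambda>y. a + y" lborel borel f] by (simp add: lborel_distr_plus) (simp add: add.commute)

lemma integrable_lborel_reflect:
  fixes f :: "real^'n::finite \<Rightarrow> real"
  assumes "integrable lborel f"
  shows "integrable lborel (\<lambda>y. f (a - y))"
  using integrable_distr_eq[of "\<lambda>y. a - y" lborel borel f] assms by (simp add: lborel_distr_reflect)

lemma continuous_compact_support_bounded:
  fixes f :: "real^'n::finite \<Rightarrow> 'b::real_normed_vector"
  assumes "continuous_on UNIV f" "compact K" "\<And>x. x \<notin> K \<Longrightarrow> f x = 0"
  obtains C where "0 \<le> C" "\<And>x. norm (f x) \<le> C"
proof -
  have "bounded (f ` K)"
    using assms by (intro compact_imp_bounded compact_continuous_image) (auto intro: continuous_on_subset)
  then obtain C where "\<And>x. x \<in> K \<Longrightarrow> norm (f x) \<le> C" by (auto simp: bounded_iff)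
  then have "norm (f x) \<le> max C 0" for x
    using assms(3)[of x] by (cases "x \<in> K") (auto simp: le_max_iff_disj)
  then show ?thesis using that[of "max C 0"] by auto
qed

lemma continuous_compact_support_uniformly:
  fixes f :: "real^'n::finite \<Rightarrow> 'b::real_normed_vector"
  assumes "continuous_on UNIV f" "compact K" "\<And>x. x \<notin> K \<Longrightarrow> f x = 0" "e > 0"
  obtains d where "d > 0" "\<And>x y. norm (x - y) < d \<Longrightarrow> norm (f x - f y) < e"
proof -
  obtain R where R: "\<And>x. x \<in> K \<Longrightarrow> norm x \<le> R"
    using compact_imp_bounded[OF assms(2)] by (auto simp: bounded_iff)
  have "uniformly_continuous_on (cball 0 (R+1)) f"
    by (rule compact_uniformly_continuous) (use assms(1) continuous_on_subset in auto)
  then obtain d where d: "d > 0" "\<And>x y. \<lbrakk>x \<in> cball 0 (R+1); y \<in> cball 0 (R+1); dist y x < d\<rbrakk> \<Longrightarrow> dist (f y) (f x) < e"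
    using \<open>e > 0\<close> unfolding uniformly_continuous_on_def by metis
  show ?thesis
  proof (rule that[of "min d 1"])
    fix x y :: "real^'n" assume xy: "norm (x - y) < min d 1"
    show "norm (f x - f y) < e"
    proof (cases "norm x \<le> R+1 \<and> norm y \<le> R+1")
      case True
      then show ?thesis using d(2)[of y x] xy by (simp add: dist_norm)
    next
      case False
      have "norm x \<le> norm y + norm (x - y)" "norm y \<le> norm x + norm (x - y)"
        using norm_triangle_ineq2[of x y] norm_triangle_ineq3[of x y] by linarith+
      then have "norm x > R" "norm y > R" using False xy by linarith+
      then have "f x = 0" "f y = 0" using R assms(3) by force+
      then show ?thesis using assms by simp
    qed
  qed (use d in auto)
qed

lemma grad_continuous: "smooth f \<Longrightarrow> continuous_on UNIV (grad f)"
  unfolding grad_def by (intro continuous_on_vec_lambda smooth_continuous smooth_partial)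

text \<open>Uniformity in \<open>x\<close> comes from the uniform continuity of the gradient, which has compact support. It is what
allows differentiation under the integral sign against a merely integrable function.\<close>

lemma test_function_linearization:
  assumes \<rho>: "\<rho> \<in> test_functions \<Omega>" and "e > 0"
  obtains d where "d > 0"
    "\<And>x h. norm h < d \<Longrightarrow> \<bar>\<rho> (x + h) - \<rho> x - grad \<rho> x \<bullet> h\<bar> \<le> e * norm h"
proof -
  obtain K where K: "compact K" "\<And>x. x \<notin> K \<Longrightarrow> \<rho> x = 0"
    using test_functionsE[OF \<rho>] by metis
  have sm: "smooth \<rho>" by (rule test_functions_smooth[OF \<rho>])
  have "grad \<rho> x = 0" if "x \<notin> K" for x
    using partial_deriv_zero_outside[OF K(1) that K(2)] by (simp add: vec_eq_iff)
  then obtain d where d: "d > 0" "\<And>x y. norm (x - y) < d \<Longrightarrow> norm (grad \<rho> x - grad \<rho> y) < e"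
    using continuous_compact_support_uniformly[OF grad_continuous[OF sm] K(1) _ \<open>e > 0\<close>] by metis
  show ?thesis
  proof (rule that[OF d(1)])
    fix x h :: "real^'a" assume h: "norm h < d"
    have "norm (\<rho> (x+h) - \<rho> x - (\<lambda>x h. grad \<rho> x \<bullet> h) x (x + h - x)) \<le> norm (x + h - x) * e"
    proof (rule differentiable_bound_linearization[where S = "ball x d" and f' = "\<lambda>x h. grad \<rho> x \<bullet> h" and ?x0.0 = x])
      fix t :: real assume "t \<in> {0..1}"
      then have "norm (t *\<^sub>R h) \<le> 1 * norm h" unfolding norm_scaleR by (intro mult_right_mono) auto
      then show "x + t *\<^sub>R (x + h - x) \<in> ball x d" using h by (simp add: dist_norm)
    next
      fix y
      show "(\<rho> has_derivative (\<lambda>h. grad \<rho> y \<bullet> h)) (at y within ball x d)"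
        by (rule has_derivative_at_withinI[OF has_derivative_grad[OF smooth_differentiable[OF sm]]])
      assume "y \<in> ball x d"
      then have "norm (grad \<rho> y - grad \<rho> x) \<le> e"
        using d(2)[of y x] by (simp add: dist_norm norm_minus_commute)
      then have "\<bar>(grad \<rho> y - grad \<rho> x) \<bullet> h\<bar> \<le> e * norm h" for h
        using order_trans[OF Cauchy_Schwarz_ineq2 mult_right_mono] norm_ge_zero by blast
      then show "onorm ((\<lambda>h. grad \<rho> y \<bullet> h) - (\<lambda>h. grad \<rho> x \<bullet> h)) \<le> e"
        using \<open>e > 0\<close> by (intro onorm_bound) (simp_all add: inner_diff_left fun_diff_def)
    qed (use d in auto)
    then show "\<bar>\<rho> (x + h) - \<rho> x - grad \<rho> x \<bullet> h\<bar> \<le> e * norm h"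
      by (simp add: mult.commute)
  qed
qed

lemma integrable_mult_bounded:
  fixes f g :: "'a \<Rightarrow> real"
  assumes "integrable M f" "g \<in> borel_measurable M" "\<And>x. \<bar>g x\<bar> \<le> C"
  shows "integrable M (\<lambda>x. f x * g x)"
proof (rule Bochner_Integration.integrable_bound)
  show "integrable M (\<lambda>x. C * f x)" using assms by simp
  have "\<bar>f x\<bar> * \<bar>g x\<bar> \<le> \<bar>f x\<bar> * \<bar>C\<bar>" for x
    using assms(3)[of x] by (intro mult_left_mono) auto
  then show "AE x in M. norm (f x * g x) \<le> norm (C * f x)"
    by (auto simp: abs_mult mult.commute)
qed (use assms in auto)

lemma test_function_facts:
  assumes "\<rho> \<in> test_functions \<Omega>"
  shows "\<rho> \<in> borel_measurable borel" "integrable lborel \<rho>" "\<exists>C. \<forall>x. \<bar>\<rho> x\<bar> \<le> C" "continuous_on UNIV \<rho>"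
proof -
  obtain K where K: "compact K" "\<And>x. x \<notin> K \<Longrightarrow> \<rho> x = 0"
    using test_functionsE[OF assms] by metis
  show c: "continuous_on UNIV \<rho>" using smooth_continuous[OF test_functions_smooth[OF assms]] .
  then show "\<rho> \<in> borel_measurable borel" by (rule borel_measurable_continuous_onI)
  show "integrable lborel \<rho>" by (rule integrable_continuous_compact_support[OF c K])
  show "\<exists>C. \<forall>x. \<bar>\<rho> x\<bar> \<le> C"
    using continuous_compact_support_bounded[OF c K] by (metis real_norm_def)
qed

lemma norm_integral_le_integral:
  fixes f g :: "'a \<Rightarrow> real"
  assumes "integrable M f" "integrable M g" "\<And>x. norm (f x) \<le> g x"
  shows "norm (integral\<^sup>L M f) \<le> integral\<^sup>L M g"
  using integral_norm_bound[of M f] integral_mono[OF integrable_norm[OF assms(1)] assms(2,3)] by linarith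

lemma integrable_conv:
  assumes f: "integrable lborel f" and \<rho>: "\<rho> \<in> test_functions \<Omega>"
  shows "integrable lborel (\<lambda>y. f y * \<rho> (x - y))"
proof -
  obtain C where "\<And>x. \<bar>\<rho> x\<bar> \<le> C" using test_function_facts(3)[OF \<rho>] by blast
  then show ?thesis
    using measurable_compose[OF _ test_function_facts(1)[OF \<rho>], of "\<lambda>y. x - y" lborel]
    by (intro integrable_mult_bounded[OF f]) auto
qed

lemma conv_has_derivative:
  assumes f: "integrable lborel f" and \<rho>: "\<rho> \<in> test_functions \<Omega>"
  shows "(conv f \<rho> has_derivative (\<lambda>h. (\<chi> i. conv f (partial_deriv i \<rho>) x) \<bullet> h)) (at x)"
  unfolding has_derivative_at_alt
proof (intro conjI allI impI)
  fix e :: real assume "e > 0"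
  define M where "M = (\<integral>y. \<bar>f y\<bar> \<partial>lborel) + 1"
  have M: "M > 0" by (simp add: M_def add_nonneg_pos)
  obtain d where d: "d > 0" 
    "\<And>x h. norm h < d \<Longrightarrow> \<bar>\<rho> (x + h) - \<rho> x - grad \<rho> x \<bullet> h\<bar> \<le> e / M * norm h"
    using test_function_linearization[OF \<rho>, of "e / M"] \<open>e > 0\<close> M by auto
  note [simp] = integrable_conv[OF f \<rho>] integrable_conv[OF f test_functions_partial[OF \<rho>]]
  have "norm (conv f \<rho> z - conv f \<rho> x - (\<chi> i. conv f (partial_deriv i \<rho>) x) \<bullet> (z - x)) \<le> e * norm (z - x)"
    if z: "norm (z - x) < d" for z
  proof -
    define h where "h = z - x"
    have eq: "(\<lambda>y. f y * (grad \<rho> (x - y) \<bullet> h)) = (\<lambda>y. \<Sum>i\<in>UNIV. f y * partial_deriv i \<rho> (x - y) * h $ i)"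
      by (simp add: inner_vec_def sum_distrib_left mult.assoc)
    have int1: "integrable lborel (\<lambda>y. f y * (grad \<rho> (x - y) \<bullet> h))"
      unfolding eq by simp
    have "(\<chi> i. conv f (partial_deriv i \<rho>) x) \<bullet> h = (\<integral>y. f y * (grad \<rho> (x - y) \<bullet> h) \<partial>lborel)"
      unfolding eq by (simp add: inner_vec_def conv_def)
    then have "conv f \<rho> z - conv f \<rho> x - (\<chi> i. conv f (partial_deriv i \<rho>) x) \<bullet> h
      = (\<integral>y. f y * \<rho> (z - y) - f y * \<rho> (x - y) - f y * (grad \<rho> (x - y) \<bullet> h) \<partial>lborel)"
      using int1 by (simp add: conv_def)
    also have "norm \<dots> \<le> (\<integral>y. \<bar>f y\<bar> * (e / M * norm h) \<partial>lborel)"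
    proof (rule norm_integral_le_integral)
      fix y
      have "\<bar>\<rho> (x - y + h) - \<rho> (x - y) - grad \<rho> (x - y) \<bullet> h\<bar> \<le> e / M * norm h"
        using d(2)[of h] z unfolding h_def by blast
      then have "\<bar>f y\<bar> * \<bar>\<rho> (z - y) - \<rho> (x - y) - grad \<rho> (x - y) \<bullet> h\<bar> \<le> \<bar>f y\<bar> * (e / M * norm h)"
        by (intro mult_left_mono) (simp_all add: h_def algebra_simps)
      then show "norm (f y * \<rho> (z - y) - f y * \<rho> (x - y) - f y * (grad \<rho> (x - y) \<bullet> h)) \<le> \<bar>f y\<bar> * (e / M * norm h)"
        by (simp add: abs_mult[symmetric] right_diff_distrib)
    qed (use int1 f in simp_all)
    also have "\<dots> = (\<integral>y. \<bar>f y\<bar> \<partial>lborel) * (e / M * norm h)" using f by simp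
    also have "\<dots> \<le> M * (e / M * norm h)"
      using \<open>e > 0\<close> M by (intro mult_right_mono) (auto simp: M_def)
    also have "\<dots> = e * norm h" using M by simp
    finally show ?thesis by (simp add: h_def)
  qed
  with d(1) show "\<exists>d>0. \<forall>z. norm (z - x) < d \<longrightarrow>
      norm (conv f \<rho> z - conv f \<rho> x - (\<chi> i. conv f (partial_deriv i \<rho>) x) \<bullet> (z - x)) \<le> e * norm (z - x)"
    by blast
qed (rule bounded_linear_inner_right)

lemma partial_deriv_conv:
  assumes "integrable lborel f" "\<rho> \<in> test_functions \<Omega>"
  shows "partial_deriv i (conv f \<rho>) = conv f (partial_deriv i \<rho>)"
  by (rule ext, subst partial_deriv_eqI[OF conv_has_derivative[OF assms]]) (simp add: inner_axis)

lemma smooth_conv: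
  assumes f: "integrable lborel f" and \<rho>: "\<rho> \<in> test_functions \<Omega>"
  shows "smooth (conv f \<rho>)"
proof -
  have diff: "conv f \<rho> differentiable (at x)" if "\<rho> \<in> test_functions \<Omega>" for x and \<rho> :: "real^'a \<Rightarrow> real"
    using conv_has_derivative[OF f that] differentiable_def by blast
  have "C_times m (conv f \<rho>)" for m
    using \<rho>
  proof (induction m arbitrary: \<rho>)
    case 0
    then show ?case using diff
      by (auto intro!: continuous_at_imp_continuous_on differentiable_imp_continuous_within)
  next
    case (Suc m)
    then show ?case
      using diff[OF Suc.prems] by (simp add: partial_deriv_conv[OF f Suc.prems] test_functions_partial)
  qed
  then show ?thesis by (simp add: smooth_def)
qed

lemma mollifier_test: "mollifier d \<rho> \<Longrightarrow> \<rho> \<in> test_functions UNIV"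
  by (rule test_functionsI[of _ "cball 0 d"]) (auto simp: mollifier_def)

lemma conv_zero:
  assumes "mollifier d \<rho>" "\<And>y. norm (x - y) < d \<Longrightarrow> f y = 0"
  shows "conv f \<rho> x = 0"
proof -
  have "f y * \<rho> (x - y) = 0" for y
    using assms by (cases "norm (x - y) < d") (auto simp: mollifier_def)
  then show ?thesis unfolding conv_def by (simp only:) simp
qed

lemma mollifier_reflect:
  assumes "mollifier d \<rho>"
  shows "integrable lborel (\<lambda>y. \<rho> (x - y))" "(\<integral>y. \<rho> (x - y) \<partial>lborel) = 1"
  using assms integrable_lborel_reflect[of \<rho> x] integral_lborel_reflect[of \<rho> x]
    test_function_facts(1)[OF mollifier_test[OF assms]]
  by (auto simp: mollifier_def)

text \<open>A convolution with a mollifier is a weighted mean over a small ball.\<close>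

lemma conv_close:
  assumes \<rho>: "mollifier d \<rho>" and int: "integrable lborel (\<lambda>y. f y * \<rho> (x - y))"
    and close: "\<And>y. norm (x - y) < d \<Longrightarrow> \<bar>f y - c\<bar> \<le> e"
  shows "\<bar>conv f \<rho> x - c\<bar> \<le> e"
proof -
  note r = mollifier_reflect[OF \<rho>, of x]
  have "conv f \<rho> x - c = (\<integral>y. f y * \<rho> (x - y) - c * \<rho> (x - y) \<partial>lborel)"
    using int r by (simp add: conv_def)
  also have "norm \<dots> \<le> (\<integral>y. e * \<rho> (x - y) \<partial>lborel)"
  proof (rule norm_integral_le_integral)
    fix y
    show "norm (f y * \<rho> (x - y) - c * \<rho> (x - y)) \<le> e * \<rho> (x - y)"
    proof (cases "norm (x - y) < d")
      case True
      then show ?thesis using close[OF True] \<rho>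
        by (auto simp: mollifier_def abs_mult left_diff_distrib[symmetric] intro!: mult_right_mono)
    next
      case False
      then show ?thesis using \<rho> by (simp add: mollifier_def)
    qed
  qed (use int r in auto)
  also have "\<dots> = e" using r by simp
  finally show ?thesis by simp
qed

section \<open>Mollification in the mean square\<close>

lemma sqnorm_mono: "(\<And>x. norm (f x) \<le> norm (g x)) \<Longrightarrow> sqnorm f \<le> sqnorm g"
  unfolding sqnorm_def by (intro nn_integral_mono ennreal_leI power_mono) auto

lemma sqnorm_add:
  fixes f g :: "real^'n::finite \<Rightarrow> 'b::euclidean_space"
  assumes [measurable]: "f \<in> borel_measurable borel" "g \<in> borel_measurable borel"
  shows "sqnorm (\<lambda>x. f x + g x) \<le> 2 * sqnorm f + 2 * sqnorm g"
proof -
  have "(norm (f x + g x))\<^sup>2 \<le> 2 * (norm (f x))\<^sup>2 + 2 * (norm (g x))\<^sup>2" for x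
  proof -
    have "(norm (f x + g x))\<^sup>2 \<le> (norm (f x) + norm (g x))\<^sup>2"
      by (intro power_mono norm_triangle_ineq) auto
    also have "\<dots> \<le> 2 * (norm (f x))\<^sup>2 + 2 * (norm (g x))\<^sup>2"
      using sum_squares_bound[of "norm (f x)" "norm (g x)"] by (simp add: power2_sum)
    finally show ?thesis .
  qed
  then have "sqnorm (\<lambda>x. f x + g x) \<le> (\<integral>\<^sup>+x. 2 * ennreal ((norm (f x))\<^sup>2) + 2 * ennreal ((norm (g x))\<^sup>2) \<partial>lborel)"
    unfolding sqnorm_def
    by (intro nn_integral_mono) (simp add: ennreal_plus[symmetric] ennreal_mult''[symmetric] ennreal_numeral[symmetric]
        del: ennreal_plus ennreal_numeral)
  also have "\<dots> = 2 * sqnorm f + 2 * sqnorm g"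
    by (simp add: sqnorm_def nn_integral_add nn_integral_cmult)
  finally show ?thesis .
qed

lemma sqnorm_minus_commute: "sqnorm (\<lambda>x. f x - g x) = sqnorm (\<lambda>x. g x - f x)"
  by (simp add: sqnorm_def norm_minus_commute)

lemma sqnorm_diff:
  fixes f g :: "real^'n::finite \<Rightarrow> 'b::euclidean_space"
  assumes [measurable]: "f \<in> borel_measurable borel" "g \<in> borel_measurable borel"
  shows "sqnorm (\<lambda>x. f x - g x) \<le> 2 * sqnorm f + 2 * sqnorm g"
  using sqnorm_add[of f "\<lambda>x. - g x"] by (simp add: sqnorm_def)

lemma sqnorm_triangle:
  fixes f g h :: "real^'n::finite \<Rightarrow> 'b::euclidean_space"
  assumes [measurable]: "f \<in> borel_measurable borel" "g \<in> borel_measurable borel" "h \<in> borel_measurable borel"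
  shows "sqnorm (\<lambda>x. f x - h x) \<le> 2 * sqnorm (\<lambda>x. f x - g x) + 2 * sqnorm (\<lambda>x. g x - h x)"
  using sqnorm_add[of "\<lambda>x. f x - g x" "\<lambda>x. g x - h x"] by simp

lemma norm_vec_square: "(norm (v::real^'n::finite))\<^sup>2 = (\<Sum>i\<in>UNIV. (v $ i)\<^sup>2)"
  by (simp add: norm_vec_def L2_set_def sum_nonneg)

lemma borel_measurable_vec_nth [measurable (raw)]:
  "f \<in> borel_measurable M \<Longrightarrow> (\<lambda>x. (f x :: real^'n::finite) $ i) \<in> borel_measurable M"
  by (rule borel_measurable_continuous_on[OF continuous_on_component[OF continuous_on_id]]) auto

lemma borel_measurable_vecI:
  fixes f :: "'a \<Rightarrow> real^'n::finite"
  assumes "\<And>i. (\<lambda>x. f x $ i) \<in> borel_measurable M"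
  shows "f \<in> borel_measurable M"
proof -
  have "(\<lambda>x. \<Sum>i\<in>UNIV. (f x $ i) *\<^sub>R (axis i 1 :: real^'n)) \<in> borel_measurable M"
    using assms by measurable
  moreover have "(\<lambda>x. \<Sum>i\<in>UNIV. (f x $ i) *\<^sub>R (axis i 1 :: real^'n)) = f"
    using basis_expansion[of "f _"] by (simp add: scalar_mult_eq_scaleR fun_eq_iff)
  ultimately show ?thesis by simp
qed

lemma sqnorm_components:
  fixes G :: "real^'n::finite \<Rightarrow> real^'n"
  assumes [measurable]: "G \<in> borel_measurable borel"
  shows "sqnorm G = (\<Sum>i\<in>UNIV. sqnorm (\<lambda>x. G x $ i))"
  by (simp add: sqnorm_def norm_vec_square sum_ennreal[symmetric] nn_integral_sum del: sum_ennreal)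

lemma integrable_square_iff_sqnorm:
  fixes f :: "real^'n::finite \<Rightarrow> 'b::euclidean_space"
  assumes [measurable]: "f \<in> borel_measurable borel"
  shows "integrable lborel (\<lambda>x. (norm (f x))\<^sup>2) \<longleftrightarrow> sqnorm f < \<infinity>"
  by (simp add: integrable_iff_bounded sqnorm_def)

lemma sqnorm_eq_integral:
  fixes f :: "real^'n::finite \<Rightarrow> 'b::euclidean_space"
  assumes [measurable]: "f \<in> borel_measurable borel" and "sqnorm f < \<infinity>"
  shows "sqnorm f = ennreal (\<integral>x. (norm (f x))\<^sup>2 \<partial>lborel)"
  unfolding sqnorm_def using assms integrable_square_iff_sqnorm[of f] by (intro nn_integral_eq_integral) auto

text \<open>Dominated convergence for squares.\<close>

lemma sqnorm_tendsto_0: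
  fixes f :: "nat \<Rightarrow> real^'n::finite \<Rightarrow> 'b::euclidean_space"
  assumes [measurable]: "\<And>k. f k \<in> borel_measurable borel" "w \<in> borel_measurable borel"
    and bd: "\<And>k x. norm (f k x) \<le> norm (w x :: 'c::euclidean_space)" and w: "sqnorm w < \<infinity>"
    and lim: "AE x in lborel. (\<lambda>k. f k x) \<longlonglongrightarrow> 0"
  shows "(\<lambda>k. sqnorm (f k)) \<longlonglongrightarrow> 0"
proof -
  have "(\<lambda>k. sqnorm (f k)) \<longlonglongrightarrow> (\<integral>\<^sup>+x. 0 \<partial>(lborel :: (real^'n) measure))"
    unfolding sqnorm_def
  proof (rule nn_integral_dominated_convergence[where w = "\<lambda>x. ennreal ((norm (w x))\<^sup>2)"])
    show "AE x in lborel. (\<lambda>k. ennreal ((norm (f k x))\<^sup>2)) \<longlonglongrightarrow> 0"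
      using lim
    proof eventually_elim
      case (elim x)
      have "(\<lambda>k. (norm (f k x))\<^sup>2) \<longlonglongrightarrow> (norm (0::'b))\<^sup>2"
        by (intro tendsto_intros elim)
      from tendsto_ennrealI[OF this] show ?case by simp
    qed
  qed (use bd w in \<open>auto simp: sqnorm_def intro!: ennreal_leI power_mono\<close>)
  then show ?thesis by simp
qed

lemma tendsto_0_ennreal_le:
  assumes "u \<longlonglongrightarrow> (0::ennreal)" "e > (0::real)"
  obtains k where "u k \<le> ennreal e"
proof -
  have "\<forall>\<^sub>F k in sequentially. u k < ennreal e"
    using assms by (intro order_tendstoD) auto
  then show ?thesis using that by (auto simp: eventually_sequentially intro: less_imp_le)
qed

text \<open>Truncate \<open>f\<close> in size and support, approximate the truncation almost everywhere by continuous functions, and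
truncate these in the same way so that dominated convergence applies.\<close>

lemma L2_approx_continuous:
  fixes f :: "real^'n::finite \<Rightarrow> real"
  assumes f[measurable]: "f \<in> borel_measurable borel" and fin: "sqnorm f < \<infinity>" and "e > 0"
  obtains c R where "continuous_on UNIV c" "\<And>x. norm x \<ge> R \<Longrightarrow> c x = 0" "sqnorm (\<lambda>x. f x - c x) \<le> ennreal e"
proof -
  define F where "F M x = (if norm x \<le> real M then max (- real M) (min (real M) (f x)) else 0)" for M x
  have F[measurable]: "F M \<in> borel_measurable borel" for M
    unfolding F_def by measurable
  have "(\<lambda>M. sqnorm (\<lambda>x. f x - F M x)) \<longlonglongrightarrow> 0"
  proof (rule sqnorm_tendsto_0[of _ f])
    show "AE x in lborel. (\<lambda>M. f x - F M x) \<longlonglongrightarrow> 0"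
    proof (rule AE_I2)
      fix x
      obtain M0 :: nat where "max (norm x) \<bar>f x\<bar> < real M0" using reals_Archimedean2 by blast
      then have "f x - F M x = 0" if "M \<ge> M0" for M
        using that by (auto simp: F_def)
      then show "(\<lambda>M. f x - F M x) \<longlonglongrightarrow> 0"
        by (intro tendsto_eventually eventually_sequentiallyI[of M0])
    qed
  qed (use fin in \<open>auto simp: F_def\<close>)
  then obtain M where M: "sqnorm (\<lambda>x. f x - F M x) \<le> ennreal (e / 4)"
    using \<open>e > 0\<close> by (elim tendsto_0_ennreal_le[of _ "e / 4"]) auto
  have "F M \<in> borel_measurable lebesgue" 
    using F[of M] by (simp add: borel_measurable_if_D measurable_completion)
  then have "F M measurable_on UNIV"
    using lebesgue_measurable_imp_measurable_on[of "F M" UNIV] by simp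
  then obtain N g where N: "negligible N" and g: "\<And>k. continuous_on UNIV (g k)"
    and lim: "\<And>x. x \<notin> N \<Longrightarrow> (\<lambda>k. g k x) \<longlonglongrightarrow> F M x"
    unfolding measurable_on_def by auto
  define \<kappa> where "\<kappa> x = max 0 (min 1 (real M + 1 - norm x))" for x :: "real^'n"
  define c where "c k x = \<kappa> x * max (- real M) (min (real M) (g k x))" for k x
  have c: "continuous_on UNIV (c k)" for k
    unfolding c_def \<kappa>_def by (intro continuous_intros g)
  have c0: "c k x = 0" if "norm x \<ge> real M + 1" for k x
    using that by (simp add: c_def \<kappa>_def)
  have cM: "\<bar>c k x\<bar> \<le> real M" for k x
  proof -
    have "\<bar>\<kappa> x\<bar> * \<bar>max (- real M) (min (real M) (g k x))\<bar> \<le> 1 * real M"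
      by (intro mult_mono) (auto simp: \<kappa>_def)
    then show ?thesis by (simp add: c_def abs_mult)
  qed
  have [measurable]: "c k \<in> borel_measurable borel" for k
    by (rule borel_measurable_continuous_onI[OF c])
  let ?w = "\<lambda>x::real^'n. 2 * real M * indicator (cball 0 (real M + 1)) x :: real"
  have "(\<lambda>k. sqnorm (\<lambda>x. F M x - c k x)) \<longlonglongrightarrow> 0"
  proof (rule sqnorm_tendsto_0[of _ ?w])
    show "norm (F M x - c k x) \<le> norm (?w x)" for k x
    proof (cases "norm x \<le> real M + 1")
      case True
      have "\<bar>F M x\<bar> \<le> real M" by (auto simp: F_def)
      then show ?thesis using True cM[of k x] by simp
    next
      case False
      then show ?thesis using c0[of x k] by (simp add: F_def)
    qed
    have "sqnorm ?w = (\<integral>\<^sup>+x. ennreal ((2 * real M)\<^sup>2) * indicator (cball 0 (real M + 1)) x \<partial>(lborel :: (real^'n) measure))"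
      unfolding sqnorm_def by (intro nn_integral_cong) (simp add: indicator_def)
    also have "\<dots> < \<infinity>"
      using emeasure_lborel_cball_finite[of "0::real^'n" "real M + 1"] by (simp add: nn_integral_cmult_indicator ennreal_mult_less_top)
    finally show "sqnorm ?w < \<infinity>" .
    show "?w \<in> borel_measurable borel"
      by (intro borel_measurable_times borel_measurable_const borel_measurable_indicator) simp
    have "AE x in lborel. x \<notin> N"
    proof -
      have "AE x in lebesgue. x \<notin> N"
        using N by (intro AE_not_in) (simp add: negligible_iff_null_sets)
      then show ?thesis by (simp add: AE_completion_iff)
    qed
    then show "AE x in lborel. (\<lambda>k. F M x - c k x) \<longlonglongrightarrow> 0"
    proof eventually_elim
      case (elim x)
      have "(\<lambda>k. F M x - c k x) \<longlonglongrightarrow> F M x - \<kappa> x * max (- real M) (min (real M) (F M x))"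
        unfolding c_def by (intro tendsto_intros lim elim)
      moreover have "F M x = \<kappa> x * max (- real M) (min (real M) (F M x))"
        by (auto simp: F_def \<kappa>_def)
      ultimately show ?case by simp
    qed
  qed auto
  then obtain k where k: "sqnorm (\<lambda>x. F M x - c k x) \<le> ennreal (e / 4)"
    using \<open>e > 0\<close> by (elim tendsto_0_ennreal_le[of _ "e / 4"]) auto
  have "sqnorm (\<lambda>x. f x - c k x) \<le> 2 * sqnorm (\<lambda>x. f x - F M x) + 2 * sqnorm (\<lambda>x. F M x - c k x)"
    by (rule sqnorm_triangle) measurable
  also have "\<dots> \<le> 2 * ennreal (e / 4) + 2 * ennreal (e / 4)"
    by (intro add_mono mult_left_mono M k) auto
  also have "\<dots> = ennreal e"
    using \<open>e > 0\<close> by (simp add: ennreal_plus[symmetric] ennreal_mult''[symmetric] ennreal_numeral[symmetric]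
        del: ennreal_plus ennreal_numeral)
  finally show ?thesis using that[OF c c0] by blast
qed

lemma integrable_mult_square:
  fixes f g :: "'a \<Rightarrow> real"
  assumes "integrable M (\<lambda>x. (f x)\<^sup>2)" "integrable M (\<lambda>x. (g x)\<^sup>2)"
    and [measurable]: "f \<in> borel_measurable M" "g \<in> borel_measurable M"
  shows "integrable M (\<lambda>x. f x * g x)"
proof (rule Bochner_Integration.integrable_bound[of _ "\<lambda>x. (f x)\<^sup>2 + (g x)\<^sup>2"])
  have "\<bar>f x * g x\<bar> \<le> (f x)\<^sup>2 + (g x)\<^sup>2" for x
  proof -
    have "2 * \<bar>f x * g x\<bar> \<le> (f x)\<^sup>2 + (g x)\<^sup>2"
      using sum_squares_bound[of "\<bar>f x\<bar>" "\<bar>g x\<bar>"] by (simp add: abs_mult mult.assoc)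
    then show ?thesis using abs_ge_zero[of "f x * g x"] by linarith
  qed
  then show "AE x in M. norm (f x * g x) \<le> norm ((f x)\<^sup>2 + (g x)\<^sup>2)" by auto
qed (use assms in auto)

lemma integrable_conv_L2:
  fixes f :: "real^'n::finite \<Rightarrow> real"
  assumes f[measurable]: "f \<in> borel_measurable borel" "sqnorm f < \<infinity>" and \<rho>: "\<rho> \<in> test_functions \<Omega>"
  shows "integrable lborel (\<lambda>y. f y * \<rho> (x - y))"
proof (rule integrable_mult_square)
  note \<rho>' = test_function_facts[OF \<rho>]
  note [measurable] = \<rho>'(1)
  obtain C where C: "\<And>x. \<bar>\<rho> x\<bar> \<le> C" using \<rho>'(3) by blast
  show "integrable lborel (\<lambda>x. (f x)\<^sup>2)"
    using f(2) integrable_square_iff_sqnorm[of f] by simp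
  show "integrable lborel (\<lambda>y. (\<rho> (x - y))\<^sup>2)"
    unfolding power2_eq_square
    using C by (intro integrable_mult_bounded integrable_lborel_reflect \<rho>') measurable
qed (use test_function_facts(1)[OF \<rho>] in measurable)

lemma conv_borel_measurable:
  assumes [measurable]: "f \<in> borel_measurable borel" "\<rho> \<in> borel_measurable borel"
  shows "conv f \<rho> \<in> borel_measurable borel"
  unfolding conv_def by measurable

text \<open>Young's inequality. The square of a mean is at most the mean of the square, since the variance
\<open>\<integral> (f y - m)\<^sup>2 \<rho> (x - y) dy\<close> about the mean \<open>m\<close> is nonnegative; then integrate in \<open>x\<close> and exchange the order.\<close>

lemma conv_sqnorm_le:
  fixes f :: "real^'n::finite \<Rightarrow> real"
  assumes f[measurable]: "f \<in> borel_measurable borel" and fin: "sqnorm f < \<infinity>" and \<rho>: "mollifier d \<rho>"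
  shows "sqnorm (conv f \<rho>) \<le> sqnorm f"
proof -
  note \<rho>t = mollifier_test[OF \<rho>]
  note [measurable] = test_function_facts(1)[OF \<rho>t]
  have \<rho>0: "0 \<le> \<rho> x" for x using \<rho> by (simp add: mollifier_def)
  have "ennreal ((norm (conv f \<rho> x))\<^sup>2) \<le> (\<integral>\<^sup>+y. ennreal ((f y)\<^sup>2) * ennreal (\<rho> (x - y)) \<partial>lborel)" for x
  proof -
    define m where "m = conv f \<rho> x"
    obtain C where C: "\<And>x. \<bar>\<rho> x\<bar> \<le> C" using test_function_facts(3)[OF \<rho>t] by blast
    have i1: "integrable lborel (\<lambda>y. (f y)\<^sup>2 * \<rho> (x - y))"
      using fin integrable_square_iff_sqnorm[of f] C by (intro integrable_mult_bounded[of _ _ _ C]) auto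
    have i2: "integrable lborel (\<lambda>y. f y * \<rho> (x - y))"
      by (rule integrable_conv_L2[OF f fin \<rho>t])
    note r = mollifier_reflect[OF \<rho>, of x]
    have "0 \<le> (\<integral>y. (f y - m)\<^sup>2 * \<rho> (x - y) \<partial>lborel)"
      using \<rho>0 by (intro integral_nonneg_AE) auto
    also have "\<dots> = (\<integral>y. (f y)\<^sup>2 * \<rho> (x - y) - 2 * m * (f y * \<rho> (x - y)) + m\<^sup>2 * \<rho> (x - y) \<partial>lborel)"
      by (intro Bochner_Integration.integral_cong refl) (simp add: power2_diff algebra_simps)
    also have "\<dots> = (\<integral>y. (f y)\<^sup>2 * \<rho> (x - y) \<partial>lborel) - 2 * m * m + m\<^sup>2"
      using i1 i2 r by (simp add: m_def conv_def)
    finally have "m\<^sup>2 \<le> (\<integral>y. (f y)\<^sup>2 * \<rho> (x - y) \<partial>lborel)"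
      by (simp add: power2_eq_square)
    then have "ennreal (m\<^sup>2) \<le> ennreal (\<integral>y. (f y)\<^sup>2 * \<rho> (x - y) \<partial>lborel)" by (rule ennreal_leI)
    also have "\<dots> = (\<integral>\<^sup>+y. ennreal ((f y)\<^sup>2 * \<rho> (x - y)) \<partial>lborel)"
      using i1 \<rho>0 by (intro nn_integral_eq_integral[symmetric]) auto
    finally show ?thesis using \<rho>0 by (simp add: m_def ennreal_mult)
  qed
  then have "sqnorm (conv f \<rho>) \<le> (\<integral>\<^sup>+x. \<integral>\<^sup>+y. ennreal ((f y)\<^sup>2) * ennreal (\<rho> (x - y)) \<partial>lborel \<partial>lborel)"
    unfolding sqnorm_def by (intro nn_integral_mono) auto
  also have "\<dots> = (\<integral>\<^sup>+y. \<integral>\<^sup>+x. ennreal ((f y)\<^sup>2) * ennreal (\<rho> (x - y)) \<partial>lborel \<partial>lborel)"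
    by (rule lborel_pair.Fubini') measurable
  also have "\<dots> = (\<integral>\<^sup>+y. ennreal ((f y)\<^sup>2) \<partial>lborel)"
  proof (intro nn_integral_cong)
    fix y
    have "(\<integral>\<^sup>+x. ennreal (\<rho> (x - y)) \<partial>lborel) = (\<integral>\<^sup>+x. ennreal (\<rho> x) \<partial>lborel)"
      using nn_integral_lborel_shift[of "\<lambda>x. ennreal (\<rho> x)" "-y"] by simp
    also have "\<dots> = 1"
      using \<rho> nn_integral_eq_integral[of lborel \<rho>] by (simp add: mollifier_def)
    finally show "(\<integral>\<^sup>+x. ennreal ((f y)\<^sup>2) * ennreal (\<rho> (x - y)) \<partial>lborel) = ennreal ((f y)\<^sup>2)"
      by (simp add: nn_integral_cmult)
  qed
  finally show ?thesis by (simp add: sqnorm_def)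
qed

lemma mollifier_mono: "mollifier d \<rho> \<Longrightarrow> d \<le> d' \<Longrightarrow> mollifier d' \<rho>"
  by (auto simp: mollifier_def)

text \<open>For a continuous function of compact support the convergence is uniform. Young's inequality controls the
error of replacing \<open>f\<close> by such a function independently of the mollifier.\<close>

lemma mollify_L2:
  fixes f :: "real^'n::finite \<Rightarrow> real"
  assumes f[measurable]: "f \<in> borel_measurable borel" and fin: "sqnorm f < \<infinity>" and "e > 0"
  obtains d where "d > 0" "\<And>\<rho>. mollifier d \<rho> \<Longrightarrow> sqnorm (\<lambda>x. conv f \<rho> x - f x) \<le> ennreal e"
proof -
  obtain c R where c: "continuous_on UNIV c" "\<And>x. norm x \<ge> R \<Longrightarrow> c x = 0"
    and fc: "sqnorm (\<lambda>x. f x - c x) \<le> ennreal (e / 10)"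
    using L2_approx_continuous[OF f fin, of "e / 10"] \<open>e > 0\<close> by auto
  have c0: "c x = 0" if "x \<notin> cball 0 R" for x using c(2) that by simp
  have [measurable]: "c \<in> borel_measurable borel" by (rule borel_measurable_continuous_onI[OF c(1)])
  have cint: "integrable lborel c"
    by (rule integrable_continuous_compact_support[OF c(1) compact_cball c0])
  define V where "V = measure lborel (cball (0::real^'n) (R + 1))"
  have V: "V \<ge> 0" "emeasure lborel (cball (0::real^'n) (R + 1)) = ennreal V"
    unfolding V_def using emeasure_lborel_cball_finite[of "0::real^'n" "R + 1"]
    by (auto intro!: emeasure_eq_ennreal_measure)
  define \<eta> where "\<eta> = sqrt (e / (10 * (V + 1)))"
  have \<eta>: "\<eta> > 0" using \<open>e > 0\<close> V by (simp add: \<eta>_def)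
  obtain d where d: "d > 0" "\<And>x y. norm (x - y) < d \<Longrightarrow> norm (c x - c y) < \<eta>"
    using continuous_compact_support_uniformly[OF c(1) compact_cball c0 \<eta>] by metis
  show ?thesis
  proof (rule that[of "min d 1"])
    fix \<rho> :: "real^'n \<Rightarrow> real" assume \<rho>: "mollifier (min d 1) \<rho>"
    note \<rho>t = mollifier_test[OF \<rho>]
    note [measurable] = test_function_facts(1)[OF \<rho>t] conv_borel_measurable
    have bd: "norm (conv c \<rho> x - c x) \<le> norm (\<eta> * indicator (cball 0 (R + 1)) x)" for x
    proof (cases "norm x \<le> R + 1")
      case True
      have "\<bar>conv c \<rho> x - c x\<bar> \<le> \<eta>"
      proof (rule conv_close[OF \<rho> integrable_conv[OF cint \<rho>t]])
        show "norm (x - y) < min d 1 \<Longrightarrow> \<bar>c y - c x\<bar> \<le> \<eta>" for y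
          using d(2)[of x y] by simp
      qed
      then show ?thesis using True \<eta> by simp
    next
      case False
      have "c y = 0" if "norm (x - y) < min d 1" for y
        using False that norm_triangle_ineq2[of x y] by (intro c(2)) linarith
      then have "conv c \<rho> x = 0" by (intro conv_zero[OF \<rho>]) auto
      then show ?thesis using False c(2)[of x] by simp
    qed
    have "sqnorm (\<lambda>x. conv c \<rho> x - c x) \<le> sqnorm (\<lambda>x::real^'n. \<eta> * indicator (cball 0 (R + 1)) x)"
      by (rule sqnorm_mono) (use bd in auto)
    also have "\<dots> = (\<integral>\<^sup>+x. ennreal (\<eta>\<^sup>2) * indicator (cball 0 (R + 1)) x \<partial>(lborel :: (real^'n) measure))"
      unfolding sqnorm_def by (intro nn_integral_cong) (simp add: indicator_def)
    also have "\<dots> = ennreal (\<eta>\<^sup>2 * V)"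
      using V by (simp add: nn_integral_cmult_indicator ennreal_mult)
    also have "\<dots> \<le> ennreal (e / 10)"
      using V \<open>e > 0\<close> by (intro ennreal_leI) (simp add: \<eta>_def field_simps)
    finally have cc: "sqnorm (\<lambda>x. conv c \<rho> x - c x) \<le> ennreal (e / 10)" .
    have lin: "conv (\<lambda>x. f x - c x) \<rho> = (\<lambda>x. conv f \<rho> x - conv c \<rho> x)"
      using integrable_conv_L2[OF f fin \<rho>t] integrable_conv[OF cint \<rho>t]
      by (auto simp: conv_def left_diff_distrib)
    have "sqnorm (conv (\<lambda>x. f x - c x) \<rho>) \<le> sqnorm (\<lambda>x. f x - c x)"
      using fc le_less_trans by (intro conv_sqnorm_le[OF _ _ \<rho>]) fastforce+
    also note fc
    finally have ff: "sqnorm (\<lambda>x. conv f \<rho> x - conv c \<rho> x) \<le> ennreal (e / 10)"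
      by (simp add: lin)
    have "sqnorm (\<lambda>x. conv f \<rho> x - f x) \<le> 2 * sqnorm (\<lambda>x. conv f \<rho> x - conv c \<rho> x) + 2 * sqnorm (\<lambda>x. conv c \<rho> x - f x)"
      by (rule sqnorm_triangle) measurable
    also have "\<dots> \<le> 2 * sqnorm (\<lambda>x. conv f \<rho> x - conv c \<rho> x) + 2 * (2 * sqnorm (\<lambda>x. conv c \<rho> x - c x) + 2 * sqnorm (\<lambda>x. c x - f x))"
      by (intro add_left_mono mult_left_mono sqnorm_triangle) auto
    also have "\<dots> \<le> 2 * ennreal (e / 10) + 2 * (2 * ennreal (e / 10) + 2 * ennreal (e / 10))"
      using fc by (intro add_mono mult_left_mono ff cc) (auto simp: sqnorm_minus_commute[of c f])
    also have "\<dots> = ennreal e"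
      using \<open>e > 0\<close> by (simp add: ennreal_plus[symmetric] ennreal_mult''[symmetric] ennreal_numeral[symmetric]
        del: ennreal_plus ennreal_numeral)
    finally show "sqnorm (\<lambda>x. conv f \<rho> x - f x) \<le> ennreal e" .
  qed (use d in auto)
qed

text \<open>The fundamental lemma of the calculus of variations: \<open>f\<close> is the limit of its own mollifications.\<close>

lemma vanishing_conv_imp_AE_zero:
  fixes f :: "real^'n::finite \<Rightarrow> real"
  assumes f[measurable]: "f \<in> borel_measurable borel" and fin: "sqnorm f < \<infinity>"
    and zero: "\<And>\<rho> x. \<rho> \<in> test_functions UNIV \<Longrightarrow> conv f \<rho> x = 0"
  shows "AE x in lborel. f x = 0"
proof -
  have "sqnorm f \<le> ennreal e" if e: "e > 0" for e
  proof -
    obtain d where d: "d > 0" "\<And>\<rho>. mollifier d \<rho> \<Longrightarrow> sqnorm (\<lambda>x. conv f \<rho> x - f x) \<le> ennreal e"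
      using mollify_L2[OF f fin e] by blast
    obtain \<rho> :: "real^'n \<Rightarrow> real" where \<rho>: "mollifier d \<rho>" using mollifier_exists[OF d(1)] by blast
    show ?thesis using d(2)[OF \<rho>] zero[OF mollifier_test[OF \<rho>]] by (simp add: sqnorm_def)
  qed
  then have "sqnorm f \<le> 0 + ennreal e" if "e > 0" for e using that by simp
  then have "sqnorm f \<le> 0" by (rule ennreal_le_epsilon) 
  then have "sqnorm f = 0" by simp
  then have "AE x in lborel. ennreal ((norm (f x))\<^sup>2) = 0"
    unfolding sqnorm_def by (subst (asm) nn_integral_0_iff_AE) auto
  then show ?thesis by eventually_elim simp
qed

section \<open>Limits of test functions\<close>

text \<open>Functions \<open>w\<close> in \<open>W\<^sub>0\<^sup>1\<^sup>,\<^sup>2\<close> with gradient \<open>G\<close>, restricted to those that are uniform limits of the approximating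
test functions. Uniform convergence makes the pointwise limits in the chain rule and in Fatou's lemma
available along the whole sequence.\<close>

definition approximable ::
  "(real^'n::finite) set \<Rightarrow> (real^'n \<Rightarrow> real) \<Rightarrow> (real^'n \<Rightarrow> real^'n) \<Rightarrow> bool" where
  "approximable \<Omega> w G \<longleftrightarrow> G \<in> borel_measurable borel \<and>
     (\<forall>e>0. \<exists>\<phi>\<in>test_functions \<Omega>. (\<forall>x. \<bar>\<phi> x - w x\<bar> \<le> e) \<and> sqnorm (\<lambda>x. grad \<phi> x - G x) \<le> ennreal e)"

lemma test_function_reflect:
  assumes \<rho>: "\<rho> \<in> test_functions \<Omega>"
  shows "(\<lambda>y. \<rho> (x - y)) \<in> test_functions UNIV"
    and "partial_deriv i (\<lambda>y. \<rho> (x - y)) = (\<lambda>y. - partial_deriv i \<rho> (x - y))"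
proof -
  note sm = test_functions_smooth[OF \<rho>]
  obtain K where K: "compact K" "\<And>x. x \<notin> K \<Longrightarrow> \<rho> x = 0"
    using test_functionsE[OF \<rho>] by metis
  show "(\<lambda>y. \<rho> (x - y)) \<in> test_functions UNIV"
  proof (rule test_functionsI)
    show "smooth (\<lambda>y. \<rho> (x - y))" using smooth_affine[OF sm, of "-1" x] by simp
    show "compact ((\<lambda>y. x - y) ` K)"
      by (intro compact_continuous_image continuous_intros K)
    show "\<rho> (x - y) = 0" if "y \<notin> (\<lambda>y. x - y) ` K" for y
      using that by (intro K(2)) (metis diff_diff_eq2 add_diff_cancel_left' imageI)
  qed auto
  show "partial_deriv i (\<lambda>y. \<rho> (x - y)) = (\<lambda>y. - partial_deriv i \<rho> (x - y))"
    using partial_deriv_affine[OF smooth_differentiable[OF sm], of i "-1" x] by simp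
qed

text \<open>Mollification commutes with weak differentiation: the derivative falls on the mollifier, and
\<open>y \<mapsto> \<rho> (x - y)\<close> is a test function to which the definition of the weak gradient applies.\<close>

lemma approximable_of_weak_grad:
  fixes U :: "real^'n::finite \<Rightarrow> real"
  assumes "open \<Omega>" and K: "compact K" "K \<subseteq> \<Omega>" and U: "continuous_on UNIV U" "\<And>x. x \<notin> K \<Longrightarrow> U x = 0"
    and G[measurable]: "G \<in> borel_measurable borel" and fin: "sqnorm G < \<infinity>"
    and weak: "\<And>\<psi> i. \<psi> \<in> test_functions UNIV \<Longrightarrow>
        (\<integral>x. U x * partial_deriv i \<psi> x \<partial>lborel) = - (\<integral>x. G x $ i * \<psi> x \<partial>lborel)"
  shows "approximable \<Omega> U G"
  unfolding approximable_def
proof (intro conjI allI impI G)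
  fix e :: real assume e: "e > 0"
  obtain r where r: "r > 0" "(\<Union>x\<in>K. cball x r) \<subseteq> \<Omega>"
    using compact_subset_open_imp_cball_epsilon_subset[OF K(1) \<open>open \<Omega>\<close> K(2)] by blast
  have Uint: "integrable lborel U"
    by (rule integrable_continuous_compact_support[OF U(1) K(1) U(2)])
  have "\<exists>d>0. \<forall>\<rho>. mollifier d \<rho> \<longrightarrow> sqnorm (\<lambda>x. conv (\<lambda>x. G x $ i) \<rho> x - G x $ i) \<le> ennreal (e / CARD('n))" for i
  proof -
    have "sqnorm (\<lambda>x. G x $ i) \<le> sqnorm G" by (rule sqnorm_mono) (simp add: component_le_norm_cart)
    then have "sqnorm (\<lambda>x. G x $ i) < \<infinity>" using fin by (rule le_less_trans)
    moreover have "e / CARD('n) > 0" using e by simp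
    ultimately obtain d where "d > 0"
        "\<And>\<rho>. mollifier d \<rho> \<Longrightarrow> sqnorm (\<lambda>x. conv (\<lambda>x. G x $ i) \<rho> x - G x $ i) \<le> ennreal (e / CARD('n))"
      using mollify_L2[OF borel_measurable_vec_nth[OF G]] by blast
    then show ?thesis by blast
  qed
  then obtain D where D: "\<And>i. D i > 0"
    "\<And>i \<rho>. mollifier (D i) \<rho> \<Longrightarrow> sqnorm (\<lambda>x. conv (\<lambda>x. G x $ i) \<rho> x - G x $ i) \<le> ennreal (e / CARD('n))"
    by metis
  obtain d1 where d1: "d1 > 0" "\<And>x y. norm (x - y) < d1 \<Longrightarrow> norm (U x - U y) < e"
    using continuous_compact_support_uniformly[OF U(1) K(1) U(2) e] by metis
  define d where "d = Min (insert r (insert d1 (range D)))"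
  have "d \<in> insert r (insert d1 (range D))" unfolding d_def by (rule Min_in) auto
  then have d: "d > 0" "d \<le> r" "d \<le> d1" "d \<le> D i" for i
    unfolding d_def using r(1) d1(1) D(1) by (auto intro!: Min_le simp del: Min_insert)
  obtain \<rho> :: "real^'n \<Rightarrow> real" where \<rho>: "mollifier d \<rho>" using mollifier_exists[OF d(1)] by blast
  note \<rho>t = mollifier_test[OF \<rho>]
  have grad_conv: "partial_deriv i (conv U \<rho>) = conv (\<lambda>x. G x $ i) \<rho>" for i
  proof
    fix x
    have "conv U (partial_deriv i \<rho>) x = - (\<integral>y. U y * partial_deriv i (\<lambda>y. \<rho> (x - y)) y \<partial>lborel)"
      by (simp add: conv_def test_function_reflect(2)[OF \<rho>t])
    also have "\<dots> = conv (\<lambda>x. G x $ i) \<rho> x"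
      by (simp add: weak[OF test_function_reflect(1)[OF \<rho>t]] conv_def)
    finally show "partial_deriv i (conv U \<rho>) x = conv (\<lambda>x. G x $ i) \<rho> x"
      by (simp add: partial_deriv_conv[OF Uint \<rho>t])
  qed
  have sm: "smooth (conv U \<rho>)" by (rule smooth_conv[OF Uint \<rho>t])
  show "\<exists>\<phi>\<in>test_functions \<Omega>. (\<forall>x. \<bar>\<phi> x - U x\<bar> \<le> e) \<and> sqnorm (\<lambda>x. grad \<phi> x - G x) \<le> ennreal e"
  proof (intro bexI[of _ "conv U \<rho>"] conjI allI)
    show "conv U \<rho> \<in> test_functions \<Omega>"
    proof (rule test_functionsI[OF sm])
      let ?K = "{x + y |x y. x \<in> K \<and> y \<in> cball 0 r}"
      show "compact ?K" by (rule compact_sums[OF K(1) compact_cball])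
      show "?K \<subseteq> \<Omega>"
        using r(2) by (force simp: dist_norm)
      fix x assume x: "x \<notin> ?K"
      show "conv U \<rho> x = 0"
      proof (rule conv_zero[OF \<rho>])
        fix y assume "norm (x - y) < d"
        then have "x - y \<in> cball 0 r" using d(2) by simp
        have "y \<notin> K"
        proof
          assume "y \<in> K"
          with \<open>x - y \<in> cball 0 r\<close> have "y + (x - y) \<in> ?K" by blast
          then show False using x by simp
        qed
        then show "U y = 0" by (rule U(2))
      qed
    qed
    show "\<bar>conv U \<rho> x - U x\<bar> \<le> e" for x
    proof (rule conv_close[OF \<rho> integrable_conv[OF Uint \<rho>t]])
      show "norm (x - y) < d \<Longrightarrow> \<bar>U y - U x\<bar> \<le> e" for y
        using d1(2)[of x y] d(3) by simp
    qed
    have [measurable]: "grad (conv U \<rho>) \<in> borel_measurable borel"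
      by (rule borel_measurable_continuous_onI[OF grad_continuous[OF sm]])
    have "sqnorm (\<lambda>x. grad (conv U \<rho>) x - G x) = (\<Sum>i\<in>UNIV. sqnorm (\<lambda>x. conv (\<lambda>x. G x $ i) \<rho> x - G x $ i))"
      by (subst sqnorm_components) (auto simp: grad_conv)
    also have "\<dots> \<le> (\<Sum>i\<in>(UNIV::'n set). ennreal (e / CARD('n)))"
      by (intro sum_mono D mollifier_mono[OF \<rho> d(4)])
    also have "\<dots> = ennreal e"
      using e by (simp add: ennreal_of_nat_eq_real_of_nat ennreal_mult''[symmetric])
    finally show "sqnorm (\<lambda>x. grad (conv U \<rho>) x - G x) \<le> ennreal e" .
  qed
qed

lemma approximableE:
  assumes "approximable \<Omega> w G" "e > 0"
  obtains \<phi> where "\<phi> \<in> test_functions \<Omega>" "\<And>x. \<bar>\<phi> x - w x\<bar> \<le> e" "sqnorm (\<lambda>x. grad \<phi> x - G x) \<le> ennreal e"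
  using assms unfolding approximable_def by blast

lemma approximable_sequence:
  assumes "approximable \<Omega> w G" "e > 0"
  obtains \<phi> where "\<And>j. \<phi> j \<in> test_functions \<Omega>" "\<And>j x. \<bar>\<phi> j x - w x\<bar> \<le> e / Suc j"
    "\<And>j. sqnorm (\<lambda>x. grad (\<phi> j) x - G x) \<le> ennreal (e / Suc j)" "\<And>x. (\<lambda>j. \<phi> j x) \<longlonglongrightarrow> w x"
proof -
  have "\<exists>\<phi>\<in>test_functions \<Omega>. (\<forall>x. \<bar>\<phi> x - w x\<bar> \<le> e / Suc j) \<and> sqnorm (\<lambda>x. grad \<phi> x - G x) \<le> ennreal (e / Suc j)" for j
    using approximableE[OF assms(1), of "e / Suc j"] assms(2) by (metis divide_pos_pos of_nat_0_less_iff zero_less_Suc)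
  then obtain \<phi> where \<phi>: "\<And>j. \<phi> j \<in> test_functions \<Omega>" "\<And>j x. \<bar>\<phi> j x - w x\<bar> \<le> e / Suc j"
    "\<And>j. sqnorm (\<lambda>x. grad (\<phi> j) x - G x) \<le> ennreal (e / Suc j)" by metis
  have "(\<lambda>j. \<phi> j x) \<longlonglongrightarrow> w x" for x
  proof (rule LIM_zero_cancel, rule Lim_null_comparison)
    show "\<forall>\<^sub>F j in sequentially. norm (\<phi> j x - w x) \<le> e / real (Suc j)" using \<phi>(2) by simp
    show "(\<lambda>j. e / real (Suc j)) \<longlonglongrightarrow> 0"
      using LIMSEQ_Suc[OF lim_const_over_n[of e]] by simp
  qed
  with \<phi> show ?thesis using that by blast
qed

lemma approximable_measurable: "approximable \<Omega> w G \<Longrightarrow> G \<in> borel_measurable borel"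
  by (simp add: approximable_def)

lemma grad_measurable: "\<phi> \<in> test_functions \<Omega> \<Longrightarrow> grad \<phi> \<in> borel_measurable borel"
  by (rule borel_measurable_continuous_onI[OF grad_continuous[OF test_functions_smooth]])

lemma approximable_continuous:
  assumes "approximable \<Omega> w G" shows "continuous_on UNIV w"
proof -
  obtain \<phi> where \<phi>: "\<And>j. \<phi> j \<in> test_functions \<Omega>" "\<And>j x. \<bar>\<phi> j x - w x\<bar> \<le> 1 / Suc j"
    using approximable_sequence[OF assms, of 1] by (metis zero_less_one)
  have ul: "uniform_limit UNIV \<phi> w sequentially"
  proof (rule uniform_limitI)
    fix e :: real assume "e > 0"
    then obtain N where "inverse (real (Suc N)) < e" using reals_Archimedean by blast
    then have N: "1 / real (Suc N) < e" by (simp add: inverse_eq_divide)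
    show "\<forall>\<^sub>F j in sequentially. \<forall>x\<in>UNIV. dist (\<phi> j x) (w x) < e"
    proof (rule eventually_sequentiallyI[of N], intro ballI)
      fix j x assume "N \<le> j"
      then have "1 / real (Suc j) \<le> 1 / real (Suc N)" by (simp add: frac_le)
      then show "dist (\<phi> j x) (w x) < e" using \<phi>(2)[of j x] N by (simp add: dist_norm)
    qed
  qed
  have c: "\<forall>\<^sub>F j in sequentially. continuous_on UNIV (\<phi> j)"
    using \<phi>(1) test_function_facts(4) by (intro always_eventually allI) blast
  show ?thesis by (rule uniform_limit_theorem[OF c ul]) simp
qed

lemma approximable_zero_outside:
  assumes "approximable \<Omega> w G" "x \<notin> \<Omega>" shows "w x = 0"
proof -
  obtain \<phi> where \<phi>: "\<And>j. \<phi> j \<in> test_functions \<Omega>" "(\<lambda>j. \<phi> j x) \<longlonglongrightarrow> w x"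
    using approximable_sequence[OF assms(1), of 1] by (metis zero_less_one)
  have "\<phi> j x = 0" for j
    using test_functionsE[OF \<phi>(1)[of j]] assms(2) by (metis subsetD)
  then show ?thesis using \<phi>(2) LIMSEQ_unique by (metis (no_types, lifting) tendsto_const ext)
qed

lemma sqnorm_grad_test_finite:
  assumes "\<phi> \<in> test_functions \<Omega>" shows "sqnorm (grad \<phi>) < \<infinity>"
proof -
  note [measurable] = grad_measurable[OF assms]
  have c: "continuous_on UNIV (\<lambda>x. (norm (grad \<phi> x))\<^sup>2)"
    using grad_continuous[OF test_functions_smooth[OF assms]] by (intro continuous_intros)
  obtain K where K: "compact K" "\<And>x. x \<notin> K \<Longrightarrow> \<phi> x = 0"
    using test_functionsE[OF assms] by metis
  have "(norm (grad \<phi> x))\<^sup>2 = 0" if "x \<notin> K" for x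
    using partial_deriv_zero_outside[OF K(1) that K(2)] by (simp add: vec_eq_iff)
  then have "integrable lborel (\<lambda>x. (norm (grad \<phi> x))\<^sup>2)"
    by (intro integrable_continuous_compact_support[OF c K(1)])
  then show ?thesis by (subst (asm) integrable_square_iff_sqnorm) auto
qed

lemma approximable_sqnorm_finite:
  assumes "approximable \<Omega> w G" shows "sqnorm G < \<infinity>"
proof -
  obtain \<phi> where \<phi>: "\<phi> \<in> test_functions \<Omega>" "sqnorm (\<lambda>x. grad \<phi> x - G x) \<le> ennreal 1"
    using approximableE[OF assms, of 1] by auto
  note [measurable] = grad_measurable[OF \<phi>(1)] approximable_measurable[OF assms]
  have "sqnorm (\<lambda>x. grad \<phi> x - (grad \<phi> x - G x)) \<le> 2 * sqnorm (grad \<phi>) + 2 * sqnorm (\<lambda>x. grad \<phi> x - G x)"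
    by (rule sqnorm_diff) measurable
  also have "\<dots> < \<infinity>"
    using \<phi>(2) sqnorm_grad_test_finite[OF \<phi>(1)] by (auto simp: ennreal_mult_less_top intro: le_less_trans)
  finally show ?thesis by simp
qed

text \<open>The integrals of \<open>f (x + h)\<close> and \<open>f x\<close> agree, so the integral of the difference quotient in the direction \<open>i\<close>
vanishes; by the uniform linearization it is close to the integral of the partial derivative.\<close>

lemma integral_partial_deriv_zero:
  fixes f :: "real^'n::finite \<Rightarrow> real"
  assumes f: "f \<in> test_functions \<Omega>"
  shows "(\<integral>x. partial_deriv i f x \<partial>lborel) = 0"
proof -
  obtain K where K: "compact K" "\<And>x. x \<notin> K \<Longrightarrow> f x = 0"
    using test_functionsE[OF f] by metis
  obtain R where R: "\<And>x. x \<in> K \<Longrightarrow> norm x \<le> R"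
    using compact_imp_bounded[OF K(1)] by (auto simp: bounded_iff)
  note [measurable] = test_function_facts(1)[OF f]
  note fi = test_function_facts(2)[OF f] test_function_facts(2)[OF test_functions_partial[OF f]]
  define V where "V = measure lborel (cball (0::real^'n) (R + 1))"
  have "\<bar>\<integral>x. partial_deriv i f x \<partial>lborel\<bar> \<le> e * V" if e: "e > 0" for e
  proof -
    obtain d where d: "d > 0" "\<And>x h. norm h < d \<Longrightarrow> \<bar>f (x + h) - f x - grad f x \<bullet> h\<bar> \<le> e * norm h"
      using test_function_linearization[OF f e] by blast
    define t where "t = min (d / 2) 1"
    have t: "t > 0" "t < d" "t \<le> 1" using d(1) by (auto simp: t_def)
    define h where "h = t *\<^sub>R (axis i 1 :: real^'n)"
    have h: "norm h = t" using t by (simp add: h_def)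
    have fh: "integrable lborel (\<lambda>x. f (x + h))"
      using integrable_distr_eq[of "\<lambda>y. h + y" lborel borel f] fi(1)
      by (simp add: lborel_distr_plus) (simp add: add.commute)
    have "t * \<bar>\<integral>x. partial_deriv i f x \<partial>lborel\<bar> = \<bar>\<integral>x. f (x + h) - f x - t * partial_deriv i f x \<partial>lborel\<bar>"
      using fi fh t integral_lborel_shift[of f h] by (simp add: abs_mult)
    also have "\<dots> = norm (\<integral>x. f (x + h) - f x - t * partial_deriv i f x \<partial>lborel)" by simp
    also have "\<dots> \<le> (\<integral>x. (e * t) * indicator (cball (0::real^'n) (R + 1)) x \<partial>lborel)"
    proof (rule norm_integral_le_integral)
      fix x
      show "norm (f (x + h) - f x - t * partial_deriv i f x) \<le> e * t * indicator (cball 0 (R + 1)) x"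
      proof (cases "norm x \<le> R + 1")
        case True
        then show ?thesis using d(2)[of h x] h t by (simp add: h_def inner_axis)
      next
        case False
        have "norm x \<le> norm (x + h) + norm h" using norm_triangle_ineq4[of "x + h" h] by simp
        then have "x \<notin> K" "x + h \<notin> K" using R[of x] R[of "x + h"] False h t(3) by auto
        then show ?thesis using K partial_deriv_zero_outside[OF K(1) _ K(2)] False by simp
      qed
    qed (use fi fh emeasure_lborel_cball_finite[of "0::real^'n" "R + 1"] in auto)
    also have "\<dots> = t * (e * V)" by (simp add: V_def)
    finally show ?thesis using t(1) by (simp add: mult_le_cancel_left_pos)
  qed
  then have "\<bar>\<integral>x. partial_deriv i f x \<partial>lborel\<bar> \<le> 0 + s" if "s > 0" for s :: real
  proof -
    have "V \<ge> 0" by (simp add: V_def)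
    then have "s / (V + 1) * V \<le> s" using that by (simp add: field_simps)
    moreover have "s / (V + 1) > 0" using that \<open>V \<ge> 0\<close> by simp
    ultimately show ?thesis
      using \<open>\<And>e. e > 0 \<Longrightarrow> \<bar>\<integral>x. partial_deriv i f x \<partial>lborel\<bar> \<le> e * V\<close>[of "s / (V + 1)"] by linarith
  qed
  then have "\<bar>\<integral>x. partial_deriv i f x \<partial>lborel\<bar> \<le> 0" by (rule field_le_epsilon)
  then show ?thesis by simp
qed

lemma integration_by_parts:
  assumes f: "f \<in> test_functions \<Omega>" and g: "smooth g"
  shows "(\<integral>x. f x * partial_deriv i g x \<partial>lborel) = - (\<integral>x. partial_deriv i f x * g x \<partial>lborel)"
proof -
  have eq: "partial_deriv i (\<lambda>x. f x * g x) = (\<lambda>x. f x * partial_deriv i g x + partial_deriv i f x * g x)"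
    by (intro partial_deriv_mult smooth_differentiable g test_functions_smooth[OF f])
  have "integrable lborel (\<lambda>x. f x * partial_deriv i g x)" "integrable lborel (\<lambda>x. partial_deriv i f x * g x)"
    by (rule test_function_facts(2)[OF test_functions_mult], rule f test_functions_partial[OF f],
        rule smooth_partial[OF g] g)+
  then show ?thesis
    using integral_partial_deriv_zero[OF test_functions_mult[OF f g], of i] by (simp add: eq)
qed

lemma eq_zero_if_small:
  fixes a C :: real
  assumes "\<And>s. 0 < s \<Longrightarrow> s \<le> 1 \<Longrightarrow> \<bar>a\<bar> \<le> s * C"
  shows "a = 0"
proof (rule ccontr)
  assume "a \<noteq> 0"
  have C: "C \<ge> 0" using assms[of 1] by simp
  define s where "s = min 1 (\<bar>a\<bar> / (2 * (C + 1)))"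
  have s: "0 < s" "s \<le> 1" using \<open>a \<noteq> 0\<close> C by (auto simp: s_def)
  have "\<bar>a\<bar> \<le> s * C" using assms s by blast
  also have "\<dots> \<le> \<bar>a\<bar> / (2 * (C + 1)) * C" using C by (intro mult_right_mono) (auto simp: s_def)
  also have "\<dots> < \<bar>a\<bar>"
  proof -
    have "\<bar>a\<bar> * C < \<bar>a\<bar> * (2 * (C + 1))" using C \<open>a \<noteq> 0\<close> by (intro mult_strict_left_mono) auto
    then show ?thesis using C by (simp add: pos_divide_less_eq)
  qed
  finally show False by simp
qed

text \<open>Integration by parts for the approximating test functions passes to the limit. The products of gradients with \<open>\<psi>\<close>
are estimated by \<open>a b \<le> a\<^sup>2/s + s b\<^sup>2\<close>.\<close>

lemma approximable_weak_grad:
  fixes w :: "real^'n::finite \<Rightarrow> real"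
  assumes w: "approximable \<Omega> w G" "integrable lborel w" and \<psi>: "\<psi> \<in> test_functions \<Omega>'"
  shows "(\<integral>x. w x * partial_deriv i \<psi> x \<partial>lborel) = - (\<integral>x. G x $ i * \<psi> x \<partial>lborel)"
proof -
  let ?D = "partial_deriv i \<psi>"
  note [measurable] = approximable_measurable[OF w(1)] test_function_facts(1)[OF \<psi>]
  note Dt = test_functions_partial[OF \<psi>, of i]
  have \<psi>2: "integrable lborel (\<lambda>x. (\<psi> x)\<^sup>2)"
    unfolding power2_eq_square
    by (rule test_function_facts(2)[OF test_functions_mult[OF \<psi> test_functions_smooth[OF \<psi>]]])
  have sG: "integrable lborel (\<lambda>x. (norm (G x))\<^sup>2)"
    using approximable_sqnorm_finite[OF w(1)] integrable_square_iff_sqnorm[of G] by simp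
  have iwD: "integrable lborel (\<lambda>x. w x * ?D x)"
  proof -
    obtain C where "\<And>x. \<bar>?D x\<bar> \<le> C" using test_function_facts(3)[OF Dt] by blast
    then show ?thesis
      by (intro integrable_mult_bounded[OF w(2)]) (use test_function_facts(1)[OF Dt] in auto)
  qed
  have sGi: "integrable lborel (\<lambda>x. (H x $ i)\<^sup>2)" if [measurable]: "H \<in> borel_measurable borel" and "integrable lborel (\<lambda>x. (norm (H x))\<^sup>2)" for H :: "real^'n \<Rightarrow> real^'n"
    by (rule Bochner_Integration.integrable_bound[OF that(2)])
      (auto intro!: AE_I2 power_mono simp: component_le_norm_cart abs_le_square_iff[symmetric])
  have iG: "integrable lborel (\<lambda>x. G x $ i * \<psi> x)"
    by (rule integrable_mult_square[OF sGi[OF _ sG] \<psi>2]) auto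
  define C where "C = (\<integral>x. \<bar>?D x\<bar> \<partial>lborel) + 1 + (\<integral>x. (\<psi> x)\<^sup>2 \<partial>lborel)"
  have "(\<integral>x. w x * ?D x \<partial>lborel) + (\<integral>x. G x $ i * \<psi> x \<partial>lborel) = 0"
  proof (rule eq_zero_if_small[of _ C])
    fix s :: real assume s: "0 < s" "s \<le> 1"
    have s2: "s\<^sup>2 \<le> s" using s by (simp add: power2_eq_square mult_left_le)
    obtain \<phi> where \<phi>: "\<phi> \<in> test_functions \<Omega>" "\<And>x. \<bar>\<phi> x - w x\<bar> \<le> s\<^sup>2" "sqnorm (\<lambda>x. grad \<phi> x - G x) \<le> ennreal (s\<^sup>2)"
      using approximableE[OF w(1), of "s\<^sup>2"] s by auto
    note [measurable] = grad_measurable[OF \<phi>(1)] test_function_facts(1)[OF \<phi>(1)]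
    have i1: "integrable lborel (\<lambda>x. \<phi> x * ?D x)"
      by (rule test_function_facts(2)[OF test_functions_mult[OF \<phi>(1) smooth_partial[OF test_functions_smooth[OF \<psi>]]]])
    have i2: "integrable lborel (\<lambda>x. partial_deriv i \<phi> x * \<psi> x)"
      by (rule test_function_facts(2)[OF test_functions_mult[OF test_functions_partial[OF \<phi>(1)] test_functions_smooth[OF \<psi>]]])
    have sfin: "sqnorm (\<lambda>x. grad \<phi> x - G x) < \<infinity>" using \<phi>(3) by (rule le_less_trans) simp
    then have i3: "integrable lborel (\<lambda>x. (norm (grad \<phi> x - G x))\<^sup>2)"
      by (subst integrable_square_iff_sqnorm) auto
    have i3le: "(\<integral>x. (norm (grad \<phi> x - G x))\<^sup>2 \<partial>lborel) \<le> s\<^sup>2"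
      using \<phi>(3) sqnorm_eq_integral[OF _ sfin] by simp
    have "(\<integral>x. w x * ?D x \<partial>lborel) + (\<integral>x. G x $ i * \<psi> x \<partial>lborel)
        = (\<integral>x. (w x - \<phi> x) * ?D x \<partial>lborel) + (\<integral>x. (G x $ i - partial_deriv i \<phi> x) * \<psi> x \<partial>lborel)"
      using integration_by_parts[OF \<phi>(1) test_functions_smooth[OF \<psi>], of i] i1 i2 iwD iG
      by (simp add: left_diff_distrib)
    moreover have "norm (\<integral>x. (w x - \<phi> x) * ?D x \<partial>lborel) \<le> (\<integral>x. s * \<bar>?D x\<bar> \<partial>lborel)"
    proof (rule norm_integral_le_integral)
      fix x
      have "\<bar>w x - \<phi> x\<bar> \<le> s" using \<phi>(2)[of x] s2 by (simp add: abs_minus_commute)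
      then show "norm ((w x - \<phi> x) * ?D x) \<le> s * \<bar>?D x\<bar>" by (simp add: abs_mult mult_right_mono)
    qed (use i1 iwD test_function_facts(2)[OF Dt] in \<open>auto simp: left_diff_distrib\<close>)
    moreover have "norm (\<integral>x. (G x $ i - partial_deriv i \<phi> x) * \<psi> x \<partial>lborel)
        \<le> (\<integral>x. (norm (grad \<phi> x - G x))\<^sup>2 / s + s * (\<psi> x)\<^sup>2 \<partial>lborel)"
    proof (rule norm_integral_le_integral)
      fix x
      let ?a = "norm (grad \<phi> x - G x)"
      have "\<bar>G x $ i - partial_deriv i \<phi> x\<bar> \<le> ?a"
        using component_le_norm_cart[of "grad \<phi> x - G x" i] by (simp add: abs_minus_commute)
      then have "\<bar>G x $ i - partial_deriv i \<phi> x\<bar> * \<bar>\<psi> x\<bar> \<le> ?a * \<bar>\<psi> x\<bar>" by (rule mult_right_mono) simp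
      also have "\<dots> \<le> ?a\<^sup>2 / s + s * (\<psi> x)\<^sup>2"
      proof -
        have "0 \<le> (?a - s * \<bar>\<psi> x\<bar>)\<^sup>2 + ?a * (s * \<bar>\<psi> x\<bar>)" using s by simp
        then have "s * (?a * \<bar>\<psi> x\<bar>) \<le> ?a\<^sup>2 + s * (s * (\<psi> x)\<^sup>2)"
          by (simp add: power2_diff power_mult_distrib power2_eq_square[of s] algebra_simps)
        then show ?thesis using s by (simp add: field_simps)
      qed
      finally show "norm ((G x $ i - partial_deriv i \<phi> x) * \<psi> x) \<le> ?a\<^sup>2 / s + s * (\<psi> x)\<^sup>2"
        by (simp add: abs_mult)
    qed (use i2 iG i3 \<psi>2 in \<open>auto simp: left_diff_distrib\<close>)
    moreover have "(\<integral>x. (norm (grad \<phi> x - G x))\<^sup>2 / s + s * (\<psi> x)\<^sup>2 \<partial>lborel)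
        \<le> s + s * (\<integral>x. (\<psi> x)\<^sup>2 \<partial>lborel)"
      using i3 \<psi>2 i3le s by (simp add: field_simps power2_eq_square)
    ultimately show "\<bar>(\<integral>x. w x * ?D x \<partial>lborel) + (\<integral>x. G x $ i * \<psi> x \<partial>lborel)\<bar> \<le> s * C"
      by (simp add: C_def algebra_simps)
  qed
  then show ?thesis by simp
qed

section \<open>Positive parts and translations\<close>

text \<open>A smooth approximation of the positive part: \<open>t exp (-1/(N t))\<close> for \<open>t > 0\<close>, which tends to \<open>max 0 t\<close> as \<open>N\<close> grows.
It vanishes for \<open>t \<le> 0\<close>, so composition with it maps test functions to test functions.\<close>

definition smooth_pos :: "real \<Rightarrow> real \<Rightarrow> real" where
  "smooth_pos N t = t * flat_exp 0 (N * t)"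

text \<open>The derivative of the previous function. In terms of \<open>s = 1/(N t)\<close> it equals \<open>exp (-s) (1 + s)\<close> for \<open>t > 0\<close> and
therefore lies between \<open>0\<close> and \<open>1\<close>.\<close>

definition smooth_pos' :: "real \<Rightarrow> real \<Rightarrow> real" where
  "smooth_pos' N t = flat_exp 0 (N * t) + t * (N * flat_exp 2 (N * t))"

lemma smooth_pos_deriv: "(smooth_pos N has_real_derivative smooth_pos' N t) (at t)"
  unfolding smooth_pos_def smooth_pos'_def
  by (rule DERIV_cong[OF DERIV_mult[OF DERIV_ident DERIV_chain2[OF flat_exp_deriv]]])
    (auto intro!: derivative_eq_intros simp: numeral_2_eq_2)

lemma smooth_pos'_continuous: "continuous_on UNIV (smooth_pos' N)"
  unfolding smooth_pos'_def
  by (intro continuous_intros continuous_on_compose2[OF flat_exp_continuous]) auto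

lemma smooth_pos'_pos: "N > 0 \<Longrightarrow> t > 0 \<Longrightarrow> smooth_pos' N t = exp (- (1 / (N * t))) * (1 + 1 / (N * t))"
  by (simp add: smooth_pos'_def flat_exp_def field_simps power2_eq_square)

lemma smooth_pos'_nonpos: "N > 0 \<Longrightarrow> t \<le> 0 \<Longrightarrow> smooth_pos' N t = 0"
  by (simp add: smooth_pos'_def flat_exp_def mult_nonneg_nonpos not_less zero_less_mult_iff)

lemma smooth_pos'_bounds: assumes "N > 0" shows "0 \<le> smooth_pos' N t" "smooth_pos' N t \<le> 1"
proof -
  have "0 \<le> smooth_pos' N t \<and> smooth_pos' N t \<le> 1"
  proof (cases "t > 0")
    case True
    define s where "s = 1 / (N * t)"
    have s: "s > 0" using True assms by (simp add: s_def)
    have "exp (- s) * (1 + s) \<le> exp (- s) * exp s"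
      by (intro mult_left_mono exp_ge_add_one_self) auto
    then show ?thesis using smooth_pos'_pos[OF assms True] s by (simp add: s_def[symmetric] exp_minus)
  qed (use smooth_pos'_nonpos[OF assms] in auto)
  then show "0 \<le> smooth_pos' N t" "smooth_pos' N t \<le> 1" by auto
qed

lemma smooth_pos_lipschitz: assumes "N > 0" shows "\<bar>smooth_pos N a - smooth_pos N b\<bar> \<le> \<bar>a - b\<bar>"
proof -
  have "norm (smooth_pos N a - smooth_pos N b) \<le> 1 * norm (a - b)"
    by (rule field_differentiable_bound[of UNIV _ "smooth_pos' N"])
      (use smooth_pos'_bounds[OF assms] smooth_pos_deriv in \<open>auto simp: abs_le_iff intro: order_trans[of _ 0]\<close>)
  then show ?thesis by simp
qed

lemma smooth_pos_close: assumes "N > 0" shows "\<bar>smooth_pos N t - max 0 t\<bar> \<le> 1 / N"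
proof (cases "t > 0")
  case True
  define s where "s = 1 / (N * t)"
  have s: "s > 0" using True assms by (simp add: s_def)
  have "1 - s \<le> exp (- s)" using exp_ge_add_one_self[of "-s"] by simp
  then have "t * (1 - exp (- s)) \<le> t * s" using True by (intro mult_left_mono) auto
  moreover have "t * s = 1 / N" using True assms by (simp add: s_def)
  moreover have "exp (- s) \<le> 1" using s by simp
  then have "t * exp (- s) \<le> t * 1" using True by (intro mult_left_mono) auto
  moreover have "smooth_pos N t = t * exp (- s)" using True assms by (simp add: smooth_pos_def flat_exp_def s_def)
  ultimately show ?thesis using True by (simp add: right_diff_distrib)
next
  case False
  then have "N * t \<le> 0" using assms by (simp add: mult_nonneg_nonpos)
  then show ?thesis using False assms by (simp add: smooth_pos_def flat_exp_def)
qed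

lemma smooth_pos'_tendsto: "(\<lambda>j. smooth_pos' (real (Suc j)) t) \<longlonglongrightarrow> (if t > 0 then 1 else 0)"
proof (cases "t > 0")
  case True
  have "(\<lambda>j. 1 / (real (Suc j) * t)) \<longlonglongrightarrow> 0"
    using LIMSEQ_Suc[OF lim_const_over_n[of "1 / t"]] by (simp add: field_simps)
  then have "(\<lambda>j. exp (- (1 / (real (Suc j) * t))) * (1 + 1 / (real (Suc j) * t))) \<longlonglongrightarrow> exp (- 0) * (1 + 0)"
    by (intro tendsto_intros)
  then show ?thesis using True by (simp add: smooth_pos'_pos)
qed (simp add: smooth_pos'_nonpos)

lemma smooth_pos_comp_test:
  assumes \<phi>: "\<phi> \<in> test_functions \<Omega>"
  shows "(\<lambda>x. smooth_pos N (\<phi> x)) \<in> test_functions \<Omega>"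
    and "grad (\<lambda>x. smooth_pos N (\<phi> x)) x = smooth_pos' N (\<phi> x) *\<^sub>R grad \<phi> x"
proof -
  note sm = test_functions_smooth[OF \<phi>]
  show "(\<lambda>x. smooth_pos N (\<phi> x)) \<in> test_functions \<Omega>"
    unfolding smooth_pos_def
    by (intro test_functions_mult[OF \<phi>] smooth_flat_exp_comp smooth_mult smooth_const sm)
  show "grad (\<lambda>x. smooth_pos N (\<phi> x)) x = smooth_pos' N (\<phi> x) *\<^sub>R grad \<phi> x"
    by (rule grad_eqI)
      (use has_derivative_compose[OF has_derivative_grad[OF smooth_differentiable[OF sm]] 
        smooth_pos_deriv[of N "\<phi> x", unfolded has_field_derivative_def]] in simp)
qed

lemma approximable_limit:
  assumes [measurable]: "G \<in> borel_measurable borel"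
    and lim: "\<And>e. e > 0 \<Longrightarrow> \<exists>w' G'. approximable \<Omega> w' G' \<and> (\<forall>x. \<bar>w' x - w x\<bar> \<le> e) \<and> sqnorm (\<lambda>x. G' x - G x) \<le> ennreal e"
  shows "approximable \<Omega> w G"
  unfolding approximable_def
proof (intro conjI allI impI)
  fix e :: real assume e: "e > 0"
  obtain w' G' where w': "approximable \<Omega> w' G'" "\<And>x. \<bar>w' x - w x\<bar> \<le> e / 4" "sqnorm (\<lambda>x. G' x - G x) \<le> ennreal (e / 4)"
    using lim[of "e / 4"] e by auto
  obtain \<phi> where \<phi>: "\<phi> \<in> test_functions \<Omega>" "\<And>x. \<bar>\<phi> x - w' x\<bar> \<le> e / 4" "sqnorm (\<lambda>x. grad \<phi> x - G' x) \<le> ennreal (e / 4)"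
    using approximableE[OF w'(1), of "e / 4"] e by auto
  note [measurable] = grad_measurable[OF \<phi>(1)] approximable_measurable[OF w'(1)]
  have "\<bar>\<phi> x - w x\<bar> \<le> e" for x using \<phi>(2)[of x] w'(2)[of x] e by linarith
  moreover have "sqnorm (\<lambda>x. grad \<phi> x - G x) \<le> ennreal e"
  proof -
    have "sqnorm (\<lambda>x. grad \<phi> x - G x) \<le> 2 * sqnorm (\<lambda>x. grad \<phi> x - G' x) + 2 * sqnorm (\<lambda>x. G' x - G x)"
      by (rule sqnorm_triangle) measurable
    also have "\<dots> \<le> 2 * ennreal (e / 4) + 2 * ennreal (e / 4)"
      by (intro add_mono mult_left_mono \<phi> w') auto
    also have "\<dots> = ennreal e"
      using e by (simp add: ennreal_plus[symmetric] ennreal_mult''[symmetric] ennreal_numeral[symmetric]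
          del: ennreal_plus ennreal_numeral)
    finally show ?thesis .
  qed
  ultimately show "\<exists>\<phi>\<in>test_functions \<Omega>. (\<forall>x. \<bar>\<phi> x - w x\<bar> \<le> e) \<and> sqnorm (\<lambda>x. grad \<phi> x - G x) \<le> ennreal e"
    using \<phi>(1) by blast
qed simp

lemma tendsto_0_eventually_le:
  assumes "u \<longlonglongrightarrow> (0::ennreal)" "e > (0::real)"
  shows "\<forall>\<^sub>F k in sequentially. u k \<le> ennreal e"
proof -
  have "\<forall>\<^sub>F k in sequentially. u k < ennreal e"
    using assms by (intro order_tendstoD) auto
  then show ?thesis by eventually_elim (rule less_imp_le)
qed

lemma eventually_over_Suc_le: "(e::real) > 0 \<Longrightarrow> \<forall>\<^sub>F k in sequentially. a / real (Suc k) \<le> e"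
proof -
  assume "e > 0"
  have "\<forall>\<^sub>F k in sequentially. a / real (Suc k) < e"
    using \<open>e > 0\<close> LIMSEQ_Suc[OF lim_const_over_n[of a]] by (intro order_tendstoD) auto
  then show ?thesis by eventually_elim (rule less_imp_le)
qed

text \<open>The chain rule for a smooth function with bounded derivative. The error splits into the derivative times
\<open>\<nabla>\<phi> - G\<close>, which is small by assumption, and \<open>(F'(\<phi>) - F'(w)) G\<close>, which tends to zero by dominated convergence.\<close>

lemma approximable_smooth_pos:
  assumes w: "approximable \<Omega> w G" and N: "N > 0"
  shows "approximable \<Omega> (\<lambda>x. smooth_pos N (w x)) (\<lambda>x. smooth_pos' N (w x) *\<^sub>R G x)"
proof -
  note [measurable] = approximable_measurable[OF w]
  have wc: "continuous_on UNIV w" by (rule approximable_continuous[OF w])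
  have pc: "continuous_on UNIV (\<lambda>x. smooth_pos' N (f x))" if "continuous_on UNIV f" for f :: "real^'n \<Rightarrow> real"
    by (rule continuous_on_compose2[OF smooth_pos'_continuous that]) auto
  have pm: "(\<lambda>x. smooth_pos' N (f x)) \<in> borel_measurable borel" if "continuous_on UNIV f" for f :: "real^'n \<Rightarrow> real"
    by (rule borel_measurable_continuous_onI[OF pc[OF that]])
  note [measurable] = pm[OF wc]
  show ?thesis
  proof (rule approximable_limit)
    fix e :: real assume e: "e > 0"
    obtain \<phi> where \<phi>: "\<And>j. \<phi> j \<in> test_functions \<Omega>" "\<And>j x. \<bar>\<phi> j x - w x\<bar> \<le> e / Suc j"
      "\<And>j. sqnorm (\<lambda>x. grad (\<phi> j) x - G x) \<le> ennreal (e / Suc j)" "\<And>x. (\<lambda>j. \<phi> j x) \<longlonglongrightarrow> w x"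
      using approximable_sequence[OF w e] by blast
    note [measurable] = grad_measurable[OF \<phi>(1)] pm[OF test_function_facts(4)[OF \<phi>(1)]]
    have "(\<lambda>j. sqnorm (\<lambda>x. (smooth_pos' N (\<phi> j x) - smooth_pos' N (w x)) *\<^sub>R G x)) \<longlonglongrightarrow> 0"
    proof (rule sqnorm_tendsto_0[of _ G])
      show "norm ((smooth_pos' N (\<phi> j x) - smooth_pos' N (w x)) *\<^sub>R G x) \<le> norm (G x)" for j x
      proof -
        have "\<bar>smooth_pos' N (\<phi> j x) - smooth_pos' N (w x)\<bar> \<le> 1"
          using smooth_pos'_bounds[OF N, of "\<phi> j x"] smooth_pos'_bounds[OF N, of "w x"] by linarith
        then show ?thesis using mult_right_mono[of _ 1 "norm (G x)"] by simp
      qed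
      show "AE x in lborel. (\<lambda>j. (smooth_pos' N (\<phi> j x) - smooth_pos' N (w x)) *\<^sub>R G x) \<longlonglongrightarrow> 0"
      proof (rule AE_I2)
        fix x
        have "isCont (smooth_pos' N) (w x)" using smooth_pos'_continuous by (simp add: continuous_on_eq_continuous_at)
        then have "(\<lambda>j. smooth_pos' N (\<phi> j x)) \<longlonglongrightarrow> smooth_pos' N (w x)" by (rule isCont_tendsto_compose[OF _ \<phi>(4)])
        then have "(\<lambda>j. (smooth_pos' N (\<phi> j x) - smooth_pos' N (w x)) *\<^sub>R G x) \<longlonglongrightarrow> (smooth_pos' N (w x) - smooth_pos' N (w x)) *\<^sub>R G x"
          by (intro tendsto_intros)
        then show "(\<lambda>j. (smooth_pos' N (\<phi> j x) - smooth_pos' N (w x)) *\<^sub>R G x) \<longlonglongrightarrow> 0" by simp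
      qed
    qed (use approximable_sqnorm_finite[OF w] in auto)
    from tendsto_0_eventually_le[OF this, of "e / 4"]
    have "\<forall>\<^sub>F j in sequentially. sqnorm (\<lambda>x. (smooth_pos' N (\<phi> j x) - smooth_pos' N (w x)) *\<^sub>R G x) \<le> ennreal (e / 4) \<and> e / real (Suc j) \<le> e / 4"
      using e eventually_over_Suc_le[of "e / 4" e] by (intro eventually_conj) auto
    then obtain j where j: "sqnorm (\<lambda>x. (smooth_pos' N (\<phi> j x) - smooth_pos' N (w x)) *\<^sub>R G x) \<le> ennreal (e / 4)" "e / real (Suc j) \<le> e / 4"
      using eventually_happens'[OF sequentially_bot] by blast
    have "sqnorm (\<lambda>x. smooth_pos' N (\<phi> j x) *\<^sub>R grad (\<phi> j) x - smooth_pos' N (w x) *\<^sub>R G x)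
        \<le> 2 * sqnorm (\<lambda>x. smooth_pos' N (\<phi> j x) *\<^sub>R grad (\<phi> j) x - smooth_pos' N (\<phi> j x) *\<^sub>R G x)
          + 2 * sqnorm (\<lambda>x. smooth_pos' N (\<phi> j x) *\<^sub>R G x - smooth_pos' N (w x) *\<^sub>R G x)"
      by (rule sqnorm_triangle) measurable
    also have "sqnorm (\<lambda>x. smooth_pos' N (\<phi> j x) *\<^sub>R grad (\<phi> j) x - smooth_pos' N (\<phi> j x) *\<^sub>R G x) \<le> sqnorm (\<lambda>x. grad (\<phi> j) x - G x)"
    proof (rule sqnorm_mono)
      fix x
      show "norm (smooth_pos' N (\<phi> j x) *\<^sub>R grad (\<phi> j) x - smooth_pos' N (\<phi> j x) *\<^sub>R G x) \<le> norm (grad (\<phi> j) x - G x)"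
        using smooth_pos'_bounds[OF N, of "\<phi> j x"] mult_right_mono[of "smooth_pos' N (\<phi> j x)" 1 "norm (grad (\<phi> j) x - G x)"]
        by (simp add: scaleR_diff_right[symmetric])
    qed
    also have "sqnorm (\<lambda>x. grad (\<phi> j) x - G x) \<le> ennreal (e / 4)"
      using \<phi>(3)[of j] j(2) ennreal_leI order_trans by blast
    also have "sqnorm (\<lambda>x. smooth_pos' N (\<phi> j x) *\<^sub>R G x - smooth_pos' N (w x) *\<^sub>R G x) \<le> ennreal (e / 4)"
      using j(1) by (simp add: scaleR_diff_left)
    also have "2 * ennreal (e / 4) + 2 * ennreal (e / 4) = ennreal e"
      using e by (simp add: ennreal_plus[symmetric] ennreal_mult''[symmetric] ennreal_numeral[symmetric]
          del: ennreal_plus ennreal_numeral)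
    finally have fin: "sqnorm (\<lambda>x. smooth_pos' N (\<phi> j x) *\<^sub>R grad (\<phi> j) x - smooth_pos' N (w x) *\<^sub>R G x) \<le> ennreal e"
      by (simp add: add_mono mult_left_mono)
    have "approximable \<Omega> (\<lambda>x. smooth_pos N (\<phi> j x)) (\<lambda>x. smooth_pos' N (\<phi> j x) *\<^sub>R grad (\<phi> j) x)"
      unfolding approximable_def
      by (intro conjI allI impI bexI[OF _ smooth_pos_comp_test(1)[OF \<phi>(1)[of j], of N]])
        (auto simp: smooth_pos_comp_test(2)[OF \<phi>(1)] sqnorm_def)
    moreover have "\<bar>smooth_pos N (\<phi> j x) - smooth_pos N (w x)\<bar> \<le> e" for x
      using smooth_pos_lipschitz[OF N, of "\<phi> j x" "w x"] \<phi>(2)[of j x] j(2) e by linarith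
    ultimately show "\<exists>w' G'. approximable \<Omega> w' G' \<and> (\<forall>x. \<bar>w' x - smooth_pos N (w x)\<bar> \<le> e) \<and>
        sqnorm (\<lambda>x. G' x - smooth_pos' N (w x) *\<^sub>R G x) \<le> ennreal e"
      using fin by blast
  qed measurable
qed

text \<open>The parameter \<open>N\<close> tends to infinity only after the test functions have converged: the derivatives
then converge at every value of \<open>w\<close>, including \<open>0\<close>, where the limit is \<open>0\<close>.\<close>

lemma approximable_pos_part:
  assumes w: "approximable \<Omega> w G"
  shows "approximable \<Omega> (\<lambda>x. max 0 (w x)) (\<lambda>x. if w x > 0 then G x else 0)"
proof -
  note [measurable] = approximable_measurable[OF w] borel_measurable_continuous_onI[OF approximable_continuous[OF w]]
  show ?thesis
  proof (rule approximable_limit)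
    show "(\<lambda>x. if w x > 0 then G x else 0) \<in> borel_measurable borel" by measurable
    fix e :: real assume e: "e > 0"
    have pm[measurable]: "(\<lambda>x. smooth_pos' N (w x)) \<in> borel_measurable borel" for N
      by (rule borel_measurable_continuous_onI, rule continuous_on_compose2[OF smooth_pos'_continuous approximable_continuous[OF w]]) auto
    have "(\<lambda>j. sqnorm (\<lambda>x. smooth_pos' (real (Suc j)) (w x) *\<^sub>R G x - (if w x > 0 then G x else 0))) \<longlonglongrightarrow> 0"
    proof (rule sqnorm_tendsto_0[of _ G])
      show "norm (smooth_pos' (real (Suc j)) (w x) *\<^sub>R G x - (if w x > 0 then G x else 0)) \<le> norm (G x)" for j x
      proof -
        have "\<bar>smooth_pos' (real (Suc j)) (w x) - (if w x > 0 then 1 else 0)\<bar> \<le> 1"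
          using smooth_pos'_bounds[of "real (Suc j)" "w x"] by auto
        from mult_right_mono[OF this, of "norm (G x)"]
        have "norm ((smooth_pos' (real (Suc j)) (w x) - (if w x > 0 then 1 else 0)) *\<^sub>R G x) \<le> norm (G x)" by simp
        moreover have "(smooth_pos' (real (Suc j)) (w x) - (if w x > 0 then 1 else 0)) *\<^sub>R G x
          = smooth_pos' (real (Suc j)) (w x) *\<^sub>R G x - (if w x > 0 then G x else 0)" by (simp add: scaleR_diff_left)
        ultimately show ?thesis by (simp only:)
      qed
      show "AE x in lborel. (\<lambda>j. smooth_pos' (real (Suc j)) (w x) *\<^sub>R G x - (if w x > 0 then G x else 0)) \<longlonglongrightarrow> 0"
      proof (rule AE_I2)
        fix x
        have "(\<lambda>j. smooth_pos' (real (Suc j)) (w x) *\<^sub>R G x - (if w x > 0 then G x else 0)) \<longlonglongrightarrow>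
            (if w x > 0 then 1 else 0) *\<^sub>R G x - (if w x > 0 then G x else 0)"
          by (intro tendsto_intros smooth_pos'_tendsto)
        then show "(\<lambda>j. smooth_pos' (real (Suc j)) (w x) *\<^sub>R G x - (if w x > 0 then G x else 0)) \<longlonglongrightarrow> 0"
          by (simp split: if_splits)
      qed
    qed (use approximable_sqnorm_finite[OF w] in auto)
    from tendsto_0_eventually_le[OF this e]
    have "\<forall>\<^sub>F j in sequentially. sqnorm (\<lambda>x. smooth_pos' (real (Suc j)) (w x) *\<^sub>R G x - (if w x > 0 then G x else 0)) \<le> ennreal e \<and> 1 / real (Suc j) \<le> e"
      using e eventually_over_Suc_le[of e 1] by (intro eventually_conj) auto
    then obtain j where j: "sqnorm (\<lambda>x. smooth_pos' (real (Suc j)) (w x) *\<^sub>R G x - (if w x > 0 then G x else 0)) \<le> ennreal e" "1 / real (Suc j) \<le> e"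
      using eventually_happens'[OF sequentially_bot] by blast
    have "\<bar>smooth_pos (real (Suc j)) (w x) - max 0 (w x)\<bar> \<le> e" for x
      using smooth_pos_close[of "real (Suc j)" "w x"] j(2) by linarith
    then show "\<exists>w' G'. approximable \<Omega> w' G' \<and> (\<forall>x. \<bar>w' x - max 0 (w x)\<bar> \<le> e) \<and>
        sqnorm (\<lambda>x. G' x - (if w x > 0 then G x else 0)) \<le> ennreal e"
      using approximable_smooth_pos[OF w of_nat_0_less_iff[THEN iffD2, OF zero_less_Suc[of j]]] j(1) by blast
  qed
qed

text \<open>Write the increment as the integral of the gradient along the segment from \<open>x\<close> to \<open>x + z\<close>, apply the
Cauchy-Schwarz inequality on the segment, and integrate in \<open>x\<close>.\<close>

lemma test_function_translation:
  fixes \<phi> :: "real^'n::finite \<Rightarrow> real"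
  assumes \<phi>: "\<phi> \<in> test_functions \<Omega>"
  shows "sqnorm (\<lambda>x. \<phi> (x + z) - \<phi> x) \<le> ennreal ((norm z)\<^sup>2) * sqnorm (grad \<phi>)"
proof -
  note sm = test_functions_smooth[OF \<phi>]
  note gc = grad_continuous[OF sm]
  have [measurable]: "grad \<phi> \<in> borel_measurable borel" by (rule grad_measurable[OF \<phi>])
  let ?I = "\<lambda>t::real. indicator {0..1} t :: ennreal"
  have "ennreal ((norm (\<phi> (x + z) - \<phi> x))\<^sup>2)
      \<le> (\<integral>\<^sup>+t. ?I t * ennreal ((norm z)\<^sup>2 * (norm (grad \<phi> (x + t *\<^sub>R z)))\<^sup>2) \<partial>lborel)" for x
  proof -
    let ?f = "\<lambda>t. grad \<phi> (x + t *\<^sub>R z) \<bullet> z"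
    have fc: "continuous_on UNIV ?f"
      by (intro continuous_intros continuous_on_compose2[OF gc]) auto
    have [measurable]: "?f \<in> borel_measurable borel" by (rule borel_measurable_continuous_onI[OF fc])
    have ftc: "integral\<^sup>L lborel (\<lambda>t. indicator {0..1} t *\<^sub>R ?f t) = \<phi> (x + 1 *\<^sub>R z) - \<phi> (x + 0 *\<^sub>R z)"
    proof (rule integral_FTC_atLeastAtMost)
      fix t :: real
      have "((\<lambda>t. \<phi> (x + t *\<^sub>R z)) has_derivative (\<lambda>h. grad \<phi> (x + t *\<^sub>R z) \<bullet> (h *\<^sub>R z))) (at t within {0..1})"
        by (rule has_derivative_compose[OF _ has_derivative_grad[OF smooth_differentiable[OF sm]]])
          (auto intro!: derivative_eq_intros)
      then show "((\<lambda>t. \<phi> (x + t *\<^sub>R z)) has_vector_derivative ?f t) (at t within {0..1})"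
        by (simp add: has_vector_derivative_def)
    qed (use fc continuous_on_subset in auto)
    have int: "integrable lborel (\<lambda>t. indicator {0..1} t *\<^sub>R ?f t)"
      by (rule borel_integrable_compact) (use fc continuous_on_subset in auto)
    have "ennreal (norm (\<phi> (x + z) - \<phi> x)) \<le> (\<integral>\<^sup>+t. ennreal (norm (indicator {0..1} t *\<^sub>R ?f t)) \<partial>lborel)"
      using integral_norm_bound_ennreal[OF int] ftc by simp
    also have "\<dots> = (\<integral>\<^sup>+t. ?I t * (?I t * ennreal \<bar>?f t\<bar>) \<partial>lborel)"
      by (intro nn_integral_cong) (simp add: indicator_def)
    finally have "(ennreal (norm (\<phi> (x + z) - \<phi> x)))\<^sup>2 \<le> (\<integral>\<^sup>+t. ?I t * (?I t * ennreal \<bar>?f t\<bar>) \<partial>lborel)\<^sup>2"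
      by (rule power_mono) simp
    also have "\<dots> \<le> (\<integral>\<^sup>+t. (?I t)\<^sup>2 \<partial>lborel) * (\<integral>\<^sup>+t. (?I t * ennreal \<bar>?f t\<bar>)\<^sup>2 \<partial>lborel)"
      by (rule Cauchy_Schwarz_nn_integral) measurable
    also have "(\<integral>\<^sup>+t. (?I t)\<^sup>2 \<partial>lborel) = (\<integral>\<^sup>+t. ?I t \<partial>lborel)"
      by (intro nn_integral_cong) (simp add: indicator_def)
    also have "\<dots> = 1" by simp
    also have "(\<integral>\<^sup>+t. (?I t * ennreal \<bar>?f t\<bar>)\<^sup>2 \<partial>lborel)
        \<le> (\<integral>\<^sup>+t. ?I t * ennreal ((norm z)\<^sup>2 * (norm (grad \<phi> (x + t *\<^sub>R z)))\<^sup>2) \<partial>lborel)"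
    proof (rule nn_integral_mono)
      fix t :: real
      have "\<bar>?f t\<bar>\<^sup>2 \<le> (norm (grad \<phi> (x + t *\<^sub>R z)) * norm z)\<^sup>2"
        by (intro power_mono Cauchy_Schwarz_ineq2) auto
      then show "(?I t * ennreal \<bar>?f t\<bar>)\<^sup>2 \<le> ?I t * ennreal ((norm z)\<^sup>2 * (norm (grad \<phi> (x + t *\<^sub>R z)))\<^sup>2)"
        by (auto simp: indicator_def ennreal_power power_mult_distrib mult.commute intro!: ennreal_leI)
    qed
    finally show ?thesis by (simp add: ennreal_power)
  qed
  then have "sqnorm (\<lambda>x. \<phi> (x + z) - \<phi> x)
      \<le> (\<integral>\<^sup>+x. \<integral>\<^sup>+t. ?I t * ennreal ((norm z)\<^sup>2 * (norm (grad \<phi> (x + t *\<^sub>R z)))\<^sup>2) \<partial>lborel \<partial>lborel)"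
    unfolding sqnorm_def by (intro nn_integral_mono) auto
  also have "\<dots> = (\<integral>\<^sup>+t. \<integral>\<^sup>+x. ?I t * ennreal ((norm z)\<^sup>2 * (norm (grad \<phi> (x + t *\<^sub>R z)))\<^sup>2) \<partial>lborel \<partial>lborel)"
    by (rule lborel_pair.Fubini') measurable
  also have "\<dots> = (\<integral>\<^sup>+t. ?I t * (ennreal ((norm z)\<^sup>2) * sqnorm (grad \<phi>)) \<partial>lborel)"
  proof (intro nn_integral_cong)
    fix t :: real
    have "(\<integral>\<^sup>+x. ennreal ((norm (grad \<phi> (x + t *\<^sub>R z)))\<^sup>2) \<partial>lborel) = sqnorm (grad \<phi>)"
      unfolding sqnorm_def by (rule nn_integral_lborel_shift) measurable
    then show "(\<integral>\<^sup>+x. ?I t * ennreal ((norm z)\<^sup>2 * (norm (grad \<phi> (x + t *\<^sub>R z)))\<^sup>2) \<partial>lborel)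
        = ?I t * (ennreal ((norm z)\<^sup>2) * sqnorm (grad \<phi>))"
      by (simp add: nn_integral_cmult ennreal_mult)
  qed
  also have "\<dots> = ennreal ((norm z)\<^sup>2) * sqnorm (grad \<phi>)"
    by (subst nn_integral_multc) auto
  finally show ?thesis .
qed

text \<open>Fatou's lemma along the approximating test functions. The factor \<open>2\<close> comes from the crude bound for
the norms of their gradients and is harmless.\<close>

lemma approximable_translation:
  fixes w :: "real^'n::finite \<Rightarrow> real"
  assumes w: "approximable \<Omega> w G"
  shows "sqnorm (\<lambda>x. w (x + z) - w x) \<le> ennreal ((norm z)\<^sup>2) * (2 * sqnorm G)"
proof -
  note [measurable] = approximable_measurable[OF w] borel_measurable_continuous_onI[OF approximable_continuous[OF w]]
  have "sqnorm (\<lambda>x. w (x + z) - w x) \<le> ennreal ((norm z)\<^sup>2) * (2 * sqnorm G + 2 * ennreal e)" if e: "e > 0" for e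
  proof -
    obtain \<phi> where \<phi>: "\<And>j. \<phi> j \<in> test_functions \<Omega>"
      "\<And>j. sqnorm (\<lambda>x. grad (\<phi> j) x - G x) \<le> ennreal (e / Suc j)" "\<And>x. (\<lambda>j. \<phi> j x) \<longlonglongrightarrow> w x"
      using approximable_sequence[OF w e] by metis
    note [measurable] = grad_measurable[OF \<phi>(1)] test_function_facts(1)[OF \<phi>(1)]
    have bd: "sqnorm (\<lambda>x. \<phi> j (x + z) - \<phi> j x) \<le> ennreal ((norm z)\<^sup>2) * (2 * sqnorm G + 2 * ennreal e)" for j
    proof -
      have "sqnorm (\<lambda>x. grad (\<phi> j) x - G x + G x) \<le> 2 * sqnorm (\<lambda>x. grad (\<phi> j) x - G x) + 2 * sqnorm G"
        by (rule sqnorm_add) measurable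
      also have "sqnorm (\<lambda>x. grad (\<phi> j) x - G x) \<le> ennreal e"
        using e by (intro order_trans[OF \<phi>(2)] ennreal_leI) (simp add: field_simps)
      finally have "sqnorm (grad (\<phi> j)) \<le> 2 * sqnorm G + 2 * ennreal e"
        by (simp add: add.commute mult_left_mono)
      then show ?thesis by (intro order_trans[OF test_function_translation[OF \<phi>(1)]] mult_left_mono) auto
    qed
    have "sqnorm (\<lambda>x. w (x + z) - w x) = (\<integral>\<^sup>+x. liminf (\<lambda>j. ennreal ((norm (\<phi> j (x + z) - \<phi> j x))\<^sup>2)) \<partial>lborel)"
      unfolding sqnorm_def
    proof (rule nn_integral_cong)
      fix x
      have "(\<lambda>j. ennreal ((norm (\<phi> j (x + z) - \<phi> j x))\<^sup>2)) \<longlonglongrightarrow> ennreal ((norm (w (x + z) - w x))\<^sup>2)"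
        by (intro tendsto_ennrealI tendsto_intros \<phi>)
      then show "ennreal ((norm (w (x + z) - w x))\<^sup>2) = liminf (\<lambda>j. ennreal ((norm (\<phi> j (x + z) - \<phi> j x))\<^sup>2))"
        by (rule lim_imp_Liminf[OF sequentially_bot, symmetric])
    qed
    also have "\<dots> \<le> liminf (\<lambda>j. sqnorm (\<lambda>x. \<phi> j (x + z) - \<phi> j x))"
      unfolding sqnorm_def by (rule nn_integral_liminf) measurable
    also have "\<dots> \<le> liminf (\<lambda>j::nat. ennreal ((norm z)\<^sup>2) * (2 * sqnorm G + 2 * ennreal e))"
      by (intro Liminf_mono always_eventually allI bd)
    also have "\<dots> = ennreal ((norm z)\<^sup>2) * (2 * sqnorm G + 2 * ennreal e)" by (simp add: Liminf_const)
    finally show ?thesis .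
  qed
  note main = this
  show ?thesis
  proof (rule ennreal_le_epsilon)
    fix e :: real assume e: "e > 0"
    define d where "d = e / (2 * ((norm z)\<^sup>2 + 1))"
    have z1: "(norm z)\<^sup>2 + 1 > 0" by (simp add: add_nonneg_pos)
    then have d: "d > 0" "(norm z)\<^sup>2 * (2 * d) \<le> e" using e by (auto simp: d_def field_simps)
    have "sqnorm (\<lambda>x. w (x + z) - w x) \<le> ennreal ((norm z)\<^sup>2) * (2 * sqnorm G) + ennreal ((norm z)\<^sup>2) * (2 * ennreal d)"
      using main[OF d(1)] by (simp add: distrib_left)
    also have "ennreal ((norm z)\<^sup>2) * (2 * ennreal d) \<le> ennreal e"
      using d by (simp add: ennreal_mult''[symmetric] ennreal_numeral[symmetric] ennreal_leI del: ennreal_numeral)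
    finally show "sqnorm (\<lambda>x. w (x + z) - w x) \<le> ennreal ((norm z)\<^sup>2) * (2 * sqnorm G) + ennreal e"
      by (simp add: add_left_mono)
  qed
qed

section \<open>A Faber-Krahn inequality\<close>

lemma zero_outside_bounded_facts:
  fixes w :: "real^'n::finite \<Rightarrow> real"
  assumes c: "continuous_on UNIV w" and "bounded \<Omega>" and z: "\<And>x. x \<notin> \<Omega> \<Longrightarrow> w x = 0"
  shows "integrable lborel w" "sqnorm w < \<infinity>"
proof -
  have K: "compact (closure \<Omega>)" using \<open>bounded \<Omega>\<close> by (simp add: compact_closure)
  have z': "w x = 0" if "x \<notin> closure \<Omega>" for x using that z closure_subset by blast
  show "integrable lborel w" by (rule integrable_continuous_compact_support[OF c K z'])
  have [measurable]: "w \<in> borel_measurable borel" by (rule borel_measurable_continuous_onI[OF c])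
  have "integrable lborel (\<lambda>x. (norm (w x))\<^sup>2)"
    by (rule integrable_continuous_compact_support[OF _ K]) (use c z' in \<open>auto intro!: continuous_intros\<close>)
  then show "sqnorm w < \<infinity>" by (subst (asm) integrable_square_iff_sqnorm) auto
qed

text \<open>For \<open>z\<close> in the ball \<open>B\<close> of radius \<open>r\<close> the translation estimate gives
\<open>\<integral> w(x) w(x + z) dx = \<integral> w\<^sup>2 - 1/2 \<integral> (w(x + z) - w(x))\<^sup>2 \<ge> \<integral> w\<^sup>2 - r\<^sup>2 \<integral> |G|\<^sup>2\<close>. Averaged over \<open>z\<close>, the left-hand
side is at most \<open>(\<integral> w)\<^sup>2 / |B|\<close>, hence at most \<open>|{w \<noteq> 0}| / |B| \<integral> w\<^sup>2\<close> by the Cauchy-Schwarz inequality, and this is at most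
half of \<open>\<integral> w\<^sup>2\<close> if the support is small compared with \<open>B\<close>.\<close>

lemma faber_krahn:
  fixes w :: "real^'n::finite \<Rightarrow> real"
  assumes w: "approximable \<Omega> w G" and "bounded \<Omega>" and nn: "\<And>x. 0 \<le> w x" and r: "r > 0"
    and small: "2 * emeasure lborel {x. w x \<noteq> 0} \<le> emeasure lborel (ball (0::real^'n) r)"
  shows "sqnorm w \<le> ennreal (2 * r\<^sup>2) * sqnorm G"
proof -
  have wc: "continuous_on UNIV w" by (rule approximable_continuous[OF w])
  have wm[measurable]: "w \<in> borel_measurable borel" by (rule borel_measurable_continuous_onI[OF wc])
  note fin = zero_outside_bounded_facts[OF wc \<open>bounded \<Omega>\<close> approximable_zero_outside[OF w]]
  let ?B = "ball (0::real^'n) r" and ?A = "{x. w x \<noteq> 0}"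
  have [measurable]: "?B \<in> sets borel" by simp
  have Gfin: "sqnorm G < \<infinity>" by (rule approximable_sqnorm_finite[OF w])
  have shift: "2 * sqnorm w \<le> 2 * (\<integral>\<^sup>+x. ennreal (w x * w (x + z)) \<partial>lborel) + ennreal (r\<^sup>2) * (2 * sqnorm G)" if "z \<in> ?B" for z
  proof -
    have "(\<integral>\<^sup>+x. ennreal ((norm (w x))\<^sup>2) + ennreal ((norm (w (x + z)))\<^sup>2) \<partial>lborel) = 2 * sqnorm w"
      using nn_integral_lborel_shift[of "\<lambda>x. ennreal ((norm (w x))\<^sup>2)" z]
      by (subst nn_integral_add) (auto simp: sqnorm_def mult_2)
    moreover have "(\<integral>\<^sup>+x. ennreal ((norm (w x))\<^sup>2) + ennreal ((norm (w (x + z)))\<^sup>2) \<partial>lborel)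
      = (\<integral>\<^sup>+x. 2 * ennreal (w x * w (x + z)) + ennreal ((norm (w (x + z) - w x))\<^sup>2) \<partial>lborel)"
    proof (rule nn_integral_cong)
      fix x
      have "(w x)\<^sup>2 + (w (x+z))\<^sup>2 = 2 * (w x * w (x+z)) + (w (x+z) - w x)\<^sup>2"
        by (simp add: power2_diff)
      then show "ennreal ((norm (w x))\<^sup>2) + ennreal ((norm (w (x + z)))\<^sup>2) =
          2 * ennreal (w x * w (x + z)) + ennreal ((norm (w (x + z) - w x))\<^sup>2)"
        using nn by (simp add: ennreal_plus[symmetric] ennreal_mult''[symmetric] ennreal_numeral[symmetric]
          del: ennreal_plus ennreal_numeral)
    qed
    moreover have "\<dots> = 2 * (\<integral>\<^sup>+x. ennreal (w x * w (x + z)) \<partial>lborel) + sqnorm (\<lambda>x. w (x + z) - w x)"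
      by (subst nn_integral_add) (auto simp: sqnorm_def nn_integral_cmult)
    moreover have "sqnorm (\<lambda>x. w (x + z) - w x) \<le> ennreal (r\<^sup>2) * (2 * sqnorm G)"
      using that by (intro order_trans[OF approximable_translation[OF w]] mult_right_mono ennreal_leI power_mono) auto
    ultimately show ?thesis by (simp add: add_left_mono)
  qed
  let ?b = "emeasure lborel ?B"
  have "2 * sqnorm w * ?b = (\<integral>\<^sup>+z. 2 * sqnorm w * indicator ?B z \<partial>lborel)"
    by (simp add: nn_integral_cmult_indicator)
  also have "\<dots> \<le> (\<integral>\<^sup>+z. 2 * (\<integral>\<^sup>+x. ennreal (w x * w (x + z)) \<partial>lborel) + (ennreal (r\<^sup>2) * (2 * sqnorm G)) * indicator ?B z \<partial>lborel)"
    using shift by (intro nn_integral_mono) (auto simp: indicator_def)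
  also have "\<dots> = 2 * (\<integral>\<^sup>+z. \<integral>\<^sup>+x. ennreal (w x * w (x + z)) \<partial>lborel \<partial>lborel) + (ennreal (r\<^sup>2) * (2 * sqnorm G)) * ?b"
    by (subst nn_integral_add) (auto simp: nn_integral_cmult nn_integral_cmult_indicator)
  also have "(\<integral>\<^sup>+z. \<integral>\<^sup>+x. ennreal (w x * w (x + z)) \<partial>lborel \<partial>lborel) = (\<integral>\<^sup>+x. \<integral>\<^sup>+z. ennreal (w x * w (x + z)) \<partial>lborel \<partial>lborel)"
    by (rule lborel_pair.Fubini') measurable
  also have "\<dots> = (\<integral>\<^sup>+x. ennreal (w x) * (\<integral>\<^sup>+z. ennreal (w z) \<partial>lborel) \<partial>lborel)"
  proof (rule nn_integral_cong)
    fix x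
    have "(\<integral>\<^sup>+z. ennreal (w x * w (x + z)) \<partial>lborel) = ennreal (w x) * (\<integral>\<^sup>+z. ennreal (w (z + x)) \<partial>lborel)"
      using nn by (subst nn_integral_cmult[symmetric]) (auto simp: ennreal_mult add.commute)
    also have "(\<integral>\<^sup>+z. ennreal (w (z + x)) \<partial>lborel) = (\<integral>\<^sup>+z. ennreal (w z) \<partial>lborel)"
      by (rule nn_integral_lborel_shift) measurable
    finally show "(\<integral>\<^sup>+z. ennreal (w x * w (x + z)) \<partial>lborel) = ennreal (w x) * (\<integral>\<^sup>+z. ennreal (w z) \<partial>lborel)" .
  qed
  also have "\<dots> = (\<integral>\<^sup>+x. ennreal (w x) \<partial>lborel)\<^sup>2"
    by (simp add: nn_integral_multc power2_eq_square)
  also have "(\<integral>\<^sup>+x. ennreal (w x) \<partial>lborel) = (\<integral>\<^sup>+x. indicator ?A x * ennreal (w x) \<partial>lborel)"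
    by (intro nn_integral_cong) (auto simp: indicator_def)
  also have "(\<integral>\<^sup>+x. indicator ?A x * ennreal (w x) \<partial>lborel)\<^sup>2
      \<le> (\<integral>\<^sup>+x. (indicator ?A x)\<^sup>2 \<partial>lborel) * (\<integral>\<^sup>+x. (ennreal (w x))\<^sup>2 \<partial>lborel)"
    by (rule Cauchy_Schwarz_nn_integral) measurable
  also have "(\<integral>\<^sup>+x. (indicator ?A x)\<^sup>2 \<partial>(lborel :: (real^'n) measure)) = (\<integral>\<^sup>+x. indicator ?A x \<partial>lborel)"
    by (intro nn_integral_cong) (simp add: indicator_def)
  also have "\<dots> = emeasure lborel ?A" by simp
  also have "(\<integral>\<^sup>+x. (ennreal (w x))\<^sup>2 \<partial>lborel) = sqnorm w"
    using nn by (simp add: sqnorm_def ennreal_power)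
  finally have main: "2 * sqnorm w * ?b \<le> 2 * (emeasure lborel ?A * sqnorm w) + (ennreal (r\<^sup>2) * (2 * sqnorm G)) * ?b"
    by (simp add: add_mono mult_left_mono)
  also have "2 * (emeasure lborel ?A * sqnorm w) \<le> ?b * sqnorm w"
    using mult_right_mono[OF small, of "sqnorm w"] by (simp add: mult.assoc)
  finally have main: "2 * sqnorm w * ?b \<le> ?b * sqnorm w + (ennreal (r\<^sup>2) * (2 * sqnorm G)) * ?b"
    by (simp add: add_right_mono)
  obtain b where b: "?b = ennreal b" "b > 0"
    using emeasure_ball[of r "0::real^'n"] r by (metis less_imp_le unit_ball_vol_pos zero_less_power mult_pos_pos of_nat_0_le_iff)
  obtain S where S: "sqnorm w = ennreal S" "S \<ge> 0" using fin(2) by (cases "sqnorm w") auto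
  obtain T where T: "sqnorm G = ennreal T" "T \<ge> 0" using Gfin by (cases "sqnorm G") auto
  have "ennreal (2 * S * b) \<le> ennreal (b * S + r\<^sup>2 * (2 * T) * b)"
    using main S T b by (simp add: ennreal_plus[symmetric] ennreal_mult[symmetric] ennreal_numeral[symmetric]
        del: ennreal_plus ennreal_numeral)
  then have "2 * S * b \<le> b * S + r\<^sup>2 * (2 * T) * b"
    using S T b by (subst (asm) ennreal_le_iff) auto
  then have "b * S \<le> b * (2 * r\<^sup>2 * T)" by (simp add: algebra_simps)
  then have "S \<le> 2 * r\<^sup>2 * T" using b(2) by simp
  then show ?thesis using S T by (simp add: ennreal_mult[symmetric] ennreal_leI)
qed

section \<open>Weak gradients over Lebesgue and Borel measure\<close>

lemma AE_lebesgue_on_iff: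
  fixes \<Omega> :: "(real^'n::finite) set"
  assumes "\<Omega> \<in> sets borel"
  shows "(AE x in lebesgue_on \<Omega>. P x) \<longleftrightarrow> (AE x in lborel. x \<in> \<Omega> \<longrightarrow> P x)"
  using assms by (subst AE_restrict_space_iff) (auto simp: AE_completion_iff)

lemma integral_lebesgue_on_eq:
  fixes F :: "real^'n::finite \<Rightarrow> real"
  assumes "\<Omega> \<in> sets borel" "F \<in> borel_measurable borel" "\<And>x. x \<notin> \<Omega> \<Longrightarrow> F x = 0"
  shows "integral\<^sup>L (lebesgue_on \<Omega>) F = integral\<^sup>L lborel F"
    "integrable (lebesgue_on \<Omega>) F \<longleftrightarrow> integrable lborel F"
proof -
  have eq: "(\<lambda>x. indicator \<Omega> x * F x) = F" using assms(3) by (auto simp: indicator_def fun_eq_iff)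
  show "integral\<^sup>L (lebesgue_on \<Omega>) F = integral\<^sup>L lborel F"
    using assms by (subst integral_restrict_space) (auto simp: eq integral_completion)
  show "integrable (lebesgue_on \<Omega>) F \<longleftrightarrow> integrable lborel F"
    using assms by (subst integrable_restrict_space) (auto simp: eq integrable_completion set_integrable_def)
qed

lemma nn_integral_lebesgue_on_eq:
  fixes F :: "real^'n::finite \<Rightarrow> ennreal"
  assumes "\<Omega> \<in> sets borel" "\<And>x. x \<notin> \<Omega> \<Longrightarrow> F x = 0"
  shows "integral\<^sup>N (lebesgue_on \<Omega>) F = integral\<^sup>N lborel F"
proof -
  have eq: "(\<lambda>x. F x * indicator \<Omega> x) = F" using assms(2) by (auto simp: indicator_def fun_eq_iff)
  show ?thesis using assms by (subst nn_integral_restrict_space) (auto simp: eq nn_integral_completion)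
qed

lemma borel_measurable_lebesgue_on:
  fixes F :: "real^'n::finite \<Rightarrow> 'b::euclidean_space"
  assumes "F \<in> borel_measurable borel"
  shows "F \<in> borel_measurable (lebesgue_on \<Omega>)"
  using assms by (intro measurable_restrict_space1 measurable_completion) simp

text \<open>Weak gradients are only Lebesgue measurable. Borel representatives that vanish outside the domain make
Fubini's theorem on \<open>lborel\<close> available and turn integrals over \<open>\<Omega>\<close> into integrals over the whole space.\<close>

lemma lebesgue_on_borel_representative:
  fixes f :: "real^'n::finite \<Rightarrow> real^'n"
  assumes \<Omega>: "\<Omega> \<in> sets borel" and f: "f \<in> borel_measurable (lebesgue_on \<Omega>)"
  obtains f' where "f' \<in> borel_measurable borel" "\<And>x. x \<notin> \<Omega> \<Longrightarrow> f' x = 0" "AE x in lebesgue_on \<Omega>. f x = f' x"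
proof -
  have "\<forall>i. \<exists>h. h \<in> borel_measurable borel \<and> (AE x in lborel. (if x \<in> \<Omega> then f x $ i else 0) = h x)"
  proof
    fix i
    have "(\<lambda>x. f x $ i) \<in> borel_measurable (lebesgue_on \<Omega>)" using f by measurable
    then have "(\<lambda>x. if x \<in> \<Omega> then f x $ i else 0) \<in> borel_measurable lebesgue"
      using \<Omega> by (intro borel_measurable_if_I) auto
    from completion_ex_borel_measurable_real[OF this]
    show "\<exists>h. h \<in> borel_measurable borel \<and> (AE x in lborel. (if x \<in> \<Omega> then f x $ i else 0) = h x)" by auto
  qed
  from choice[OF this] obtain h where hh: "\<forall>i. h i \<in> borel_measurable borel \<and>
      (AE x in lborel. (if x \<in> \<Omega> then f x $ i else 0) = h i x)" by (elim exE)
  have h[measurable]: "h i \<in> borel_measurable borel" for i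
    using spec[OF hh, of i] by (rule conjunct1)
  have eq: "AE x in lborel. (if x \<in> \<Omega> then f x $ i else 0) = h i x" for i
    using spec[OF hh, of i] by (rule conjunct2)
  define f' where "f' x = (if x \<in> \<Omega> then (\<chi> i. h i x) else 0)" for x
  show ?thesis
  proof (rule that[of f'])
    have "(\<lambda>x. \<chi> i. h i x) \<in> borel_measurable borel" by (rule borel_measurable_vecI) simp
    then show "f' \<in> borel_measurable borel" unfolding f'_def using \<Omega> by measurable
    have "AE x in lborel. \<forall>i. (if x \<in> \<Omega> then f x $ i else 0) = h i x" using eq by (simp add: AE_all_countable)
    then have "AE x in lborel. x \<in> \<Omega> \<longrightarrow> f x = f' x" 
      by eventually_elim (auto simp: f'_def vec_eq_iff)
    then show "AE x in lebesgue_on \<Omega>. f x = f' x" by (simp add: AE_lebesgue_on_iff[OF \<Omega>])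
  qed (simp add: f'_def)
qed

text \<open>A function of \<open>W\<^sup>1\<^sup>,\<^sup>2\<close> with its weak gradient, both represented by Borel functions that are extended by zero.
The test functions are supported in \<open>\<Omega>\<close>, so the extension may jump at the boundary.\<close>

definition weak_pair ::
  "(real^'n::finite) set \<Rightarrow> (real^'n \<Rightarrow> real) \<Rightarrow> (real^'n \<Rightarrow> real^'n) \<Rightarrow> bool" where
  "weak_pair \<Omega> u g \<longleftrightarrow>
     u \<in> borel_measurable borel \<and> g \<in> borel_measurable borel \<and> sqnorm u < \<infinity> \<and> sqnorm g < \<infinity> \<and>
     (\<forall>x. x \<notin> \<Omega> \<longrightarrow> u x = 0 \<and> g x = 0) \<and>
     (\<forall>\<phi>\<in>test_functions \<Omega>. \<forall>i.
        (\<integral>x. u x * partial_deriv i \<phi> x \<partial>lborel) = - (\<integral>x. g x $ i * \<phi> x \<partial>lborel))"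

lemma integrable_L2_test:
  assumes "f \<in> borel_measurable borel" "sqnorm f < \<infinity>" "\<phi> \<in> test_functions \<Omega>"
  shows "integrable lborel (\<lambda>x. f x * \<phi> x)"
proof (rule integrable_mult_square)
  note [measurable] = assms(1) test_function_facts(1)[OF assms(3)]
  show "integrable lborel (\<lambda>x. (f x)\<^sup>2)"
    using assms(2) integrable_square_iff_sqnorm[of f] by simp
  show "integrable lborel (\<lambda>x. (\<phi> x)\<^sup>2)"
    unfolding power2_eq_square
    by (rule test_function_facts(2)[OF test_functions_mult[OF assms(3) test_functions_smooth[OF assms(3)]]])
qed (use assms(1) test_function_facts(1)[OF assms(3)] in measurable)

lemma sqnorm_component_finite:
  fixes g :: "real^'n::finite \<Rightarrow> real^'m::finite"
  shows "sqnorm g < \<infinity> \<Longrightarrow> sqnorm (\<lambda>x. g x $ i) < \<infinity>"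
  by (rule le_less_trans[OF sqnorm_mono[of "\<lambda>x. g x $ i" g]]) (simp_all add: component_le_norm_cart)

lemma weak_pair_diff:
  assumes "weak_pair \<Omega> u g" "weak_pair \<Omega> w G"
  shows "weak_pair \<Omega> (\<lambda>x. u x - w x) (\<lambda>x. g x - G x)"
proof -
  note a = assms[unfolded weak_pair_def]
  have [measurable]: "u \<in> borel_measurable borel" "g \<in> borel_measurable borel"
    "w \<in> borel_measurable borel" "G \<in> borel_measurable borel" using a by auto
  have "sqnorm (\<lambda>x. u x - w x) < \<infinity>" "sqnorm (\<lambda>x. g x - G x) < \<infinity>"
    using a by (auto intro!: le_less_trans[OF sqnorm_diff] simp: ennreal_mult_less_top)
  moreover have "(\<integral>x. (u x - w x) * partial_deriv i \<phi> x \<partial>lborel) = - (\<integral>x. (g x - G x) $ i * \<phi> x \<partial>lborel)"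
    if \<phi>: "\<phi> \<in> test_functions \<Omega>" for \<phi> i
  proof -
    have "integrable lborel (\<lambda>x. u x * partial_deriv i \<phi> x)" "integrable lborel (\<lambda>x. w x * partial_deriv i \<phi> x)"
      using a by (auto intro!: integrable_L2_test[OF _ _ test_functions_partial[OF \<phi>]])
    moreover have "integrable lborel (\<lambda>x. g x $ i * \<phi> x)" "integrable lborel (\<lambda>x. G x $ i * \<phi> x)"
      using a by (auto intro!: integrable_L2_test[OF _ sqnorm_component_finite \<phi>])
    moreover have "(\<integral>x. u x * partial_deriv i \<phi> x \<partial>lborel) = - (\<integral>x. g x $ i * \<phi> x \<partial>lborel)"
      "(\<integral>x. w x * partial_deriv i \<phi> x \<partial>lborel) = - (\<integral>x. G x $ i * \<phi> x \<partial>lborel)" using a \<phi> by blast+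
    ultimately show ?thesis by (simp add: left_diff_distrib)
  qed
  ultimately show ?thesis using a unfolding weak_pair_def by (intro conjI) auto
qed

lemma weak_pair_approximable:
  assumes w: "approximable \<Omega> w G" and "bounded \<Omega>" and G: "\<And>x. x \<notin> \<Omega> \<Longrightarrow> G x = 0"
  shows "weak_pair \<Omega> w G"
proof -
  note fin = zero_outside_bounded_facts[OF approximable_continuous[OF w] \<open>bounded \<Omega>\<close> approximable_zero_outside[OF w]]
  show ?thesis
    unfolding weak_pair_def
    using fin approximable_measurable[OF w] approximable_sqnorm_finite[OF w] G approximable_zero_outside[OF w]
      approximable_weak_grad[OF w fin(1)] borel_measurable_continuous_onI[OF approximable_continuous[OF w]]
    by auto
qed

lemma approximable_test: "\<phi> \<in> test_functions \<Omega> \<Longrightarrow> approximable \<Omega> \<phi> (grad \<phi>)"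
  unfolding approximable_def
  by (intro conjI allI impI grad_measurable bexI[of _ \<phi>]) (auto simp: sqnorm_def)

lemma grad_zero_outside:
  assumes "\<phi> \<in> test_functions \<Omega>" "x \<notin> \<Omega>" shows "grad \<phi> x = 0"
proof -
  obtain K where K: "compact K" "K \<subseteq> \<Omega>" "\<And>x. x \<notin> K \<Longrightarrow> \<phi> x = 0"
    using test_functionsE[OF assms(1)] by metis
  have "x \<notin> K" using K(2) assms(2) by blast
  from partial_deriv_zero_outside[OF K(1) this K(3)] show ?thesis by (simp add: vec_eq_iff)
qed

lemma weak_pair_test: "\<phi> \<in> test_functions \<Omega> \<Longrightarrow> bounded \<Omega> \<Longrightarrow> weak_pair \<Omega> \<phi> (grad \<phi>)"
  by (intro weak_pair_approximable approximable_test grad_zero_outside)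

text \<open>The difference \<open>h\<close> of two weak gradients is orthogonal to all test functions on the ball. Multiplying it by a bump
that is supported in the ball reduces the claim to the fundamental lemma on the whole space, and the bumps \<open>\<zeta> m\<close>
exhaust the ball.\<close>

lemma weak_pair_unique:
  fixes u :: "real^'n::finite \<Rightarrow> real"
  assumes "weak_pair (ball 0 R) u g" "weak_pair (ball 0 R) u g'"
  shows "AE x in lborel. g x = g' x"
proof (cases "R > 0")
  case False
  then have "x \<notin> ball 0 R" for x :: "real^'n"
    using norm_ge_zero[of x] by (auto simp del: norm_ge_zero)
  then have "g x = g' x" for x using assms unfolding weak_pair_def by metis
  then show ?thesis by simp
next
  case True
  note R = True
  let ?\<Omega> = "ball 0 R :: (real^'n) set"
  define h where "h x = g x - g' x" for x
  have p: "weak_pair ?\<Omega> (\<lambda>x. 0) h" using weak_pair_diff[OF assms] by (simp add: h_def[abs_def])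
  note a = p[unfolded weak_pair_def]
  have [measurable]: "h \<in> borel_measurable borel" using a by simp
  \<comment> \<open>\<open>\<zeta> m\<close> is positive exactly where \<open>|x|\<^sup>2 < R\<^sup>2 - 1/(m+1)\<close>.\<close>
  define \<zeta> where "\<zeta> m x = flat_exp 0 ((R\<^sup>2 - 1 / real (Suc m)) - (norm x)\<^sup>2)" for m and x :: "real^'n"
  have \<zeta>s: "smooth (\<zeta> m)" for m
    unfolding \<zeta>_def by (intro smooth_flat_exp_comp smooth_diff smooth_const smooth_norm_square)
  have \<zeta>t: "\<zeta> m \<in> test_functions ?\<Omega>" for m
  proof (rule test_functionsI[OF \<zeta>s])
    let ?K = "{x::real^'n. (norm x)\<^sup>2 \<le> R\<^sup>2 - 1 / real (Suc m)} \<inter> cball 0 \<bar>R\<bar>"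
    show "compact ?K"
      by (intro closed_Int_compact compact_cball closed_Collect_le continuous_intros)
    show "?K \<subseteq> ?\<Omega>"
    proof
      fix x assume x: "x \<in> ?K"
      have "1 / real (Suc m) > 0" by simp
      moreover have "(norm x)\<^sup>2 \<le> R\<^sup>2 - 1 / real (Suc m)" using x by blast
      ultimately have "(norm x)\<^sup>2 < R\<^sup>2" by linarith
      then show "x \<in> ?\<Omega>" using R by (simp add: power_less_imp_less_base)
    qed
    show "\<zeta> m x = 0" if "x \<notin> ?K" for x
    proof (rule ccontr)
      assume "\<zeta> m x \<noteq> 0"
      then have le: "(norm x)\<^sup>2 < R\<^sup>2 - 1 / real (Suc m)" by (auto simp: \<zeta>_def flat_exp_def split: if_splits)
      moreover have "1 / real (Suc m) > 0" by simp
      ultimately have "(norm x)\<^sup>2 \<le> R\<^sup>2" by linarith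
      then have "(norm x)\<^sup>2 \<le> \<bar>R\<bar>\<^sup>2" by simp
      then have "norm x \<le> \<bar>R\<bar>" using abs_ge_zero power2_le_imp_le by blast
      then show False using le that by simp
    qed
  qed
  have "AE x in lborel. h x $ i * \<zeta> m x = 0" for i m
  proof (rule vanishing_conv_imp_AE_zero)
    have [measurable]: "\<zeta> m \<in> borel_measurable borel" by (rule test_function_facts(1)[OF \<zeta>t])
    show "(\<lambda>x. h x $ i * \<zeta> m x) \<in> borel_measurable borel" by measurable
    have "norm (h x $ i * \<zeta> m x) \<le> norm (h x)" for x
    proof -
      have "\<bar>\<zeta> m x\<bar> \<le> 1" by (simp add: \<zeta>_def flat_exp_def)
      then have "\<bar>h x $ i\<bar> * \<bar>\<zeta> m x\<bar> \<le> norm (h x) * 1" by (intro mult_mono component_le_norm_cart) auto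
      then show ?thesis by (simp add: abs_mult)
    qed
    then have "sqnorm (\<lambda>x. h x $ i * \<zeta> m x) \<le> sqnorm h" by (rule sqnorm_mono)
    then show "sqnorm (\<lambda>x. h x $ i * \<zeta> m x) < \<infinity>" using a le_less_trans by blast
    fix \<rho> :: "real^'n \<Rightarrow> real" and x assume \<rho>: "\<rho> \<in> test_functions UNIV"
    have t: "(\<lambda>y. \<zeta> m y * \<rho> (x - y)) \<in> test_functions ?\<Omega>"
      by (rule test_functions_mult[OF \<zeta>t test_functions_smooth[OF test_function_reflect(1)[OF \<rho>]]])
    have "(\<integral>y. h y $ i * (\<zeta> m y * \<rho> (x - y)) \<partial>lborel) = 0"
      using a t by force
    then show "conv (\<lambda>x. h x $ i * \<zeta> m x) \<rho> x = 0" by (simp add: conv_def mult.assoc)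
  qed
  then have "AE x in lborel. \<forall>m i. h x $ i * \<zeta> m x = 0" unfolding AE_all_countable by blast
  then show ?thesis
  proof eventually_elim
    case (elim x)
    show ?case
    proof (cases "x \<in> ?\<Omega>")
      case True
      then have "(norm x)\<^sup>2 < R\<^sup>2" by (intro power_strict_mono) auto
      then obtain m where "inverse (real (Suc m)) < R\<^sup>2 - (norm x)\<^sup>2" using reals_Archimedean[of "R\<^sup>2 - (norm x)\<^sup>2"] by auto
      then have "\<zeta> m x \<noteq> 0" by (simp add: \<zeta>_def flat_exp_def inverse_eq_divide)
      then have "h x = 0" using elim by (auto simp: vec_eq_iff)
      then show ?thesis by (simp add: h_def)
    next
      case False
      then show ?thesis using a by (simp add: h_def)
    qed
  qed
qed

lemma weak_pair_of_weak_grad: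
  fixes u u1 :: "real^'n::finite \<Rightarrow> real"
  assumes \<Omega>: "\<Omega> \<in> sets borel" and u1: "u1 \<in> borel_measurable borel" "\<And>x. x \<notin> \<Omega> \<Longrightarrow> u1 x = 0"
    and eq: "\<And>x. x \<in> \<Omega> \<Longrightarrow> u x = u1 x" and u: "u \<in> L2 \<Omega>" and g: "g \<in> L2 \<Omega>" "is_weak_grad \<Omega> u g"
  obtains g' where "weak_pair \<Omega> u1 g'" "AE x in lebesgue_on \<Omega>. g x = g' x"
proof -
  note [measurable] = u1(1)
  have gm: "g \<in> borel_measurable (lebesgue_on \<Omega>)" using g(1) by (simp add: L2_def)
  obtain g' where g'[measurable]: "g' \<in> borel_measurable borel" and g'0: "\<And>x. x \<notin> \<Omega> \<Longrightarrow> g' x = 0"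
    and ae: "AE x in lebesgue_on \<Omega>. g x = g' x"
    using lebesgue_on_borel_representative[OF \<Omega> gm] by metis
  have g'm: "g' \<in> borel_measurable (lebesgue_on \<Omega>)" by (rule borel_measurable_lebesgue_on[OF g'])
  have "integrable (lebesgue_on \<Omega>) (\<lambda>x. (norm (u1 x))\<^sup>2)"
    using u eq by (subst Bochner_Integration.integrable_cong[OF refl, of _ _ "\<lambda>x. (norm (u x))\<^sup>2"]) (auto simp: L2_def)
  then have su: "sqnorm u1 < \<infinity>"
    using u1(2) by (subst (asm) integral_lebesgue_on_eq(2)[OF \<Omega>]) (auto simp: integrable_square_iff_sqnorm[of u1, simplified])
  have "integrable (lebesgue_on \<Omega>) (\<lambda>x. (norm (g' x))\<^sup>2)"
    using g(1) by (subst integrable_cong_AE[of _ _ "\<lambda>x. (norm (g x))\<^sup>2"])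
      (use ae g'm gm in \<open>auto simp: L2_def\<close>)
  then have sg: "sqnorm g' < \<infinity>"
    using g'0 by (subst (asm) integral_lebesgue_on_eq(2)[OF \<Omega>]) (auto simp: integrable_square_iff_sqnorm[OF g'])
  have "(\<integral>x. u1 x * partial_deriv i \<phi> x \<partial>lborel) = - (\<integral>x. g' x $ i * \<phi> x \<partial>lborel)"
    if \<phi>: "\<phi> \<in> test_functions \<Omega>" for \<phi> i
  proof -
    note [measurable] = test_function_facts(1)[OF \<phi>] test_function_facts(1)[OF test_functions_partial[OF \<phi>]]
    have "(\<integral>x. u1 x * partial_deriv i \<phi> x \<partial>lborel) = (\<integral>x. u1 x * partial_deriv i \<phi> x \<partial>lebesgue_on \<Omega>)"
      using u1 by (intro integral_lebesgue_on_eq(1)[OF \<Omega>, symmetric]) auto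
    also have "\<dots> = (\<integral>x. u x * partial_deriv i \<phi> x \<partial>lebesgue_on \<Omega>)"
      using eq by (intro Bochner_Integration.integral_cong) auto
    also have "\<dots> = - (\<integral>x. g x $ i * \<phi> x \<partial>lebesgue_on \<Omega>)"
      using g(2) \<phi> by (simp add: is_weak_grad_def)
    also have "(\<integral>x. g x $ i * \<phi> x \<partial>lebesgue_on \<Omega>) = (\<integral>x. g' x $ i * \<phi> x \<partial>lebesgue_on \<Omega>)"
    proof (rule integral_cong_AE)
      have [measurable]: "\<phi> \<in> borel_measurable (lebesgue_on \<Omega>)"
        by (rule borel_measurable_lebesgue_on[OF test_function_facts(1)[OF \<phi>]])
      note [measurable] = gm g'm
      show "(\<lambda>x. g x $ i * \<phi> x) \<in> borel_measurable (lebesgue_on \<Omega>)" by measurable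
      show "(\<lambda>x. g' x $ i * \<phi> x) \<in> borel_measurable (lebesgue_on \<Omega>)" by measurable
      show "AE x in lebesgue_on \<Omega>. g x $ i * \<phi> x = g' x $ i * \<phi> x" using ae by eventually_elim simp
    qed
    also have "\<dots> = (\<integral>x. g' x $ i * \<phi> x \<partial>lborel)"
      using g'0 by (intro integral_lebesgue_on_eq(1)[OF \<Omega>]) auto
    finally show ?thesis .
  qed
  then have "weak_pair \<Omega> u1 g'" using su sg u1 g' g'0 by (auto simp: weak_pair_def)
  then show ?thesis using that ae by blast
qed

lemma weak_pair_is_weak_grad:
  fixes u u1 :: "real^'n::finite \<Rightarrow> real"
  assumes \<Omega>: "\<Omega> \<in> sets borel" and p: "weak_pair \<Omega> u1 g" and eq: "\<And>x. x \<in> \<Omega> \<Longrightarrow> u x = u1 x"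
  shows "u \<in> L2 \<Omega>" "g \<in> L2 \<Omega>" "is_weak_grad \<Omega> u g"
proof -
  note a = p[unfolded weak_pair_def]
  have [measurable]: "u1 \<in> borel_measurable borel" "g \<in> borel_measurable borel" using a by auto
  have "u1 \<in> borel_measurable (lebesgue_on \<Omega>)" by (rule borel_measurable_lebesgue_on) simp
  then have um: "u \<in> borel_measurable (lebesgue_on \<Omega>)"
    by (subst measurable_cong[of _ _ u1]) (auto simp: eq)
  have "integrable (lebesgue_on \<Omega>) (\<lambda>x. (norm (u1 x))\<^sup>2)"
    using a by (subst integral_lebesgue_on_eq(2)[OF \<Omega>]) (auto simp: integrable_square_iff_sqnorm[of u1, simplified])
  then have "integrable (lebesgue_on \<Omega>) (\<lambda>x. (norm (u x))\<^sup>2)"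
    by (subst Bochner_Integration.integrable_cong[OF refl, of _ _ "\<lambda>x. (norm (u1 x))\<^sup>2"]) (auto simp: eq)
  with um show "u \<in> L2 \<Omega>" by (simp add: L2_def)
  have "integrable (lebesgue_on \<Omega>) (\<lambda>x. (norm (g x))\<^sup>2)"
    using a by (subst integral_lebesgue_on_eq(2)[OF \<Omega>]) (auto simp: integrable_square_iff_sqnorm)
  then show "g \<in> L2 \<Omega>" using borel_measurable_lebesgue_on[of g] by (simp add: L2_def)
  show "is_weak_grad \<Omega> u g"
    unfolding is_weak_grad_def
  proof (intro ballI allI)
    fix \<phi> :: "real^'n \<Rightarrow> real" and i assume \<phi>: "\<phi> \<in> test_functions \<Omega>"
    note [measurable] = test_function_facts(1)[OF \<phi>] test_function_facts(1)[OF test_functions_partial[OF \<phi>]]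
    have "(\<integral>x. u x * partial_deriv i \<phi> x \<partial>lebesgue_on \<Omega>) = (\<integral>x. u1 x * partial_deriv i \<phi> x \<partial>lebesgue_on \<Omega>)"
      using eq by (intro Bochner_Integration.integral_cong) auto
    also have "\<dots> = (\<integral>x. u1 x * partial_deriv i \<phi> x \<partial>lborel)"
      using a by (intro integral_lebesgue_on_eq(1)[OF \<Omega>]) auto
    also have "\<dots> = - (\<integral>x. g x $ i * \<phi> x \<partial>lborel)" using a \<phi> by blast
    also have "(\<integral>x. g x $ i * \<phi> x \<partial>lborel) = (\<integral>x. g x $ i * \<phi> x \<partial>lebesgue_on \<Omega>)"
      using a by (intro integral_lebesgue_on_eq(1)[OF \<Omega>, symmetric]) auto
    finally show "(\<integral>x. u x * partial_deriv i \<phi> x \<partial>lebesgue_on \<Omega>) = - (\<integral>x. g x $ i * \<phi> x \<partial>lebesgue_on \<Omega>)" .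
  qed
qed

text \<open>The chosen weak gradient is one among those that have the defining property, and all of these agree almost everywhere.\<close>

lemma weak_pair_W12:
  assumes p: "weak_pair (ball 0 R) u1 g" and eq: "\<And>x. x \<in> ball 0 R \<Longrightarrow> u x = u1 x"
  shows "u \<in> W12 (ball 0 R)" "AE x in lebesgue_on (ball 0 R). weak_grad (ball 0 R) u x = g x"
proof -
  let ?\<Omega> = "ball 0 R :: (real^'a) set"
  have \<Omega>: "?\<Omega> \<in> sets borel" by simp
  note w = weak_pair_is_weak_grad[OF \<Omega> p eq]
  then show "u \<in> W12 ?\<Omega>" by (auto simp: W12_def)
  have wg: "weak_grad ?\<Omega> u \<in> L2 ?\<Omega> \<and> is_weak_grad ?\<Omega> u (weak_grad ?\<Omega> u)"
    unfolding weak_grad_def by (rule someI[of _ g]) (use w in blast)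
  have u1: "u1 \<in> borel_measurable borel" "\<And>x. x \<notin> ?\<Omega> \<Longrightarrow> u1 x = 0"
    using p by (auto simp: weak_pair_def)
  obtain g' where g': "weak_pair ?\<Omega> u1 g'" "AE x in lebesgue_on ?\<Omega>. weak_grad ?\<Omega> u x = g' x"
    by (rule weak_pair_of_weak_grad[OF \<Omega> u1 eq w(1) conjunct1[OF wg] conjunct2[OF wg]])
  have "AE x in lborel. x \<in> ?\<Omega> \<longrightarrow> g' x = g x"
    using weak_pair_unique[OF g'(1) p] by eventually_elim simp
  then have "AE x in lebesgue_on ?\<Omega>. g' x = g x"
    by (simp only: AE_lebesgue_on_iff[OF \<Omega>])
  with g'(2) show "AE x in lebesgue_on ?\<Omega>. weak_grad ?\<Omega> u x = g x" by eventually_elim simp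
qed

lemma W12_norm_le:
  assumes p: "weak_pair (ball 0 R) u1 g" and eq: "\<And>x. x \<in> ball 0 R \<Longrightarrow> u x = u1 x"
    and "sqnorm u1 \<le> ennreal a" "sqnorm g \<le> ennreal b" "0 \<le> a" "0 \<le> b"
  shows "W12_norm (ball 0 R) u \<le> sqrt (a + b)"
proof -
  let ?\<Omega> = "ball 0 R :: (real^'a) set"
  have \<Omega>: "?\<Omega> \<in> sets borel" by simp
  note a = p[unfolded weak_pair_def]
  have [measurable]: "u1 \<in> borel_measurable borel" "g \<in> borel_measurable borel" using a by auto
  have "(\<integral>x. (u x)\<^sup>2 \<partial>lebesgue_on ?\<Omega>) = (\<integral>x. (norm (u1 x))\<^sup>2 \<partial>lebesgue_on ?\<Omega>)"
    using eq by (intro Bochner_Integration.integral_cong) auto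
  also have "\<dots> = (\<integral>x. (norm (u1 x))\<^sup>2 \<partial>lborel)"
    using a by (intro integral_lebesgue_on_eq(1)[OF \<Omega>]) auto
  also have "\<dots> \<le> a"
    using assms(3,5) sqnorm_eq_integral[of u1] a by simp
  finally have 1: "(\<integral>x. (u x)\<^sup>2 \<partial>lebesgue_on ?\<Omega>) \<le> a" .
  have "(\<integral>x. (norm (weak_grad ?\<Omega> u x))\<^sup>2 \<partial>lebesgue_on ?\<Omega>) = (\<integral>x. (norm (g x))\<^sup>2 \<partial>lebesgue_on ?\<Omega>)"
  proof (rule integral_cong_AE)
    have "weak_grad ?\<Omega> u \<in> L2 ?\<Omega> \<and> is_weak_grad ?\<Omega> u (weak_grad ?\<Omega> u)"
      unfolding weak_grad_def by (rule someI[of _ g]) (use weak_pair_is_weak_grad[OF \<Omega> p eq] in blast)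
    then have [measurable]: "weak_grad ?\<Omega> u \<in> borel_measurable (lebesgue_on ?\<Omega>)" by (simp add: L2_def)
    show "(\<lambda>x. (norm (weak_grad ?\<Omega> u x))\<^sup>2) \<in> borel_measurable (lebesgue_on ?\<Omega>)" by measurable
    have [measurable]: "g \<in> borel_measurable (lebesgue_on ?\<Omega>)" by (rule borel_measurable_lebesgue_on) simp
    show "(\<lambda>x. (norm (g x))\<^sup>2) \<in> borel_measurable (lebesgue_on ?\<Omega>)" by measurable
    have "AE x in lebesgue_on ?\<Omega>. weak_grad ?\<Omega> u x = g x" by (rule weak_pair_W12(2)[OF p eq])
    then show "AE x in lebesgue_on ?\<Omega>. (norm (weak_grad ?\<Omega> u x))\<^sup>2 = (norm (g x))\<^sup>2"
      by eventually_elim simp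
  qed
  also have "\<dots> = (\<integral>x. (norm (g x))\<^sup>2 \<partial>lborel)"
    using a by (intro integral_lebesgue_on_eq(1)[OF \<Omega>]) auto
  also have "\<dots> \<le> b"
    using assms(4,6) sqnorm_eq_integral[of g] a by simp
  finally have 2: "(\<integral>x. (norm (weak_grad ?\<Omega> u x))\<^sup>2 \<partial>lebesgue_on ?\<Omega>) \<le> b" .
  show ?thesis unfolding W12_norm_def using 1 2 by simp
qed

text \<open>Stated for \<open>- w\<close>, the difference between the competitor \<open>u - w\<close> and \<open>u\<close>.\<close>

lemma approximable_W12_0:
  assumes w: "approximable (ball 0 R) w G" and G: "\<And>x. x \<notin> ball 0 R \<Longrightarrow> G x = 0"
  shows "(\<lambda>x. - w x) \<in> W12_0 (ball 0 R)"
proof -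
  let ?\<Omega> = "ball 0 R :: (real^'a) set"
  have wp: "weak_pair ?\<Omega> w G" by (rule weak_pair_approximable[OF w bounded_ball G])
  have z: "weak_pair ?\<Omega> (\<lambda>x. 0) (\<lambda>x. 0)" using weak_pair_diff[OF wp wp] by simp
  have mp: "weak_pair ?\<Omega> (\<lambda>x. - w x) (\<lambda>x. - G x)" using weak_pair_diff[OF z wp] by simp
  obtain \<phi> where \<phi>: "\<And>j. \<phi> j \<in> test_functions ?\<Omega>" "\<And>j x. \<bar>\<phi> j x - w x\<bar> \<le> 1 / Suc j"
    "\<And>j. sqnorm (\<lambda>x. grad (\<phi> j) x - G x) \<le> ennreal (1 / Suc j)" "\<And>x. (\<lambda>j. \<phi> j x) \<longlonglongrightarrow> w x"
    by (rule approximable_sequence[OF w zero_less_one], rule that, assumption+)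
  define \<psi> where "\<psi> j x = (-1) * \<phi> j x" for j x
  have \<psi>: "\<psi> j \<in> test_functions ?\<Omega>" for j
    using test_functions_mult[OF \<phi>(1) smooth_const[of "-1"], of j] by (simp add: \<psi>_def[abs_def] mult.commute)
  obtain V where V: "emeasure lborel ?\<Omega> = ennreal V" "V \<ge> 0"
    using emeasure_lborel_ball_finite[of "0::real^'a" R] by (cases "emeasure lborel ?\<Omega>") auto
  have le: "W12_norm ?\<Omega> (\<lambda>x. - w x - \<psi> j x) \<le> sqrt (V / real (Suc j) + 1 / real (Suc j))" for j
  proof (rule W12_norm_le)
    have "weak_pair ?\<Omega> (\<lambda>x. \<phi> j x - w x) (\<lambda>x. grad (\<phi> j) x - G x)"
      by (rule weak_pair_diff[OF weak_pair_test[OF \<phi>(1) bounded_ball] wp])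
    then show "weak_pair ?\<Omega> (\<lambda>x. \<phi> j x - w x) (\<lambda>x. grad (\<phi> j) x - G x)" .
    show "- w x - \<psi> j x = \<phi> j x - w x" for x by (simp add: \<psi>_def)
    show "sqnorm (\<lambda>x. grad (\<phi> j) x - G x) \<le> ennreal (1 / Suc j)" by (rule \<phi>(3))
    have "sqnorm (\<lambda>x. \<phi> j x - w x) \<le> (\<integral>\<^sup>+x. ennreal (1 / Suc j) * indicator ?\<Omega> x \<partial>lborel)"
      unfolding sqnorm_def
    proof (rule nn_integral_mono)
      fix x
      show "ennreal ((norm (\<phi> j x - w x))\<^sup>2) \<le> ennreal (1 / Suc j) * indicator ?\<Omega> x"
      proof (cases "x \<in> ?\<Omega>")
        case True
        have "\<bar>\<phi> j x - w x\<bar>\<^sup>2 \<le> (1 / Suc j)\<^sup>2" by (intro power_mono \<phi>) auto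
        also have "\<dots> \<le> 1 / Suc j" by (simp only: power2_eq_square) (rule mult_left_le, simp_all)
        finally show ?thesis using True by (simp add: ennreal_leI)
      next
        case False
        then have "\<phi> j x = 0" using approximable_zero_outside[OF approximable_test[OF \<phi>(1)]] by blast
        then show ?thesis using False approximable_zero_outside[OF w] by simp
      qed
    qed
    also have "\<dots> = ennreal (V / Suc j)"
      using V by (simp add: nn_integral_cmult_indicator ennreal_mult''[symmetric])
    finally show "sqnorm (\<lambda>x. \<phi> j x - w x) \<le> ennreal (V / Suc j)" .
  qed (use V in auto)
  have "(\<lambda>j. sqrt (V / real (Suc j) + 1 / real (Suc j))) \<longlonglongrightarrow> sqrt (0 + 0)"
    by (intro tendsto_intros LIMSEQ_Suc[OF lim_const_over_n])
  then have lim: "(\<lambda>j. sqrt (V / real (Suc j) + 1 / real (Suc j))) \<longlonglongrightarrow> 0" by simp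
  have "(\<lambda>j. W12_norm ?\<Omega> (\<lambda>x. - w x - \<psi> j x)) \<longlonglongrightarrow> 0"
  proof (rule tendsto_sandwich[OF _ _ tendsto_const lim])
    show "\<forall>\<^sub>F j in sequentially. 0 \<le> W12_norm ?\<Omega> (\<lambda>x. - w x - \<psi> j x)"
      by (simp add: W12_norm_def)
  qed (use le in simp)
  then show ?thesis
    unfolding W12_0_def using weak_pair_W12(1)[OF mp refl] \<psi> by (intro CollectI conjI exI[of _ \<psi>]) auto
qed

text \<open>The interface to the definition of local minimizers. All integrals are rewritten as integrals of Borel functions
over the whole space, with a weak gradient \<open>g\<close> that is fixed once and for all, and the competitors are
restricted to \<open>u - w\<close> with \<open>w\<close> approximable.\<close>

lemma minimality:
  fixes u :: "real^'n::finite \<Rightarrow> real" and Q :: "real^'n \<Rightarrow> real" and R :: real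
  defines "\<Omega> \<equiv> ball 0 R"
  defines "u1 \<equiv> (\<lambda>x. if x \<in> \<Omega> then u x else 0)"
  assumes min: "local_minimizer \<epsilon> Q \<Omega> u" and uc: "continuous_on \<Omega> u"
  obtains g where "weak_pair \<Omega> u1 g"
    "\<And>w G. approximable \<Omega> w G \<Longrightarrow> (\<And>x. x \<notin> \<Omega> \<Longrightarrow> G x = 0) \<Longrightarrow>
       sqnorm G + (\<integral>\<^sup>+x. ennreal \<bar>indicator {z. u1 z > 0} x - indicator {z. u1 z - w z > 0} x\<bar> \<partial>lborel) < ennreal \<epsilon> \<Longrightarrow>
       (\<integral>\<^sup>+x. ennreal ((norm (g x))\<^sup>2 + (Q x)\<^sup>2 * indicator {z. u1 z > 0} x) \<partial>lborel) \<le>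
       (\<integral>\<^sup>+x. ennreal ((norm (g x - G x))\<^sup>2 + (Q x)\<^sup>2 * indicator {z. u1 z - w z > 0} x) \<partial>lborel)"
proof -
  have \<Omega>: "\<Omega> \<in> sets borel" by (simp add: \<Omega>_def)
  have eq: "u x = u1 x" if "x \<in> \<Omega>" for x using that by (simp add: u1_def)
  have u0: "u1 x = 0" if "x \<notin> \<Omega>" for x using that by (simp add: u1_def)
  have um[measurable]: "u1 \<in> borel_measurable borel"
    unfolding u1_def using \<Omega> uc by (intro borel_measurable_continuous_on_if) auto
  have "u \<in> W12 \<Omega>" using min by (auto simp: local_minimizer_def K_class_def)
  then obtain g0 where g0: "u \<in> L2 \<Omega>" "g0 \<in> L2 \<Omega>" "is_weak_grad \<Omega> u g0" by (auto simp: W12_def)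
  obtain g where g: "weak_pair \<Omega> u1 g"
    by (rule weak_pair_of_weak_grad[OF \<Omega> um u0 eq g0])
  show ?thesis
  proof (rule that[OF g])
    fix w G
    assume w: "approximable \<Omega> w G" and G: "\<And>x. x \<notin> \<Omega> \<Longrightarrow> G x = 0"
      and small: "sqnorm G + (\<integral>\<^sup>+x. ennreal \<bar>indicator {z. u1 z > 0} x - indicator {z. u1 z - w z > 0} x\<bar> \<partial>lborel) < ennreal \<epsilon>"
    have bd: "bounded \<Omega>" by (simp add: \<Omega>_def)
    note wp = weak_pair_approximable[OF w bd G]
    note vp = weak_pair_diff[OF g wp]
    have w0: "w x = 0" if "x \<notin> \<Omega>" for x by (rule approximable_zero_outside[OF w that])
    define v where "v x = u x - w x" for x
    have veq: "v x = u1 x - w x" if "x \<in> \<Omega>" for x using eq[OF that] by (simp add: v_def)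
    have "v \<in> W12 \<Omega>" using weak_pair_W12(1)[OF vp[unfolded \<Omega>_def], of v] veq by (simp add: \<Omega>_def)
    moreover have "(\<lambda>x. v x - u x) \<in> W12_0 \<Omega>"
      using approximable_W12_0[OF w[unfolded \<Omega>_def]] G by (simp add: \<Omega>_def v_def)
    ultimately have vK: "v \<in> K_class u \<Omega>" by (simp add: K_class_def)
    have "(\<integral>\<^sup>+x. ennreal ((norm (weak_grad \<Omega> (\<lambda>z. u z - v z) x))\<^sup>2) \<partial>lebesgue_on \<Omega>)
        = (\<integral>\<^sup>+x. ennreal ((norm (G x))\<^sup>2) \<partial>lebesgue_on \<Omega>)"
    proof (rule nn_integral_cong_AE)
      have "AE x in lebesgue_on \<Omega>. weak_grad \<Omega> (\<lambda>z. u z - v z) x = G x"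
        unfolding \<Omega>_def v_def using weak_pair_W12(2)[OF wp[unfolded \<Omega>_def], of w] by simp
      then show "AE x in lebesgue_on \<Omega>. ennreal ((norm (weak_grad \<Omega> (\<lambda>z. u z - v z) x))\<^sup>2) = ennreal ((norm (G x))\<^sup>2)"
        by eventually_elim simp
    qed
    also have "\<dots> = sqnorm G" unfolding sqnorm_def using G by (intro nn_integral_lebesgue_on_eq[OF \<Omega>]) auto
    finally have 1: "(\<integral>\<^sup>+x. ennreal ((norm (weak_grad \<Omega> (\<lambda>z. u z - v z) x))\<^sup>2) \<partial>lebesgue_on \<Omega>) = sqnorm G" .
    have "(\<integral>\<^sup>+x. ennreal \<bar>indicator {z. u z > 0} x - indicator {z. v z > 0} x\<bar> \<partial>lebesgue_on \<Omega>)
       = (\<integral>\<^sup>+x. ennreal \<bar>indicator {z. u1 z > 0} x - indicator {z. u1 z - w z > 0} x\<bar> \<partial>lebesgue_on \<Omega>)"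
      by (intro nn_integral_cong) (simp add: indicator_def eq veq)
    also have "\<dots> = (\<integral>\<^sup>+x. ennreal \<bar>indicator {z. u1 z > 0} x - indicator {z. u1 z - w z > 0} x\<bar> \<partial>lborel)"
      using u0 w0 by (intro nn_integral_lebesgue_on_eq[OF \<Omega>]) (auto simp: indicator_def)
    finally have 2: "(\<integral>\<^sup>+x. ennreal \<bar>indicator {z. u z > 0} x - indicator {z. v z > 0} x\<bar> \<partial>lebesgue_on \<Omega>) = \<dots>" .
    have J: "J_functional Q u \<Omega> \<le> J_functional Q v \<Omega>"
      using min vK small 1 2 by (simp add: local_minimizer_def)
    have "J_functional Q u \<Omega> = (\<integral>\<^sup>+x. ennreal ((norm (g x))\<^sup>2 + (Q x)\<^sup>2 * indicator {z. u1 z > 0} x) \<partial>lebesgue_on \<Omega>)"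
      unfolding J_functional_def
    proof (rule nn_integral_cong_AE)
      have "AE x in lebesgue_on \<Omega>. weak_grad \<Omega> u x = g x"
        unfolding \<Omega>_def by (intro weak_pair_W12(2)[OF g[unfolded \<Omega>_def]] eq) (simp add: \<Omega>_def)
      moreover have "AE x in lebesgue_on \<Omega>. x \<in> \<Omega>" by (simp add: AE_lebesgue_on_iff[OF \<Omega>])
      ultimately show "AE x in lebesgue_on \<Omega>. ennreal ((norm (weak_grad \<Omega> u x))\<^sup>2 + (Q x)\<^sup>2 * indicator {z. u z > 0} x)
         = ennreal ((norm (g x))\<^sup>2 + (Q x)\<^sup>2 * indicator {z. u1 z > 0} x)"
        by eventually_elim (simp add: eq indicator_def)
    qed
    also have "\<dots> = (\<integral>\<^sup>+x. ennreal ((norm (g x))\<^sup>2 + (Q x)\<^sup>2 * indicator {z. u1 z > 0} x) \<partial>lborel)"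
      using u0 g by (intro nn_integral_lebesgue_on_eq[OF \<Omega>]) (auto simp: weak_pair_def)
    finally have Ju: "J_functional Q u \<Omega> = \<dots>" .
    have "J_functional Q v \<Omega> = (\<integral>\<^sup>+x. ennreal ((norm (g x - G x))\<^sup>2 + (Q x)\<^sup>2 * indicator {z. u1 z - w z > 0} x) \<partial>lebesgue_on \<Omega>)"
      unfolding J_functional_def
    proof (rule nn_integral_cong_AE)
      have "AE x in lebesgue_on \<Omega>. weak_grad \<Omega> v x = g x - G x"
        unfolding \<Omega>_def
      proof (rule weak_pair_W12(2))
        show "weak_pair (ball 0 R) (\<lambda>x. u1 x - w x) (\<lambda>x. g x - G x)" using vp unfolding \<Omega>_def .
        show "v x = u1 x - w x" if "x \<in> ball 0 R" for x using that veq[of x] unfolding \<Omega>_def by blast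
      qed
      moreover have "AE x in lebesgue_on \<Omega>. x \<in> \<Omega>" by (simp add: AE_lebesgue_on_iff[OF \<Omega>])
      ultimately show "AE x in lebesgue_on \<Omega>. ennreal ((norm (weak_grad \<Omega> v x))\<^sup>2 + (Q x)\<^sup>2 * indicator {z. v z > 0} x)
         = ennreal ((norm (g x - G x))\<^sup>2 + (Q x)\<^sup>2 * indicator {z. u1 z - w z > 0} x)"
        by eventually_elim (simp add: veq indicator_def)
    qed
    also have "\<dots> = (\<integral>\<^sup>+x. ennreal ((norm (g x - G x))\<^sup>2 + (Q x)\<^sup>2 * indicator {z. u1 z - w z > 0} x) \<partial>lborel)"
      using u0 w0 vp by (intro nn_integral_lebesgue_on_eq[OF \<Omega>]) (auto simp: weak_pair_def)
    finally have "J_functional Q v \<Omega> = \<dots>" .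
    with J Ju show "(\<integral>\<^sup>+x. ennreal ((norm (g x))\<^sup>2 + (Q x)\<^sup>2 * indicator {z. u1 z > 0} x) \<partial>lborel) \<le>
       (\<integral>\<^sup>+x. ennreal ((norm (g x - G x))\<^sup>2 + (Q x)\<^sup>2 * indicator {z. u1 z - w z > 0} x) \<partial>lborel)" by simp
  qed
qed

section \<open>Cutoffs and the competitor\<close>

text \<open>By translation and scaling of one fixed cut-off, the mollified indicator of a ball of radius \<open>3/4\<close>; this makes \<open>L\<close>
independent of the ball.\<close>

lemma cutoff_exists:
  obtains L where "L \<ge> 1"
    "\<And>(q::real^'n::finite) s. s > 0 \<Longrightarrow> \<exists>\<eta>\<in>test_functions (ball q s).
       (\<forall>x. 0 \<le> \<eta> x \<and> \<eta> x \<le> 1) \<and> (\<forall>x\<in>ball q (s/2). \<eta> x = 1) \<and> (\<forall>x. norm (grad \<eta> x) \<le> L / s)"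
proof -
  obtain \<rho> :: "real^'n \<Rightarrow> real" where \<rho>: "mollifier (1/8) \<rho>"
    using mollifier_exists[of "1/8"] by auto
  let ?f = "indicator (ball 0 (3/4)) :: real^'n \<Rightarrow> real"
  define \<eta>0 where "\<eta>0 = conv ?f \<rho>"
  have fi: "integrable lborel ?f" using emeasure_lborel_ball_finite[of "0::real^'n" "3/4"] by simp
  have int: "integrable lborel (\<lambda>y. ?f y * \<rho> (x - y))" for x
    by (rule integrable_conv[OF fi mollifier_test[OF \<rho>]])
  have sm: "smooth \<eta>0" unfolding \<eta>0_def by (rule smooth_conv[OF fi mollifier_test[OF \<rho>]])
  have one: "\<eta>0 x = 1" if "norm x < 1/2" for x
  proof -
    have "\<bar>conv ?f \<rho> x - 1\<bar> \<le> 0"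
    proof (rule conv_close[OF \<rho> int])
      fix y assume "norm (x - y) < 1/8"
      then have "norm y < 3/4" using that norm_triangle_ineq3[of y x] by (simp add: norm_minus_commute)
      then show "\<bar>?f y - 1\<bar> \<le> 0" by simp
    qed
    then show ?thesis by (simp add: \<eta>0_def)
  qed
  have zero: "\<eta>0 x = 0" if "x \<notin> cball 0 (7/8)" for x
    unfolding \<eta>0_def
  proof (rule conv_zero[OF \<rho>])
    fix y assume "norm (x - y) < 1/8"
    then have "norm y > 3/4" using that norm_triangle_ineq2[of x y] by simp
    then show "?f y = 0" by simp
  qed
  have range: "0 \<le> \<eta>0 x" "\<eta>0 x \<le> 1" for x
  proof -
    have "\<bar>conv ?f \<rho> x - 1/2\<bar> \<le> 1/2"
      by (rule conv_close[OF \<rho> int]) (simp add: indicator_def)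
    then show "0 \<le> \<eta>0 x" "\<eta>0 x \<le> 1" unfolding \<eta>0_def by linarith+
  qed
  have "grad \<eta>0 x = 0" if "x \<notin> cball 0 (7/8)" for x
    using partial_deriv_zero_outside[OF compact_cball that zero] by (simp add: vec_eq_iff)
  then obtain C where C: "0 \<le> C" "\<And>x. norm (grad \<eta>0 x) \<le> C"
    using continuous_compact_support_bounded[OF grad_continuous[OF sm] compact_cball] by metis
  show ?thesis
  proof (rule that[of "C + 1"])
    fix q :: "real^'n" and s :: real assume s: "s > 0"
    define \<eta> where "\<eta> x = \<eta>0 ((1/s) *\<^sub>R x + (- (1/s)) *\<^sub>R q)" for x
    have arg: "(1/s) *\<^sub>R x + (- (1/s)) *\<^sub>R q = (1/s) *\<^sub>R (x - q)" for x by (simp add: algebra_simps)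
    have nrm: "norm ((1/s) *\<^sub>R (x - q)) = dist q x / s" for x
      using s by (simp add: dist_norm norm_minus_commute)
    have \<eta>s: "smooth \<eta>" unfolding \<eta>_def[abs_def] by (rule smooth_affine[OF sm])
    have "grad \<eta> x = (1/s) *\<^sub>R grad \<eta>0 ((1/s) *\<^sub>R x + (- (1/s)) *\<^sub>R q)" for x
    proof -
      have "partial_deriv i \<eta> x = (1/s) * partial_deriv i \<eta>0 ((1/s) *\<^sub>R x + (- (1/s)) *\<^sub>R q)" for i
        unfolding \<eta>_def[abs_def] by (rule fun_cong[OF partial_deriv_affine[OF smooth_differentiable[OF sm]]])
      then show ?thesis by (simp only: vec_eq_iff grad_nth vector_scaleR_component real_scaleR_def) blast
    qed
    then have "norm (grad \<eta> x) \<le> (C + 1) / s" for x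
      using C(2)[of "(1/s) *\<^sub>R x + (- (1/s)) *\<^sub>R q"] s by (simp add: divide_right_mono)
    moreover have "\<eta> \<in> test_functions (ball q s)"
    proof (rule test_functionsI[OF \<eta>s, of "cball q (s * (7/8))"])
      show "\<eta> x = 0" if "x \<notin> cball q (s * (7/8))" for x
        unfolding \<eta>_def arg using that s by (intro zero, unfold mem_cball_0 nrm) (simp add: field_simps)
    qed (use s in auto)
    moreover have "\<eta> x = 1" if "x \<in> ball q (s/2)" for x
      unfolding \<eta>_def arg using that s by (intro one, unfold nrm) (simp add: field_simps)
    ultimately show "\<exists>\<eta>\<in>test_functions (ball q s).
       (\<forall>x. 0 \<le> \<eta> x \<and> \<eta> x \<le> 1) \<and> (\<forall>x\<in>ball q (s/2). \<eta> x = 1) \<and> (\<forall>x. norm (grad \<eta> x) \<le> (C + 1) / s)"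
      using range by (intro bexI[of _ \<eta>]) (auto simp: \<eta>_def)
  qed (use C in simp)
qed

text \<open>The product rule holds since \<open>\<eta> \<psi>\<close> is again a test function on \<open>\<Omega>\<close>. The product \<open>\<eta> u\<close> extends continuously
by zero because \<open>\<eta>\<close> has compact support in \<open>\<Omega>\<close>.\<close>

lemma approximable_cutoff:
  fixes u :: "real^'n::finite \<Rightarrow> real"
  assumes p: "weak_pair \<Omega> u g" and "open \<Omega>" and uc: "continuous_on \<Omega> u"
    and \<eta>: "\<eta> \<in> test_functions \<Omega>"
  shows "approximable \<Omega> (\<lambda>x. \<eta> x * u x) (\<lambda>x. \<eta> x *\<^sub>R g x + u x *\<^sub>R grad \<eta> x)"
proof -
  note a = p[unfolded weak_pair_def]
  note [measurable] = test_function_facts(1)[OF \<eta>] grad_measurable[OF \<eta>]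
  have [measurable]: "u \<in> borel_measurable borel" "g \<in> borel_measurable borel" using a by auto
  obtain K where K: "compact K" "K \<subseteq> \<Omega>" "\<And>x. x \<notin> K \<Longrightarrow> \<eta> x = 0"
    using test_functionsE[OF \<eta>] by metis
  note \<eta>s = test_functions_smooth[OF \<eta>]
  show ?thesis
  proof (rule approximable_of_weak_grad[OF \<open>open \<Omega>\<close> K(1,2)])
    have "continuous_on (\<Omega> \<union> - K) (\<lambda>x. \<eta> x * u x)"
    proof (rule continuous_on_open_Un[OF \<open>open \<Omega>\<close>])
      show "open (- K)" using compact_imp_closed[OF K(1)] by (rule open_Compl)
      show "continuous_on \<Omega> (\<lambda>x. \<eta> x * u x)"
        using continuous_on_subset[OF smooth_continuous[OF \<eta>s]] uc by (intro continuous_intros) auto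
      show "continuous_on (- K) (\<lambda>x. \<eta> x * u x)"
        by (subst continuous_on_cong[OF refl, of _ _ "\<lambda>x. 0"]) (use K in auto)
    qed
    moreover have "\<Omega> \<union> - K = UNIV" using K(2) by auto
    ultimately show "continuous_on UNIV (\<lambda>x. \<eta> x * u x)" by simp
    show "\<eta> x * u x = 0" if "x \<notin> K" for x using K(3)[OF that] by simp
    show "(\<lambda>x. \<eta> x *\<^sub>R g x + u x *\<^sub>R grad \<eta> x) \<in> borel_measurable borel" by measurable
    show "sqnorm (\<lambda>x. \<eta> x *\<^sub>R g x + u x *\<^sub>R grad \<eta> x) < \<infinity>"
    proof -
      obtain C where C: "\<And>x. \<bar>\<eta> x\<bar> \<le> C" using test_function_facts(3)[OF \<eta>] by blast
      have "grad \<eta> x = 0" if "x \<notin> K" for x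
        using partial_deriv_zero_outside[OF K(1) that K(3)] by (simp add: vec_eq_iff)
      then obtain D where D: "\<And>x. norm (grad \<eta> x) \<le> D"
        using continuous_compact_support_bounded[OF grad_continuous[OF \<eta>s] K(1)] by blast
      have sc: "sqnorm (\<lambda>x. c *\<^sub>R f x) < \<infinity>" if "sqnorm f < \<infinity>" "f \<in> borel_measurable borel"
        for c and f :: "real^'n \<Rightarrow> 'z::euclidean_space"
      proof -
        have "integrable lborel (\<lambda>x. c\<^sup>2 * (norm (f x))\<^sup>2)"
          using that by (simp add: integrable_square_iff_sqnorm)
        then have "integrable lborel (\<lambda>x. (norm (c *\<^sub>R f x))\<^sup>2)" by (simp add: power_mult_distrib)
        then show ?thesis using that(2) by (subst (asm) integrable_square_iff_sqnorm) auto
      qed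
      have "sqnorm (\<lambda>x. \<eta> x *\<^sub>R g x) \<le> sqnorm (\<lambda>x. C *\<^sub>R g x)"
      proof (rule sqnorm_mono)
        fix x
        have "\<bar>\<eta> x\<bar> * norm (g x) \<le> \<bar>C\<bar> * norm (g x)" using C[of x] by (intro mult_right_mono) auto
        then show "norm (\<eta> x *\<^sub>R g x) \<le> norm (C *\<^sub>R g x)" by simp
      qed
      also have "\<dots> < \<infinity>" using a by (intro sc) auto
      finally have 1: "sqnorm (\<lambda>x. \<eta> x *\<^sub>R g x) < \<infinity>" .
      have "sqnorm (\<lambda>x. u x *\<^sub>R grad \<eta> x) \<le> sqnorm (\<lambda>x. D *\<^sub>R u x)"
      proof (rule sqnorm_mono)
        fix x
        have "\<bar>u x\<bar> * norm (grad \<eta> x) \<le> \<bar>u x\<bar> * \<bar>D\<bar>" using D[of x] by (intro mult_left_mono) auto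
        then show "norm (u x *\<^sub>R grad \<eta> x) \<le> norm (D *\<^sub>R u x)" by (simp add: abs_mult mult.commute)
      qed
      also have "\<dots> < \<infinity>" using a by (intro sc) auto
      finally have 2: "sqnorm (\<lambda>x. u x *\<^sub>R grad \<eta> x) < \<infinity>" .
      have "sqnorm (\<lambda>x. \<eta> x *\<^sub>R g x + u x *\<^sub>R grad \<eta> x) \<le> 2 * sqnorm (\<lambda>x. \<eta> x *\<^sub>R g x) + 2 * sqnorm (\<lambda>x. u x *\<^sub>R grad \<eta> x)"
        by (rule sqnorm_add) measurable
      also have "\<dots> < \<infinity>" using 1 2 by (simp add: ennreal_mult_less_top)
      finally show ?thesis .
    qed
    fix \<psi> :: "real^'n \<Rightarrow> real" and i assume \<psi>: "\<psi> \<in> test_functions UNIV"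
    note \<psi>s = test_functions_smooth[OF \<psi>]
    have t: "(\<lambda>x. \<eta> x * \<psi> x) \<in> test_functions \<Omega>" by (rule test_functions_mult[OF \<eta> \<psi>s])
    have eq: "partial_deriv i (\<lambda>x. \<eta> x * \<psi> x) = (\<lambda>x. \<eta> x * partial_deriv i \<psi> x + partial_deriv i \<eta> x * \<psi> x)"
      by (intro partial_deriv_mult smooth_differentiable \<eta>s \<psi>s)
    have i1: "integrable lborel (\<lambda>x. u x * (\<eta> x * partial_deriv i \<psi> x))"
      using a by (intro integrable_L2_test[OF _ _ test_functions_mult[OF \<eta> smooth_partial[OF \<psi>s]]]) auto
    have i2: "integrable lborel (\<lambda>x. u x * (partial_deriv i \<eta> x * \<psi> x))"
      using a by (intro integrable_L2_test[OF _ _ test_functions_mult[OF test_functions_partial[OF \<eta>] \<psi>s]]) auto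
    have i3: "integrable lborel (\<lambda>x. g x $ i * (\<eta> x * \<psi> x))"
      using a by (intro integrable_L2_test[OF _ sqnorm_component_finite t]) auto
    have "(\<integral>x. u x * partial_deriv i (\<lambda>x. \<eta> x * \<psi> x) x \<partial>lborel) = - (\<integral>x. g x $ i * (\<eta> x * \<psi> x) \<partial>lborel)"
      using a t by blast
    moreover have "(\<integral>x. u x * partial_deriv i (\<lambda>x. \<eta> x * \<psi> x) x \<partial>lborel)
        = (\<integral>x. u x * (\<eta> x * partial_deriv i \<psi> x) \<partial>lborel) + (\<integral>x. u x * (partial_deriv i \<eta> x * \<psi> x) \<partial>lborel)"
      unfolding eq using i1 i2 by (simp add: distrib_left)
    moreover have "(\<integral>x. (\<eta> x *\<^sub>R g x + u x *\<^sub>R grad \<eta> x) $ i * \<psi> x \<partial>lborel)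
        = (\<integral>x. g x $ i * (\<eta> x * \<psi> x) \<partial>lborel) + (\<integral>x. u x * (partial_deriv i \<eta> x * \<psi> x) \<partial>lborel)"
      using i2 i3 by (subst Bochner_Integration.integral_add[symmetric]) (auto simp: algebra_simps)
    moreover have "(\<integral>x. \<eta> x * u x * partial_deriv i \<psi> x \<partial>lborel) = (\<integral>x. u x * (\<eta> x * partial_deriv i \<psi> x) \<partial>lborel)"
      by (simp add: algebra_simps)
    ultimately show "(\<integral>x. \<eta> x * u x * partial_deriv i \<psi> x \<partial>lborel) = - (\<integral>x. (\<eta> x *\<^sub>R g x + u x *\<^sub>R grad \<eta> x) $ i * \<psi> x \<partial>lborel)"
      by linarith
  qed
qed

text \<open>The setting of the estimates: \<open>u\<close> is extended by zero, \<open>g\<close> is its weak gradient, and minimality is assumed in the form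
in which the lemma \<open>minimality\<close> provides it.\<close>

locale minimizer =
  fixes \<Omega> :: "(real^'n::finite) set" and \<epsilon> :: real and Q u :: "real^'n \<Rightarrow> real" and g :: "real^'n \<Rightarrow> real^'n" and M :: real
  assumes open_domain: "open \<Omega>" and bounded_domain: "bounded \<Omega>"
    and wp: "weak_pair \<Omega> u g" and uc: "continuous_on \<Omega> u"
    and Q_meas [measurable]: "Q \<in> borel_measurable borel" and Q_bound: "\<And>x. x \<in> \<Omega> \<Longrightarrow> \<bar>Q x\<bar> \<le> M"
    and \<epsilon>_pos: "\<epsilon> > 0"
    and min: "\<And>w G. approximable \<Omega> w G \<Longrightarrow> (\<And>x. x \<notin> \<Omega> \<Longrightarrow> G x = 0) \<Longrightarrow>
       sqnorm G + (\<integral>\<^sup>+x. ennreal \<bar>indicator {z. u z > 0} x - indicator {z. u z - w z > 0} x\<bar> \<partial>lborel) < ennreal \<epsilon> \<Longrightarrow>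
       (\<integral>\<^sup>+x. ennreal ((norm (g x))\<^sup>2 + (Q x)\<^sup>2 * indicator {z. u z > 0} x) \<partial>lborel) \<le>
       (\<integral>\<^sup>+x. ennreal ((norm (g x - G x))\<^sup>2 + (Q x)\<^sup>2 * indicator {z. u z - w z > 0} x) \<partial>lborel)"
begin

definition Pos :: "(real^'n) set" where "Pos = {x. u x > 0}"
definition energy_density :: "real^'n \<Rightarrow> real" where "energy_density x = ((norm (g x))\<^sup>2 + (Q x)\<^sup>2) * indicator Pos x"
definition mass_density :: "real^'n \<Rightarrow> real" where "mass_density x = (u x)\<^sup>2 * indicator Pos x"
definition energy :: "real^'n \<Rightarrow> real \<Rightarrow> real" where
  "energy q s = (\<integral>x. energy_density x * indicator (ball q s) x \<partial>lborel)"
definition mass :: "real^'n \<Rightarrow> real \<Rightarrow> real" where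
  "mass q s = (\<integral>x. mass_density x * indicator (ball q s) x \<partial>lborel)"
definition vol :: "real^'n \<Rightarrow> real \<Rightarrow> real" where
  "vol q s = measure lborel (Pos \<inter> ball q s)"
definition total :: "real^'n \<Rightarrow> real \<Rightarrow> real" where
  "total q s = energy q s + mass q s / s\<^sup>2"

lemma u_meas [measurable]: "u \<in> borel_measurable borel" and g_meas [measurable]: "g \<in> borel_measurable borel"
  and u_sqnorm: "sqnorm u < \<infinity>" and g_sqnorm: "sqnorm g < \<infinity>" and zero_outside: "x \<notin> \<Omega> \<Longrightarrow> u x = 0" "x \<notin> \<Omega> \<Longrightarrow> g x = 0"
  using wp by (auto simp: weak_pair_def)

lemma Pos_meas [measurable]: "Pos \<in> sets borel"
  unfolding Pos_def by measurable

lemma Pos_subset: "Pos \<subseteq> \<Omega>"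
  using zero_outside by (force simp: Pos_def)

lemma integrable_g: "integrable lborel (\<lambda>x. (norm (g x))\<^sup>2)"
  using g_sqnorm integrable_square_iff_sqnorm[OF g_meas] by simp

lemma integrable_indicator_mult:
  assumes "integrable lborel f" "A \<in> sets borel"
  shows "integrable lborel (\<lambda>x. f x * indicator A x :: real)"
  using assms by (intro integrable_mult_bounded[of _ _ _ 1]) (auto simp: indicator_def)

lemma finite_domain: "emeasure lborel \<Omega> < \<infinity>"
  using emeasure_bounded_finite[OF bounded_domain] by simp

lemma integrable_Q: "integrable lborel (\<lambda>x. (Q x)\<^sup>2 * indicator Pos x)"
proof (rule Bochner_Integration.integrable_bound)
  have "\<Omega> \<in> sets borel" using open_domain by simp
  then show "integrable lborel (\<lambda>x. M\<^sup>2 * indicator \<Omega> x)"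
    using finite_domain by simp
  have "(Q x)\<^sup>2 * indicator Pos x \<le> M\<^sup>2 * indicator \<Omega> x" for x
  proof (cases "x \<in> Pos")
    case True
    then have "x \<in> \<Omega>" using Pos_subset by blast
    then have "\<bar>Q x\<bar>\<^sup>2 \<le> M\<^sup>2" by (intro power_mono Q_bound) auto
    then show ?thesis using True \<open>x \<in> \<Omega>\<close> by simp
  qed simp
  then show "AE x in lborel. norm ((Q x)\<^sup>2 * indicator Pos x) \<le> norm (M\<^sup>2 * indicator \<Omega> x)" by auto
qed measurable

lemma integrable_energy_density: "integrable lborel energy_density"
  unfolding energy_density_def[abs_def] using integrable_indicator_mult[OF integrable_g Pos_meas] integrable_Q
  by (simp add: distrib_right)

lemma integrable_mass_density: "integrable lborel mass_density"
  unfolding mass_density_def[abs_def] using u_sqnorm integrable_square_iff_sqnorm[OF u_meas]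
  by (intro integrable_indicator_mult) auto

lemma energy_density_nonneg: "0 \<le> energy_density x" and mass_density_nonneg: "0 \<le> mass_density x"
  by (auto simp: energy_density_def mass_density_def)

lemma integrable_energy_density_ball: "integrable lborel (\<lambda>x. energy_density x * indicator (ball q s) x)"
  by (rule integrable_indicator_mult[OF integrable_energy_density]) simp

lemma integrable_mass_density_ball: "integrable lborel (\<lambda>x. mass_density x * indicator (ball q s) x)"
  by (rule integrable_indicator_mult[OF integrable_mass_density]) simp

lemma energy_nonneg: "0 \<le> energy q s" and mass_nonneg: "0 \<le> mass q s" and vol_nonneg: "0 \<le> vol q s"
  by (auto simp: energy_def mass_def vol_def energy_density_nonneg mass_density_nonneg intro!: integral_nonneg_AE)

lemma total_nonneg: "0 \<le> total q s"
  by (simp add: total_def energy_nonneg mass_nonneg)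

lemma energy_mono: "ball q s \<subseteq> ball q' s' \<Longrightarrow> energy q s \<le> energy q' s'"
  unfolding energy_def
  by (intro integral_mono integrable_energy_density_ball mult_left_mono energy_density_nonneg) (auto simp: indicator_def)

lemma mass_mono: "ball q s \<subseteq> ball q' s' \<Longrightarrow> mass q s \<le> mass q' s'"
  unfolding mass_def
  by (intro integral_mono integrable_mass_density_ball mult_left_mono mass_density_nonneg) (auto simp: indicator_def)

lemma emeasure_Pos_ball: "emeasure lborel (Pos \<inter> ball q s) = ennreal (vol q s)"
proof -
  have "emeasure lborel (Pos \<inter> ball q s) \<le> emeasure lborel (ball q s)" by (intro emeasure_mono) auto
  also have "\<dots> < \<infinity>" using emeasure_lborel_ball_finite[of q s] by simp
  finally show ?thesis unfolding vol_def by (intro emeasure_eq_ennreal_measure) auto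
qed

lemma vol_mono: "ball q s \<subseteq> ball q' s' \<Longrightarrow> vol q s \<le> vol q' s'"
proof -
  assume "ball q s \<subseteq> ball q' s'"
  then have "emeasure lborel (Pos \<inter> ball q s) \<le> emeasure lborel (Pos \<inter> ball q' s')"
    by (intro emeasure_mono) auto
  then show ?thesis by (simp add: emeasure_Pos_ball vol_nonneg)
qed

text \<open>Since \<open>\<eta> \<ge> 0\<close>, \<open>max 0 (\<eta> u)\<close> is the cut-off of the positive part of \<open>u\<close>, so that only the values of \<open>u\<close> and \<open>g\<close> on
the positivity set enter.\<close>

lemma competitor_facts:
  assumes s: "s > 0" and sub: "ball q s \<subseteq> \<Omega>" and \<eta>: "\<eta> \<in> test_functions (ball q s)"
    and range: "\<And>x. 0 \<le> \<eta> x" "\<And>x. \<eta> x \<le> 1" and grad: "\<And>x. norm (grad \<eta> x) \<le> l"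
  defines "w \<equiv> (\<lambda>x. max 0 (\<eta> x * u x))"
    and "G \<equiv> (\<lambda>x. if \<eta> x * u x > 0 then \<eta> x *\<^sub>R g x + u x *\<^sub>R grad \<eta> x else 0)"
  shows "approximable \<Omega> w G" "\<And>x. x \<notin> \<Omega> \<Longrightarrow> G x = 0"
    "sqnorm G \<le> ennreal (2 * energy q s + 2 * l\<^sup>2 * mass q s)"
    "{x. w x \<noteq> 0} \<subseteq> Pos \<inter> ball q s"
proof -
  have \<eta>t: "\<eta> \<in> test_functions \<Omega>" using test_functions_mono[OF sub \<eta>] .
  have \<eta>0: "\<eta> x = 0" if "x \<notin> ball q s" for x
    using approximable_zero_outside[OF approximable_test[OF \<eta>] that] .
  show "approximable \<Omega> w G"
    unfolding w_def G_def
    by (rule approximable_pos_part[OF approximable_cutoff[OF wp open_domain uc \<eta>t]])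
  show "G x = 0" if "x \<notin> \<Omega>" for x using zero_outside[OF that] by (simp add: G_def)
  show "{x. w x \<noteq> 0} \<subseteq> Pos \<inter> ball q s"
  proof
    fix x assume "x \<in> {x. w x \<noteq> 0}"
    then have pos: "\<eta> x * u x > 0" by (cases "\<eta> x * u x \<le> 0") (auto simp: w_def)
    then have "\<eta> x > 0" "u x > 0" using range(1)[of x] by (auto simp: zero_less_mult_iff)
    then show "x \<in> Pos \<inter> ball q s" using \<eta>0[of x] by (auto simp: Pos_def)
  qed
  let ?d = "\<lambda>x. 2 * (energy_density x * indicator (ball q s) x) + 2 * l\<^sup>2 * (mass_density x * indicator (ball q s) x)"
  have pt: "(norm (G x))\<^sup>2 \<le> ?d x" for x
  proof (cases "\<eta> x * u x > 0")
    case True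
    then have pos: "\<eta> x > 0" "u x > 0" using range(1)[of x] by (auto simp: zero_less_mult_iff)
    then have x: "x \<in> Pos" "x \<in> ball q s" using \<eta>0[of x] by (auto simp: Pos_def)
    have "norm (\<eta> x *\<^sub>R g x + u x *\<^sub>R grad \<eta> x) \<le> norm (\<eta> x *\<^sub>R g x) + norm (u x *\<^sub>R grad \<eta> x)" by (rule norm_triangle_ineq)
    also have "\<dots> \<le> 1 * norm (g x) + \<bar>u x\<bar> * l"
      unfolding norm_scaleR using range grad by (intro add_mono mult_mono) auto
    finally have "(norm (\<eta> x *\<^sub>R g x + u x *\<^sub>R grad \<eta> x))\<^sup>2 \<le> (norm (g x) + \<bar>u x\<bar> * l)\<^sup>2"
      by (intro power_mono) auto
    also have "\<dots> \<le> 2 * (norm (g x))\<^sup>2 + 2 * (\<bar>u x\<bar> * l)\<^sup>2"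
      using sum_squares_bound[of "norm (g x)" "\<bar>u x\<bar> * l"] by (simp add: power2_sum)
    also have "\<dots> \<le> ?d x"
      using x by (simp add: energy_density_def mass_density_def power_mult_distrib)
    finally show ?thesis using True by (simp add: G_def)
  qed (auto simp: G_def energy_density_nonneg mass_density_nonneg)
  have int: "integrable lborel ?d" using integrable_energy_density_ball integrable_mass_density_ball by simp
  have "sqnorm G \<le> (\<integral>\<^sup>+x. ennreal (?d x) \<partial>lborel)"
    unfolding sqnorm_def by (intro nn_integral_mono ennreal_leI pt)
  also have "\<dots> = ennreal (\<integral>x. ?d x \<partial>lborel)"
    using int by (intro nn_integral_eq_integral) (auto simp: energy_density_nonneg mass_density_nonneg)
  also have "(\<integral>x. ?d x \<partial>lborel) = 2 * energy q s + 2 * l\<^sup>2 * mass q s"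
    using integrable_energy_density_ball integrable_mass_density_ball by (simp add: energy_def mass_def)
  finally show "sqnorm G \<le> ennreal (2 * energy q s + 2 * l\<^sup>2 * mass q s)" .
qed

text \<open>The Faber-Krahn inequality for the cut-off positive part. The radius \<open>r\<close> measures how small the positivity set is.\<close>

lemma mass_decay:
  assumes s: "s > 0" and sub: "ball q s \<subseteq> \<Omega>" and \<eta>: "\<eta> \<in> test_functions (ball q s)"
    and range: "\<And>x. 0 \<le> \<eta> x" "\<And>x. \<eta> x \<le> 1" and grad: "\<And>x. norm (grad \<eta> x) \<le> l"
    and one: "\<And>x. x \<in> ball q (s/2) \<Longrightarrow> \<eta> x = 1"
    and r: "r > 0" and small: "2 * vol q s \<le> unit_ball_vol (real CARD('n)) * r ^ CARD('n)"
  shows "mass q (s/2) \<le> 4 * r\<^sup>2 * (energy q s + l\<^sup>2 * mass q s)"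
proof -
  define w where "w = (\<lambda>x. max 0 (\<eta> x * u x))"
  define G where "G = (\<lambda>x. if \<eta> x * u x > 0 then \<eta> x *\<^sub>R g x + u x *\<^sub>R grad \<eta> x else 0)"
  note c = competitor_facts(1-3)[OF s sub \<eta> range grad, folded w_def G_def]
  have supp: "{x. w x \<noteq> 0} \<subseteq> Pos \<inter> ball q s"
    unfolding w_def by (rule competitor_facts(4)[OF s sub \<eta> range grad])
  have "2 * emeasure lborel {x. w x \<noteq> 0} \<le> 2 * emeasure lborel (Pos \<inter> ball q s)"
    by (intro mult_left_mono emeasure_mono supp) auto
  also have "\<dots> = ennreal (2 * vol q s)"
    by (simp add: emeasure_Pos_ball vol_nonneg ennreal_mult)
  also have "\<dots> \<le> emeasure lborel (ball (0::real^'n) r)"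
    using small r by (simp add: emeasure_ball ennreal_leI)
  finally have "sqnorm w \<le> ennreal (2 * r\<^sup>2) * sqnorm G"
    by (intro faber_krahn[OF c(1) bounded_domain _ r]) (auto simp: w_def)
  also have "\<dots> \<le> ennreal (2 * r\<^sup>2) * ennreal (2 * energy q s + 2 * l\<^sup>2 * mass q s)"
    by (intro mult_left_mono c(3)) auto
  also have "\<dots> = ennreal (4 * r\<^sup>2 * (energy q s + l\<^sup>2 * mass q s))"
    by (subst ennreal_mult[symmetric]) (auto simp: energy_nonneg mass_nonneg algebra_simps)
  finally have "sqnorm w \<le> ennreal (4 * r\<^sup>2 * (energy q s + l\<^sup>2 * mass q s))" .
  moreover have "ennreal (mass q (s/2)) \<le> sqnorm w"
  proof -
    have "ennreal (mass q (s/2)) = (\<integral>\<^sup>+x. ennreal (mass_density x * indicator (ball q (s/2)) x) \<partial>lborel)"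
      unfolding mass_def
      using integrable_mass_density_ball by (intro nn_integral_eq_integral[symmetric]) (auto simp: mass_density_nonneg)
    also have "\<dots> \<le> sqnorm w"
      unfolding sqnorm_def
      by (intro nn_integral_mono ennreal_leI) (auto simp: w_def mass_density_def Pos_def one indicator_def max_def)
    finally show ?thesis .
  qed
  ultimately have "ennreal (mass q (s/2)) \<le> ennreal (4 * r\<^sup>2 * (energy q s + l\<^sup>2 * mass q s))" by (rule order_trans[rotated])
  then show ?thesis by (subst (asm) ennreal_le_iff) (auto simp: energy_nonneg mass_nonneg)
qed

text \<open>On the positivity set the competitor has gradient \<open>(1 - \<eta>) g - u \<nabla>\<eta>\<close>. Where \<open>\<eta> = 1\<close> the terms \<open>|g|\<^sup>2\<close> and \<open>Q\<^sup>2\<close>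
disappear from its energy; elsewhere the cross term is absorbed by \<open>2 a b \<le> \<theta> a\<^sup>2 + b\<^sup>2/\<theta>\<close>.\<close>

lemma energy_decay:
  assumes s: "s > 0" and sub: "ball q s \<subseteq> \<Omega>" and \<eta>: "\<eta> \<in> test_functions (ball q s)"
    and range: "\<And>x. 0 \<le> \<eta> x" "\<And>x. \<eta> x \<le> 1" and grad: "\<And>x. norm (grad \<eta> x) \<le> l"
    and one: "\<And>x. x \<in> ball q (s/2) \<Longrightarrow> \<eta> x = 1"
    and \<theta>: "\<theta> > 0" and small: "2 * energy q s + 2 * l\<^sup>2 * mass q s + vol q s < \<epsilon>"
  shows "energy q (s/2) \<le> \<theta> * energy q s + (1 + 1/\<theta>) * l\<^sup>2 * mass q s"
proof -
  define w where "w = (\<lambda>x. max 0 (\<eta> x * u x))"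
  define G where "G = (\<lambda>x. if \<eta> x * u x > 0 then \<eta> x *\<^sub>R g x + u x *\<^sub>R grad \<eta> x else 0)"
  note c = competitor_facts(1-3)[OF s sub \<eta> range grad, folded w_def G_def]
  have supp: "{x. w x \<noteq> 0} \<subseteq> Pos \<inter> ball q s"
    unfolding w_def by (rule competitor_facts(4)[OF s sub \<eta> range grad])
  have G0: "G x = 0" if "x \<notin> \<Omega>" for x using zero_outside[OF that] by (simp add: G_def)
  have \<eta>0: "\<eta> x = 0" if "x \<notin> ball q s" for x
    using approximable_zero_outside[OF approximable_test[OF \<eta>] that] .
  have w0: "w x = 0" if "x \<notin> Pos \<inter> ball q s" for x using supp that by auto
  have "(\<integral>\<^sup>+x. ennreal \<bar>indicator {z. u z > 0} x - indicator {z. u z - w z > 0} x\<bar> \<partial>lborel)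
      \<le> (\<integral>\<^sup>+x. indicator (Pos \<inter> ball q s) x \<partial>lborel)"
  proof (rule nn_integral_mono)
    fix x
    show "ennreal \<bar>indicator {z. u z > 0} x - indicator {z. u z - w z > 0} x\<bar> \<le> indicator (Pos \<inter> ball q s) x"
      using w0[of x] by (cases "x \<in> Pos \<inter> ball q s") (auto simp: indicator_def)
  qed
  also have "\<dots> = ennreal (vol q s)" by (simp add: emeasure_Pos_ball)
  finally have "sqnorm G + (\<integral>\<^sup>+x. ennreal \<bar>indicator {z. u z > 0} x - indicator {z. u z - w z > 0} x\<bar> \<partial>lborel)
     \<le> ennreal (2 * energy q s + 2 * l\<^sup>2 * mass q s) + ennreal (vol q s)"
    by (intro add_mono c(3))
  also have "\<dots> = ennreal (2 * energy q s + 2 * l\<^sup>2 * mass q s + vol q s)"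
    by (simp add: energy_nonneg mass_nonneg vol_nonneg)
  also have "\<dots> < ennreal \<epsilon>" using small \<epsilon>_pos by (intro ennreal_lessI)
  finally have m: "(\<integral>\<^sup>+x. ennreal ((norm (g x))\<^sup>2 + (Q x)\<^sup>2 * indicator {z. u z > 0} x) \<partial>lborel) \<le>
       (\<integral>\<^sup>+x. ennreal ((norm (g x - G x))\<^sup>2 + (Q x)\<^sup>2 * indicator {z. u z - w z > 0} x) \<partial>lborel)"
    by (intro min[OF c(1) G0])
  let ?f = "\<lambda>x. (norm (g x))\<^sup>2 + (Q x)\<^sup>2 * indicator Pos x"
  let ?h = "\<lambda>x. ?f x - energy_density x * indicator (ball q (s/2)) x + \<theta> * (energy_density x * indicator (ball q s) x)
     + (1 + 1/\<theta>) * l\<^sup>2 * (mass_density x * indicator (ball q s) x)"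
  have pt: "(norm (g x - G x))\<^sup>2 + (Q x)\<^sup>2 * indicator {z. u z - w z > 0} x \<le> ?h x" for x
  proof (cases "\<eta> x * u x > 0")
    case False
    then have Gx: "G x = 0" and wx: "w x = 0" by (auto simp: G_def w_def)
    have "\<not> (x \<in> Pos \<and> x \<in> ball q (s/2))" using False one[of x] by (auto simp: Pos_def)
    then have e0: "energy_density x * indicator (ball q (s/2)) x = 0" by (auto simp: energy_density_def)
    have nn: "0 \<le> \<theta> * (energy_density x * indicator (ball q s) x)" "0 \<le> (1 + 1/\<theta>) * l\<^sup>2 * (mass_density x * indicator (ball q s) x)"
      using \<theta> by (auto intro!: mult_nonneg_nonneg energy_density_nonneg mass_density_nonneg)
    have ind: "indicator {z. u z - w z > 0} x = (indicator Pos x :: real)" using wx by (simp add: indicator_def Pos_def)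
    show ?thesis using nn unfolding Gx ind e0 diff_zero by linarith
  next
    case True
    then have pos: "\<eta> x > 0" "u x > 0" using range(1)[of x] by (auto simp: zero_less_mult_iff)
    then have x: "x \<in> Pos" "x \<in> ball q s" using \<eta>0[of x] by (auto simp: Pos_def)
    define A where "A = norm (g x)"
    define B where "B = \<bar>u x\<bar> * l"
    have AB: "A \<ge> 0" "B \<ge> 0" using order_trans[OF norm_ge_zero grad] by (auto simp: A_def B_def)
    define t where "t = 1 - \<eta> x"
    have t: "0 \<le> t" "t \<le> 1" using range[of x] by (auto simp: t_def)
    have "norm (g x - G x) = norm (t *\<^sub>R g x - u x *\<^sub>R grad \<eta> x)"
      using True by (simp add: G_def t_def algebra_simps)
    also have "\<dots> \<le> norm (t *\<^sub>R g x) + norm (u x *\<^sub>R grad \<eta> x)" by (rule norm_triangle_ineq4)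
    also have "\<dots> \<le> t * A + B"
      unfolding norm_scaleR A_def B_def using t grad by (intro add_mono mult_left_mono) auto
    finally have "(norm (g x - G x))\<^sup>2 \<le> (t * A + B)\<^sup>2" by (intro power_mono) auto
    also have "\<dots> = t\<^sup>2 * A\<^sup>2 + 2 * t * A * B + B\<^sup>2" by (simp add: power2_sum power_mult_distrib)
    also have "\<dots> \<le> t\<^sup>2 * A\<^sup>2 + (\<theta> * A\<^sup>2 + (1/\<theta>) * B\<^sup>2) + B\<^sup>2"
    proof -
      have "2 * t * A * B \<le> 2 * A * B"
        using t AB mult_left_le_one_le[of "2 * A * B" t] by (simp add: mult_ac)
      also have "\<dots> \<le> \<theta> * A\<^sup>2 + (1/\<theta>) * B\<^sup>2"
      proof -
        have "0 \<le> (\<theta> * A - B)\<^sup>2 / \<theta>" using \<theta> by simp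
        also have "\<dots> = \<theta> * A\<^sup>2 + (1/\<theta>) * B\<^sup>2 - 2 * A * B"
          using \<theta> by (simp add: power2_eq_square field_simps)
        finally show ?thesis by simp
      qed
      finally show ?thesis by simp
    qed
    also have "\<dots> = t\<^sup>2 * A\<^sup>2 + \<theta> * A\<^sup>2 + (1 + 1/\<theta>) * B\<^sup>2" by (simp add: algebra_simps)
    finally have n: "(norm (g x - G x))\<^sup>2 \<le> t\<^sup>2 * A\<^sup>2 + \<theta> * A\<^sup>2 + (1 + 1/\<theta>) * B\<^sup>2" .
    have B2: "(1 + 1/\<theta>) * l\<^sup>2 * (mass_density x * indicator (ball q s) x) = (1 + 1/\<theta>) * B\<^sup>2"
      using x by (simp add: mass_density_def B_def power_mult_distrib)
    have eB: "\<theta> * (energy_density x * indicator (ball q s) x) = \<theta> * A\<^sup>2 + \<theta> * (Q x)\<^sup>2"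
      using x by (simp add: energy_density_def A_def distrib_left)
    have \<theta>Q: "0 \<le> \<theta> * (Q x)\<^sup>2" using \<theta> by simp
    show ?thesis
    proof (cases "x \<in> ball q (s/2)")
      case True
      then have tw: "t = 0" "w x = u x" using one pos by (auto simp: t_def w_def)
      have e1: "energy_density x * indicator (ball q (s/2)) x = A\<^sup>2 + (Q x)\<^sup>2"
        using x True by (simp add: energy_density_def A_def)
      have "(norm (g x - G x))\<^sup>2 \<le> \<theta> * A\<^sup>2 + (1 + 1/\<theta>) * B\<^sup>2" using n tw(1) by simp
      moreover have "indicator {z. u z - w z > 0} x = (0::real)" "indicator Pos x = (1::real)"
        using tw(2) x by (auto simp: indicator_def)
      ultimately show ?thesis using \<theta>Q unfolding B2 eB e1 A_def by simp
    next
      case False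
      have "t\<^sup>2 * A\<^sup>2 \<le> 1 * A\<^sup>2" using t by (intro mult_right_mono) (auto simp: power_le_one)
      moreover have "(Q x)\<^sup>2 * indicator {z. u z - w z > 0} x \<le> (Q x)\<^sup>2" by (simp add: indicator_def)
      moreover have e0: "energy_density x * indicator (ball q (s/2)) x = 0" and iP: "indicator Pos x = (1::real)"
        using x False by (auto simp: indicator_def)
      ultimately show ?thesis using n \<theta>Q unfolding B2 eB A_def e0 iP mult_1_right by linarith
    qed
  qed
  have fi: "integrable lborel ?f" using integrable_g integrable_Q by simp
  have hi: "integrable lborel ?h" using fi integrable_energy_density_ball integrable_mass_density_ball by simp
  have h0: "0 \<le> ?h x" for x using pt[of x] order_trans[OF _ pt[of x]] by (auto intro!: add_nonneg_nonneg)
  have "ennreal (\<integral>x. ?f x \<partial>lborel) = (\<integral>\<^sup>+x. ennreal (?f x) \<partial>lborel)"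
    using fi by (intro nn_integral_eq_integral[symmetric]) auto
  also have "\<dots> \<le> (\<integral>\<^sup>+x. ennreal (?h x) \<partial>lborel)"
    using m unfolding Pos_def[symmetric] by (rule order_trans) (intro nn_integral_mono ennreal_leI pt)
  also have "\<dots> = ennreal (\<integral>x. ?h x \<partial>lborel)"
    using hi h0 by (intro nn_integral_eq_integral) auto
  finally have "(\<integral>x. ?f x \<partial>lborel) \<le> (\<integral>x. ?h x \<partial>lborel)"
    using h0 by (subst (asm) ennreal_le_iff) (auto intro!: integral_nonneg_AE)
  also have "\<dots> = (\<integral>x. ?f x \<partial>lborel) - energy q (s/2) + \<theta> * energy q s + (1 + 1/\<theta>) * l\<^sup>2 * mass q s"
    using integrable_g integrable_Q integrable_energy_density_ball integrable_mass_density_ball by (simp add: energy_def mass_def)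
  finally show ?thesis by simp
qed

end

section \<open>Decay of the scaled energy\<close>

context minimizer
begin

text \<open>The mass estimate from scale \<open>s\<close> to \<open>s/2\<close> is followed by the energy estimate from \<open>s/2\<close> to \<open>s/4\<close>. First \<open>\<theta>\<close> makes
the coefficient of the energy small; then a small density makes the mass at scale \<open>s/2\<close> small enough to compensate
the factor \<open>1 + 1/\<theta>\<close>. The bounds by \<open>\<kappa>\<close> keep the competitor within the distance \<open>\<epsilon>\<close> in which \<open>u\<close> is minimal.\<close>

lemma decay:
  assumes "\<tau> > 0"
  obtains \<delta> \<kappa> where "\<delta> > 0" "\<kappa> > 0"
    "\<And>q s. \<lbrakk>s > 0; ball q s \<subseteq> \<Omega>; vol q s \<le> \<delta> * s ^ CARD('n); vol q s \<le> \<kappa>; total q s \<le> \<kappa>\<rbrakk>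
       \<Longrightarrow> total q (s/4) \<le> \<tau> * total q s"
proof -
  obtain L where L: "L \<ge> 1"
    and cut: "\<And>(q::real^'n) s. s > 0 \<Longrightarrow> \<exists>\<eta>\<in>test_functions (ball q s).
       (\<forall>x. 0 \<le> \<eta> x \<and> \<eta> x \<le> 1) \<and> (\<forall>x\<in>ball q (s/2). \<eta> x = 1) \<and> (\<forall>x. norm (grad \<eta> x) \<le> L / s)"
    using cutoff_exists by blast
  define \<theta> where "\<theta> = \<tau> / 2"
  have \<theta>: "\<theta> > 0" using assms by (simp add: \<theta>_def)
  \<comment> \<open>\<open>C\<close> collects the factors of \<open>\<rho>\<^sup>2\<close> in the energy and mass terms at scale \<open>s/4\<close>; \<open>\<rho>\<close> is the
    ratio \<open>r/s\<close> in the Faber-Krahn inequality, chosen such that \<open>\<rho>\<^sup>2 C = \<theta>\<close>.\<close>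
  define C where "C = L^4 * (16 * (1 + 1/\<theta>) + 64)"
  have C: "C > 0" using L \<theta> by (auto simp: C_def intro!: mult_pos_pos add_pos_pos)
  define \<rho> where "\<rho> = sqrt (\<theta> / C)"
  have \<rho>: "\<rho> > 0" "\<rho>\<^sup>2 = \<theta> / C" using \<theta> C by (auto simp: \<rho>_def)
  define \<omega> where "\<omega> = unit_ball_vol (real CARD('n))"
  have \<omega>: "\<omega> > 0" by (simp add: \<omega>_def)
  define \<delta> where "\<delta> = \<omega> * \<rho> ^ CARD('n) / 2"
  \<comment> \<open>The competitor at scale \<open>s/2\<close> has distance at most \<open>(10 L\<^sup>2 + 1) \<kappa>\<close> from \<open>u\<close>.\<close>
  define \<kappa> where "\<kappa> = \<epsilon> / (2 * (10 * L\<^sup>2 + 1))"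
  have L2: "1 \<le> L\<^sup>2" using L by simp
  have \<kappa>: "\<kappa> > 0" using \<epsilon>_pos L2 by (auto simp: \<kappa>_def intro!: divide_pos_pos)
  have \<kappa>\<epsilon>: "(10 * L\<^sup>2 + 1) * \<kappa> < \<epsilon>"
  proof -
    have "(10 * L\<^sup>2 + 1) * \<kappa> = \<epsilon> / 2" using L2 by (simp add: \<kappa>_def field_simps)
    then show ?thesis using \<epsilon>_pos by simp
  qed
  show ?thesis
  proof (rule that[of \<delta> \<kappa>])
    show "\<delta> > 0" using \<omega> \<rho> by (simp add: \<delta>_def)
    show "\<kappa> > 0" by (rule \<kappa>)
    fix q s
    assume s: "s > 0" and sub: "ball q s \<subseteq> \<Omega>" and v\<delta>: "vol q s \<le> \<delta> * s ^ CARD('n)"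
      and v\<kappa>: "vol q s \<le> \<kappa>" and t\<kappa>: "total q s \<le> \<kappa>"
    define H where "H = total q s"
    have H: "0 \<le> H" "H \<le> \<kappa>" using t\<kappa> by (auto simp: H_def total_nonneg)
    have half: "ball q (s/2) \<subseteq> ball q s" using s by (intro subset_ball) simp
    have sub2: "ball q (s/2) \<subseteq> \<Omega>" by (rule order_trans[OF half sub])
    have HE: "energy q s \<le> H" "mass q s / s\<^sup>2 \<le> H"
      using energy_nonneg[of q s] mass_nonneg[of q s] by (auto simp: H_def total_def)
    obtain \<eta> where \<eta>: "\<eta> \<in> test_functions (ball q s)" "\<And>x. 0 \<le> \<eta> x" "\<And>x. \<eta> x \<le> 1"
      "\<And>x. x \<in> ball q (s/2) \<Longrightarrow> \<eta> x = 1" "\<And>x. norm (grad \<eta> x) \<le> L / s"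
      using cut[OF s, of q] by blast
    have "mass q (s/2) \<le> 4 * (\<rho> * s)\<^sup>2 * (energy q s + (L / s)\<^sup>2 * mass q s)"
      using v\<delta> \<rho> s by (intro mass_decay[OF s sub \<eta>(1-3,5,4)])
        (auto simp: \<delta>_def \<omega>_def power_mult_distrib field_simps)
    also have "energy q s + (L / s)\<^sup>2 * mass q s \<le> L\<^sup>2 * H"
    proof -
      have "1 * energy q s \<le> L\<^sup>2 * energy q s" by (intro mult_right_mono L2 energy_nonneg)
      then show ?thesis by (simp add: H_def total_def power_divide distrib_left)
    qed
    finally have "mass q (s/2) \<le> 4 * (\<rho> * s)\<^sup>2 * (L\<^sup>2 * H)"
      by (simp add: mult_left_mono)
    then have m2: "mass q (s/2) / s\<^sup>2 \<le> 4 * \<rho>\<^sup>2 * L\<^sup>2 * H"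
      using s by (simp add: power_mult_distrib field_simps)
    have m2': "mass q (s/2) / s\<^sup>2 \<le> H"
      using HE(2) divide_right_mono[OF mass_mono[OF half], of "s\<^sup>2"] by simp
    have e2: "energy q (s/2) \<le> H"
      using HE(1) energy_mono[OF half] by simp
    have v2: "vol q (s/2) \<le> \<kappa>"
      using v\<kappa> vol_mono[OF half] by simp
    obtain \<eta>' where \<eta>': "\<eta>' \<in> test_functions (ball q (s/2))" "\<And>x. 0 \<le> \<eta>' x" "\<And>x. \<eta>' x \<le> 1"
      "\<And>x. x \<in> ball q (s/2/2) \<Longrightarrow> \<eta>' x = 1" "\<And>x. norm (grad \<eta>' x) \<le> L / (s/2)"
      using cut[of "s/2" q] s by (metis half_gt_zero)
    have lm: "(L / (s/2))\<^sup>2 * mass q (s/2) = 4 * L\<^sup>2 * (mass q (s/2) / s\<^sup>2)"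
      using s by (simp add: power2_eq_square field_simps)
    have "energy q (s/2/2) \<le> \<theta> * energy q (s/2) + (1 + 1/\<theta>) * (L / (s/2))\<^sup>2 * mass q (s/2)"
    proof (rule energy_decay[OF _ sub2 \<eta>'(1-3,5,4) \<theta>])
      have "2 * (L / (s/2))\<^sup>2 * mass q (s/2) = 8 * L\<^sup>2 * (mass q (s/2) / s\<^sup>2)"
        using lm by simp
      also have "\<dots> \<le> 8 * L\<^sup>2 * \<kappa>" using m2' H by (intro mult_left_mono) auto
      finally have "2 * energy q (s/2) + 2 * (L / (s/2))\<^sup>2 * mass q (s/2) + vol q (s/2) \<le> 2 * \<kappa> + 8 * L\<^sup>2 * \<kappa> + \<kappa>"
        using e2 v2 H by linarith
      also have "\<dots> \<le> (10 * L\<^sup>2 + 1) * \<kappa>"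
        using mult_right_mono[OF L2, of \<kappa>] \<kappa> by (simp add: algebra_simps)
      finally show "2 * energy q (s/2) + 2 * (L / (s/2))\<^sup>2 * mass q (s/2) + vol q (s/2) < \<epsilon>"
        using \<kappa>\<epsilon> by linarith
    qed (use s in auto)
    also have "\<theta> * energy q (s/2) \<le> \<theta> * H" using e2 \<theta> by (intro mult_left_mono) auto
    also have "(1 + 1/\<theta>) * (L / (s/2))\<^sup>2 * mass q (s/2) \<le> (1 + 1/\<theta>) * (4 * L\<^sup>2 * (4 * \<rho>\<^sup>2 * L\<^sup>2 * H))"
      unfolding mult.assoc[of "1 + 1/\<theta>"] lm using m2 \<theta> by (intro mult_left_mono) auto
    finally have e4: "energy q (s/4) \<le> \<theta> * H + (1 + 1/\<theta>) * (4 * L\<^sup>2 * (4 * \<rho>\<^sup>2 * L\<^sup>2 * H))"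
      by simp
    have "mass q (s/4) \<le> mass q (s/2)" using s by (intro mass_mono subset_ball) auto
    then have "mass q (s/4) / (s/4)\<^sup>2 \<le> 16 * (mass q (s/2) / s\<^sup>2)"
      using s by (simp add: power2_eq_square field_simps)
    also have "\<dots> \<le> 16 * (4 * \<rho>\<^sup>2 * L\<^sup>2 * H)" using m2 by simp
    also have "\<dots> \<le> 64 * \<rho>\<^sup>2 * (L\<^sup>2 * L\<^sup>2) * H"
    proof -
      have "1 * (\<rho>\<^sup>2 * L\<^sup>2 * H) \<le> L\<^sup>2 * (\<rho>\<^sup>2 * L\<^sup>2 * H)" using H by (intro mult_right_mono L2) auto
      then show ?thesis by (simp add: mult_ac)
    qed
    finally have m4: "mass q (s/4) / (s/4)\<^sup>2 \<le> 64 * \<rho>\<^sup>2 * (L\<^sup>2 * L\<^sup>2) * H" .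
    have "total q (s/4) \<le> \<theta> * H + \<rho>\<^sup>2 * C * H"
      using e4 m4 by (simp add: total_def C_def algebra_simps power2_eq_square power4_eq_xxxx)
    also have "\<dots> = \<tau> * H" using \<rho>(2) C by (simp add: \<theta>_def algebra_simps)
    finally show "total q (s/4) \<le> \<tau> * total q s" by (simp add: H_def)
  qed
qed

lemma energy_tendsto_0:
  assumes "e > 0" obtains s1 where "s1 > 0" "\<And>s. s \<le> s1 \<Longrightarrow> energy p s \<le> e"
proof -
  have "(\<lambda>k. energy p (1 / real (Suc k))) \<longlonglongrightarrow> (\<integral>x. 0 \<partial>(lborel :: (real^'n) measure))"
    unfolding energy_def
  proof (rule integral_dominated_convergence[where w = energy_density])
    have "AE x in lborel. x \<noteq> p" by (rule AE_lborel_singleton)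
    then show "AE x in lborel. (\<lambda>k. energy_density x * indicator (ball p (1 / real (Suc k))) x) \<longlonglongrightarrow> 0"
    proof eventually_elim
      case (elim x)
      then have "dist p x > 0" by simp
      then have "\<forall>\<^sub>F k in sequentially. 1 / real (Suc k) \<le> dist p x" by (rule eventually_over_Suc_le)
      then have "\<forall>\<^sub>F k in sequentially. energy_density x * indicator (ball p (1 / real (Suc k))) x = 0"
        by eventually_elim (simp add: indicator_def)
      then show ?case by (rule tendsto_eventually)
    qed
    show "AE x in lborel. norm (energy_density x * indicator (ball p (1 / real (Suc k))) x) \<le> energy_density x" for k
      by (auto simp: energy_density_nonneg indicator_def)
  qed (use integrable_energy_density integrable_energy_density_ball in auto)
  then have "\<forall>\<^sub>F k in sequentially. energy p (1 / real (Suc k)) < e"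
    using assms by (intro order_tendstoD) auto
  then obtain k where k: "energy p (1 / real (Suc k)) < e"
    using eventually_happens'[OF sequentially_bot] by blast
  show ?thesis
  proof (rule that[of "1 / real (Suc k)"])
    show "energy p s \<le> e" if "s \<le> 1 / real (Suc k)" for s
      using energy_mono[OF subset_ball[OF that]] k by (meson le_less_trans less_imp_le)
  qed simp
qed

lemma mass_le_vol:
  assumes "\<And>x. x \<in> ball p s \<Longrightarrow> \<bar>u x\<bar> \<le> C"
  shows "mass p s \<le> C\<^sup>2 * vol p s"
proof -
  have fin: "emeasure lborel (Pos \<inter> ball p s) < \<infinity>" by (simp add: emeasure_Pos_ball)
  have "mass p s \<le> (\<integral>x. C\<^sup>2 * indicator (Pos \<inter> ball p s) x \<partial>lborel)"
    unfolding mass_def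
  proof (rule integral_mono[OF integrable_mass_density_ball])
    show "integrable lborel (\<lambda>x. C\<^sup>2 * indicator (Pos \<inter> ball p s) x)" using fin by simp
    fix x
    show "mass_density x * indicator (ball p s) x \<le> C\<^sup>2 * indicator (Pos \<inter> ball p s) x"
    proof (cases "x \<in> ball p s")
      case True
      have "\<bar>u x\<bar>\<^sup>2 \<le> C\<^sup>2" by (intro power_mono assms True) auto
      then show ?thesis by (auto simp: mass_density_def indicator_def)
    qed simp
  qed
  then show ?thesis using fin by (simp add: vol_def)
qed

lemma open_Pos: "open Pos"
proof -
  have "Pos = \<Omega> \<inter> u -` {0<..}" using Pos_subset by (auto simp: Pos_def)
  then show ?thesis
    using continuous_open_preimage[OF uc open_domain open_greaterThan] by simp
qed

lemma vol_interior:
  assumes "q \<in> Pos" obtains t where "t > 0"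
    "\<And>s. 0 < s \<Longrightarrow> s \<le> t \<Longrightarrow> vol q s = unit_ball_vol (real CARD('n)) * s ^ CARD('n)"
proof -
  obtain t where t: "t > 0" "ball q t \<subseteq> Pos" using open_Pos assms by (meson open_contains_ball)
  show ?thesis
  proof (rule that[OF t(1)])
    fix s assume s: "0 < s" "s \<le> t"
    have "Pos \<inter> ball q s = ball q s" using t(2) subset_ball[OF s(2)] by blast
    then show "vol q s = unit_ball_vol (real CARD('n)) * s ^ CARD('n)"
      using s emeasure_ball[of s q] by (simp add: vol_def measure_def)
  qed
qed

end

text \<open>The slab is contained in a box with one side \<open>2 l s\<close> and all other sides \<open>2 s\<close>.\<close>

lemma measure_slab_le:
  fixes q :: "real^'n::finite"
  assumes "s > 0" "l > 0"
  shows "emeasure lborel {x \<in> ball q s. \<bar>x $ i\<bar> < l * s} \<le> ennreal (2 ^ CARD('n) * l * s ^ CARD('n))"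
proof -
  define a where "a = (\<chi> j. if j = i then - (l * s) else q $ j - s)"
  define b where "b = (\<chi> j. if j = i then l * s else q $ j + s)"
  have "{x \<in> ball q s. \<bar>x $ i\<bar> < l * s} \<subseteq> cbox a b"
  proof
    fix x assume x: "x \<in> {x \<in> ball q s. \<bar>x $ i\<bar> < l * s}"
    have "\<bar>x $ j - q $ j\<bar> < s" for j
      using component_le_norm_cart[of "x - q" j] x by (simp add: dist_norm norm_minus_commute)
    then have "q $ j - s \<le> x $ j \<and> x $ j \<le> q $ j + s" for j by (smt (verit))
    then show "x \<in> cbox a b" using x by (auto simp: mem_box_cart a_def b_def)
  qed
  then have "emeasure lborel {x \<in> ball q s. \<bar>x $ i\<bar> < l * s} \<le> emeasure lborel (cbox a b)"
    by (intro emeasure_mono) auto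
  also have "\<dots> = ennreal (measure lborel (cbox a b))"
    by (intro emeasure_eq_ennreal_measure) (simp add: emeasure_lborel_cbox_eq)
  also have "measure lborel (cbox a b) = (\<Prod>j\<in>UNIV. b $ j - a $ j)"
  proof -
    have "cbox a b \<noteq> {}" using assms by (auto simp: interval_ne_empty_cart a_def b_def)
    then show ?thesis by (rule content_cbox_cart)
  qed
  also have "\<dots> = (\<Prod>j\<in>UNIV. (2 * s) * (if j = i then l else 1))"
    by (intro prod.cong) (auto simp: a_def b_def)
  also have "\<dots> = 2 ^ CARD('n) * l * s ^ CARD('n)"
    by (simp add: prod.distrib power_mult_distrib)
  finally show ?thesis .
qed

section \<open>The power weight and the main result\<close>

text \<open>One coordinate \<open>i\<close> of the \<open>y\<close>-part bounds \<open>|y|\<close> from below, so that \<open>Q\<close> is small only in the slab where \<open>x $ i\<close> is small.\<close>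

lemma Q_power_ge:
  assumes "i \<notin> I" "0 < t" "t \<le> \<bar>x $ i\<bar>" "\<gamma> > 0"
  shows "t powr (2 * \<gamma>) \<le> (Q_power I \<gamma> x)\<^sup>2"
proof -
  have "\<bar>x $ i\<bar> \<le> norm (y_part I x)"
    using component_le_norm_cart[of "y_part I x" i] assms(1) by (simp add: y_part_def)
  then have "t powr \<gamma> \<le> Q_power I \<gamma> x"
    unfolding Q_power_def using assms by (intro powr_mono2) auto
  then have "(t powr \<gamma>)\<^sup>2 \<le> (Q_power I \<gamma> x)\<^sup>2" by (intro power_mono) auto
  then show ?thesis by (simp add: power2_eq_square powr_add[symmetric])
qed

lemma Q_power_le:
  assumes "norm x \<le> R" "\<gamma> > 0" shows "\<bar>Q_power I \<gamma> x\<bar> \<le> R powr \<gamma>"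
proof -
  have "norm (y_part I x) \<le> norm x"
    by (rule norm_le_componentwise_cart) (simp add: y_part_def)
  then show ?thesis unfolding Q_power_def using assms by (simp add: powr_mono2)
qed

lemma Q_power_measurable: "Q_power I \<gamma> \<in> borel_measurable borel"
proof -
  have "(\<lambda>x. y_part I x) \<in> borel_measurable borel"
    unfolding y_part_def by (rule borel_measurable_vecI) (auto intro!: borel_measurable_continuous_onI continuous_intros)
  then show ?thesis unfolding Q_power_def[abs_def] by measurable
qed

locale power_minimizer = minimizer \<Omega> \<epsilon> "Q_power I \<gamma>" u g M
  for \<Omega> :: "(real^'n::finite) set" and \<epsilon> I \<gamma> u g M +
  fixes i :: 'n
  assumes i: "i \<notin> I" and \<gamma>: "\<gamma> > 0" and dim: "CARD('n) \<ge> 2"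
begin

text \<open>Inside the slab the volume is bounded trivially, outside it by Chebyshev's inequality, as \<open>Q\<^sup>2 \<ge> (l s)\<^bsup>2\<gamma>\<^esup>\<close> there.\<close>

lemma vol_le_energy:
  assumes s: "s > 0" and l: "l > 0"
  shows "vol q s \<le> 2 ^ CARD('n) * l * s ^ CARD('n) + (l * s) powr (- (2 * \<gamma>)) * energy q s"
proof -
  let ?S = "{x \<in> ball q s. \<bar>x $ i\<bar> < l * s}"
  let ?T = "Pos \<inter> ball q s - ?S"
  let ?c = "(l * s) powr (- (2 * \<gamma>))"
  have S[measurable]: "?S \<in> sets borel" by measurable
  have "emeasure lborel ?T \<le> emeasure lborel (Pos \<inter> ball q s)" by (intro emeasure_mono) auto
  also have "\<dots> < \<infinity>" by (simp add: emeasure_Pos_ball)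
  finally have finT: "emeasure lborel ?T < \<infinity>" .
  have "measure lborel ?T = (\<integral>x. indicator ?T x \<partial>lborel)" by simp
  also have "\<dots> \<le> (\<integral>x. ?c * (energy_density x * indicator (ball q s) x) \<partial>lborel)"
  proof (rule integral_mono)
    show "integrable lborel (indicator ?T :: real^'n \<Rightarrow> real)" using finT by simp
    show "integrable lborel (\<lambda>x. ?c * (energy_density x * indicator (ball q s) x))" using integrable_energy_density_ball by simp
    fix x
    show "indicator ?T x \<le> ?c * (energy_density x * indicator (ball q s) x)"
    proof (cases "x \<in> ?T")
      case True
      then have x: "x \<in> Pos" "x \<in> ball q s" "l * s \<le> \<bar>x $ i\<bar>" by auto
      have "(l * s) powr (2 * \<gamma>) \<le> (Q_power I \<gamma> x)\<^sup>2"
        using s l by (intro Q_power_ge[OF i _ x(3) \<gamma>]) simp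
      also have "\<dots> \<le> energy_density x" using x by (simp add: energy_density_def)
      finally have "?c * (l * s) powr (2 * \<gamma>) \<le> ?c * energy_density x" by (intro mult_left_mono) auto
      moreover have "?c * (l * s) powr (2 * \<gamma>) = 1" using s l by (simp add: powr_add[symmetric])
      ultimately show ?thesis using True x by simp
    qed (simp add: energy_density_nonneg)
  qed
  also have "\<dots> = ?c * energy q s" by (simp add: energy_def)
  finally have T: "measure lborel ?T \<le> ?c * energy q s" .
  have "ennreal (vol q s) = emeasure lborel (Pos \<inter> ball q s)" by (simp add: emeasure_Pos_ball)
  also have "\<dots> \<le> emeasure lborel (?S \<union> ?T)" by (intro emeasure_mono) auto
  also have "\<dots> \<le> emeasure lborel ?S + emeasure lborel ?T" by (intro emeasure_subadditive) auto
  also have "\<dots> \<le> ennreal (2 ^ CARD('n) * l * s ^ CARD('n)) + ennreal (?c * energy q s)"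
  proof (intro add_mono measure_slab_le s l)
    have "emeasure lborel ?T = ennreal (measure lborel ?T)" using finT by (intro emeasure_eq_ennreal_measure) auto
    then show "emeasure lborel ?T \<le> ennreal (?c * energy q s)" using T by (simp add: ennreal_leI)
  qed
  also have "\<dots> = ennreal (2 ^ CARD('n) * l * s ^ CARD('n) + ?c * energy q s)"
    using s l by (simp add: energy_nonneg)
  finally show ?thesis
    using s l by (subst (asm) ennreal_le_iff) (auto simp: energy_nonneg)
qed

text \<open>The bound \<open>total q s \<le> e0 * s powr m\<close> with \<open>m = n + 2\<gamma>\<close> is chosen to be compatible with both estimates: it yields a
small density by the volume estimate, and with a small density \<open>decay\<close> reproduces it at scale \<open>s/4\<close>. The extra
factor \<open>1/2\<close> in \<open>\<tau>\<close> makes \<open>total p s / s powr m\<close> tend to zero at a point of density zero.\<close>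

lemma density_zero_imp_locally_zero:
  assumes p: "p \<in> \<Omega>"
    and density: "((\<lambda>s. vol p s / (unit_ball_vol (real CARD('n)) * s ^ CARD('n))) \<longlongrightarrow> 0) (at_right 0)"
  shows "\<exists>r>0. ball p r \<inter> Pos = {}"
proof -
  let ?n = "CARD('n)"
  define \<omega> where "\<omega> = unit_ball_vol (real ?n)"
  have \<omega>: "\<omega> > 0" by (simp add: \<omega>_def)
  define m where "m = real ?n + 2 * \<gamma>"
  have m: "m > 1" using dim \<gamma> by (simp add: m_def)
  define \<tau> where "\<tau> = (1/4) powr m / 2"
  have \<tau>: "\<tau> > 0" by (simp add: \<tau>_def)
  obtain \<delta>0 \<kappa> where \<delta>0: "\<delta>0 > 0" and \<kappa>: "\<kappa> > 0"
    and dec0: "\<And>q s. \<lbrakk>s > 0; ball q s \<subseteq> \<Omega>; vol q s \<le> \<delta>0 * s ^ ?n; vol q s \<le> \<kappa>; total q s \<le> \<kappa>\<rbrakk>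
       \<Longrightarrow> total q (s/4) \<le> \<tau> * total q s"
    using decay[OF \<tau>] by blast
  \<comment> \<open>A density \<open>\<delta>\<close> below that of a full ball excludes interior points of the positivity set.\<close>
  define \<delta> where "\<delta> = min \<delta>0 (\<omega> / 2)"
  have \<delta>: "\<delta> > 0" "\<delta> \<le> \<delta>0" "\<delta> < \<omega>" using \<delta>0 \<omega> by (auto simp: \<delta>_def)
  \<comment> \<open>The slab contributes \<open>\<delta>/2\<close> to the density by the choice of \<open>l\<close>, the rest another \<open>\<delta>/2\<close> by the choice of \<open>e0\<close>.\<close>
  define l where "l = \<delta> / (2 * 2 ^ ?n)"
  have l: "l > 0" using \<delta> by (simp add: l_def)
  define e0 where "e0 = (\<delta> / 2) * l powr (2 * \<gamma>)"
  have e0: "e0 > 0" using \<delta> l by (simp add: e0_def)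
  \<comment> \<open>Below the scale \<open>s0\<close> both bounds imply the smallness \<open>\<kappa>\<close> that \<open>decay\<close> requires, as \<open>s\<^sup>n \<le> s\<close> and
    \<open>s powr m \<le> s\<close> for \<open>s \<le> 1\<close>.\<close>
  define s0 where "s0 = min 1 (min (\<kappa> / \<delta>) (\<kappa> / e0))"
  have s0: "s0 > 0" using \<kappa> \<delta> e0 by (simp add: s0_def)
  have small: "\<delta> * s ^ ?n \<le> \<kappa>" "e0 * s powr m \<le> \<kappa>" if s: "0 < s" "s \<le> s0" for s
  proof -
    have s1: "s \<le> 1" using s by (simp add: s0_def)
    have "s ^ ?n \<le> s ^ 1" using s s1 by (intro power_decreasing) auto
    then have "\<delta> * s ^ ?n \<le> \<delta> * (\<kappa> / \<delta>)" using s \<delta> by (intro mult_left_mono) (auto simp: s0_def)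
    then show "\<delta> * s ^ ?n \<le> \<kappa>" using \<delta> by simp
    have "s powr m \<le> s powr 1" using s s1 m by (intro powr_mono') auto
    then have "e0 * s powr m \<le> e0 * (\<kappa> / e0)" using s e0 by (intro mult_left_mono) (auto simp: s0_def)
    then show "e0 * s powr m \<le> \<kappa>" using e0 by simp
  qed
  have vol_small: "vol q s \<le> \<delta> * s ^ ?n" if s: "0 < s" and t: "total q s \<le> e0 * s powr m" for q s
  proof -
    have "energy q s \<le> e0 * s powr m" using t mass_nonneg[of q s] by (simp add: total_def) (smt (verit) divide_nonneg_nonneg zero_le_power2)
    then have "(l * s) powr (- (2 * \<gamma>)) * energy q s \<le> (l * s) powr (- (2 * \<gamma>)) * (e0 * s powr m)"
      by (intro mult_left_mono) auto
    also have "\<dots> = (\<delta> / 2) * (l powr (- (2 * \<gamma>)) * l powr (2 * \<gamma>)) * (s powr (- (2 * \<gamma>)) * s powr m)"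
      using l s by (simp add: e0_def powr_mult mult_ac)
    also have "\<dots> = (\<delta> / 2) * s ^ ?n"
      using l s by (simp add: powr_add[symmetric] m_def powr_realpow)
    finally have "(l * s) powr (- (2 * \<gamma>)) * energy q s \<le> (\<delta> / 2) * s ^ ?n" .
    moreover have "2 ^ ?n * l * s ^ ?n = (\<delta> / 2) * s ^ ?n" by (simp add: l_def)
    ultimately show ?thesis using vol_le_energy[OF s l, of q] by linarith
  qed
  have dec: "total q (s/4) \<le> \<tau> * total q s"
    if "0 < s" "ball q s \<subseteq> \<Omega>" "vol q s \<le> \<delta> * s ^ ?n" "vol q s \<le> \<kappa>" "total q s \<le> \<kappa>" for q s
  proof (rule dec0[OF that(1,2) _ that(4,5)])
    have "\<delta> * s ^ ?n \<le> \<delta>0 * s ^ ?n" using \<delta> that(1) by (intro mult_right_mono) auto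
    then show "vol q s \<le> \<delta>0 * s ^ ?n" using that(3) by linarith
  qed
  have out: "q \<notin> Pos" if s: "0 < s" "s \<le> s0" "ball q s \<subseteq> \<Omega>" and t: "total q s \<le> e0 * s powr m" for q s
  proof
    assume "q \<in> Pos"
    then obtain t where t0: "t > 0" and tv: "\<And>s. 0 < s \<Longrightarrow> s \<le> t \<Longrightarrow> vol q s = \<omega> * s ^ ?n"
      using vol_interior by (metis \<omega>_def)
    have inv: "total q (s / 4 ^ j) \<le> e0 * (s / 4 ^ j) powr m" for j
    proof (induction j)
      case 0 then show ?case using t by simp
    next
      case (Suc j)
      define r where "r = s / 4 ^ j"
      have "s / 4 ^ j \<le> s / 1" using s by (intro divide_left_mono) auto
      then have r: "0 < r" "r \<le> s" using s by (auto simp: r_def)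
      have v: "vol q r \<le> \<delta> * r ^ ?n" using vol_small[OF r(1)] Suc by (simp add: r_def)
      have "total q (r/4) \<le> \<tau> * total q r"
      proof (rule dec[OF r(1) _ v])
        show "ball q r \<subseteq> \<Omega>" using subset_ball[OF r(2)] s(3) by blast
        show "vol q r \<le> \<kappa>" "total q r \<le> \<kappa>"
          using v Suc small[of r] r s(2) by (auto simp: r_def)
      qed
      also have "\<dots> \<le> \<tau> * (e0 * r powr m)" using Suc \<tau> by (intro mult_left_mono) (auto simp: r_def)
      also have "\<dots> \<le> (1/4) powr m * (e0 * r powr m)"
        using e0 by (intro mult_right_mono) (auto simp: \<tau>_def)
      also have "\<dots> = e0 * (r/4) powr m" using r by (simp add: powr_divide)
      finally show ?case by (simp add: r_def mult.commute)
    qed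
    have "(\<lambda>j. s * (1/4) ^ j) \<longlonglongrightarrow> s * 0" by (intro tendsto_intros LIMSEQ_power_zero) auto
    then have "\<forall>\<^sub>F j in sequentially. s * (1/4) ^ j < t" using t0 by (intro order_tendstoD) auto
    then obtain j where "s * (1/4) ^ j < t" using eventually_happens'[OF sequentially_bot] by blast
    then have j: "s / 4 ^ j \<le> t" "s / 4 ^ j > 0" using s by (auto simp: power_divide)
    have "\<omega> * (s / 4 ^ j) ^ ?n \<le> \<delta> * (s / 4 ^ j) ^ ?n"
      using vol_small[OF j(2) inv] tv[OF j(2,1)] by simp
    then have "\<omega> \<le> \<delta>" using j(2) by (simp add: mult_le_cancel_right)
    then show False using \<delta>(3) by simp
  qed
  have dens: "\<exists>t>0. \<forall>s. 0 < s \<and> s \<le> t \<longrightarrow> vol p s \<le> c * s ^ ?n" if c: "c > 0" for c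
  proof -
    have "\<forall>\<^sub>F s in at_right 0. vol p s / (\<omega> * s ^ ?n) < c / \<omega>"
      using density c \<omega> unfolding \<omega>_def[symmetric] by (intro order_tendstoD) auto
    then obtain b where b: "b > 0" "\<And>s. 0 < s \<Longrightarrow> s < b \<Longrightarrow> vol p s / (\<omega> * s ^ ?n) < c / \<omega>"
      by (auto simp: eventually_at_right[OF zero_less_one])
    have "vol p s \<le> c * s ^ ?n" if "0 < s" "s \<le> b / 2" for s
      using b(2)[of s] that b(1) \<omega> by (simp add: field_simps)
    then show ?thesis using b(1) by (intro exI[of _ "b/2"]) auto
  qed
  obtain R where R: "R > 0" "cball p R \<subseteq> \<Omega>" using open_domain p by (meson open_contains_cball)
  have "bounded (u ` cball p R)"
    using R(2) uc by (intro compact_imp_bounded compact_continuous_image) (auto intro: continuous_on_subset)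
  then obtain C where "\<forall>x\<in>cball p R. \<bar>u x\<bar> \<le> C" by (auto simp: bounded_iff)
  then have C: "\<And>x. x \<in> cball p R \<Longrightarrow> \<bar>u x\<bar> \<le> C" by blast
  \<comment> \<open>As \<open>n \<ge> 2\<close>, a small density also makes \<open>mass p s / s\<^sup>2\<close> small: \<open>u\<close> is bounded by \<open>C\<close> near \<open>p\<close>, and
    \<open>C\<^sup>2 c2 s\<^sup>n / s\<^sup>2 \<le> C\<^sup>2 c2\<close> for \<open>s \<le> 1\<close>.\<close>
  define c2 where "c2 = min \<delta> (\<kappa> / (2 * (C\<^sup>2 + 1)))"
  have c2: "c2 > 0" using \<delta> \<kappa> by (auto simp: c2_def add_nonneg_pos)
  obtain t1 where t1: "t1 > 0" "\<And>s. 0 < s \<Longrightarrow> s \<le> t1 \<Longrightarrow> vol p s \<le> c2 * s ^ ?n"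
    using dens[OF c2] by blast
  obtain t2 where t2: "t2 > 0" "\<And>s. s \<le> t2 \<Longrightarrow> energy p s \<le> \<kappa> / 2"
    using energy_tendsto_0[of "\<kappa> / 2" p] \<kappa> by auto
  define r where "r = min s0 (min R (min t1 t2))"
  have r: "r > 0" "r \<le> s0" "r \<le> R" "r \<le> t1" "r \<le> t2" using s0 R t1 t2 by (auto simp: r_def)
  have start: "vol p s \<le> \<delta> * s ^ ?n" "vol p s \<le> \<kappa>" "total p s \<le> \<kappa>" "ball p s \<subseteq> \<Omega>" if s: "0 < s" "s \<le> r" for s
  proof -
    have v: "vol p s \<le> c2 * s ^ ?n" using t1(2) s r by auto
    also have "\<dots> \<le> \<delta> * s ^ ?n" using s by (intro mult_right_mono) (auto simp: c2_def)
    finally show v\<delta>: "vol p s \<le> \<delta> * s ^ ?n" .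
    then show "vol p s \<le> \<kappa>" using small(1)[of s] s r by linarith
    show sub: "ball p s \<subseteq> \<Omega>" using R(2) r(3) s by (meson ball_subset_cball order_trans subset_ball)
    have s1: "s \<le> 1" using s r(2) by (simp add: s0_def)
    have "mass p s \<le> C\<^sup>2 * vol p s"
      using s r(3) by (intro mass_le_vol C) auto
    also have "\<dots> \<le> C\<^sup>2 * (c2 * s ^ ?n)" using v by (intro mult_left_mono) auto
    also have "\<dots> \<le> C\<^sup>2 * (c2 * s\<^sup>2)"
      using s s1 dim c2 by (intro mult_left_mono power_decreasing) auto
    finally have "mass p s / s\<^sup>2 \<le> C\<^sup>2 * c2" using s by (simp add: field_simps)
    also have "\<dots> \<le> C\<^sup>2 * (\<kappa> / (2 * (C\<^sup>2 + 1)))" by (intro mult_left_mono) (auto simp: c2_def)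
    also have "\<dots> \<le> \<kappa> / 2"
    proof -
      have "C\<^sup>2 * \<kappa> \<le> (C\<^sup>2 + 1) * \<kappa>" using \<kappa> by (intro mult_right_mono) auto
      moreover have "C\<^sup>2 + 1 > 0" by (simp add: add_nonneg_pos)
      ultimately show ?thesis by (simp add: field_simps)
    qed
    finally have "mass p s / s\<^sup>2 \<le> \<kappa> / 2" .
    moreover have "energy p s \<le> \<kappa> / 2" using t2(2)[of s] s r by linarith
    ultimately show "total p s \<le> \<kappa>" unfolding total_def by linarith
  qed
  have it: "total p (r / 4 ^ j) \<le> \<tau> ^ j * total p r" for j
  proof (induction j)
    case (Suc j)
    have "r / 4 ^ j \<le> r / 1" using r by (intro divide_left_mono) auto
    then have j: "0 < r / 4 ^ j" "r / 4 ^ j \<le> r" using r by auto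
    have "total p (r / 4 ^ j / 4) \<le> \<tau> * total p (r / 4 ^ j)"
      by (rule dec) (use start[OF j] j in auto)
    also have "\<dots> \<le> \<tau> * (\<tau> ^ j * total p r)" using Suc \<tau> by (intro mult_left_mono) auto
    finally show ?case by (simp add: mult_ac)
  qed simp
  have "(\<lambda>j. (1/2) ^ j * total p r) \<longlonglongrightarrow> 0 * total p r" by (intro tendsto_intros LIMSEQ_power_zero) auto
  then have "\<forall>\<^sub>F j in sequentially. (1/2) ^ j * total p r < e0 * (r/2) powr m / 4"
    using e0 r by (intro order_tendstoD) auto
  then obtain j where j: "(1/2) ^ j * total p r < e0 * (r/2) powr m / 4"
    using eventually_happens'[OF sequentially_bot] by blast
  define s where "s = r / 4 ^ j"
  have "r / 4 ^ j \<le> r / 1" using r by (intro divide_left_mono) auto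
  then have s: "0 < s" "s \<le> r" using r by (auto simp: s_def)
  have "total p s \<le> \<tau> ^ j * total p r" using it by (simp add: s_def)
  also have "\<dots> = ((1/4) powr m) ^ j * ((1/2) ^ j * total p r)"
    by (simp add: \<tau>_def power_divide)
  also have "\<dots> \<le> ((1/4) powr m) ^ j * (e0 * (r/2) powr m / 4)"
    using j by (intro mult_left_mono) auto
  also have "\<dots> = e0 * (s/2) powr m / 4"
  proof -
    have "((1/4) powr m) ^ j = (1 / 4 ^ j) powr m"
      by (simp add: powr_realpow[symmetric] powr_powr powr_divide mult.commute)
    moreover have "(s / 2) powr m = ((1 / 4 ^ j) * (r / 2)) powr m" by (simp add: s_def)
    moreover have "\<dots> = (1 / 4 ^ j) powr m * (r / 2) powr m" using r by (subst powr_mult) auto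
    ultimately show ?thesis by (simp only:) simp
  qed
  finally have tp: "total p s \<le> e0 * (s/2) powr m / 4" .
  \<comment> \<open>Around \<open>q\<close> the ball of radius \<open>s/2\<close> lies in \<open>ball p s\<close>, and halving the radius multiplies the term
    \<open>mass / s\<^sup>2\<close> by at most \<open>4\<close>.\<close>
  have "q \<notin> Pos" if q: "q \<in> ball p (s/2)" for q
  proof (rule out[of "s/2"])
    have sub: "ball q (s/2) \<subseteq> ball p s"
    proof
      fix x assume "x \<in> ball q (s/2)"
      then show "x \<in> ball p s" using q dist_triangle[of p x q] by simp
    qed
    show "ball q (s/2) \<subseteq> \<Omega>" using sub start(4)[OF s] by blast
    have "mass q (s/2) / (s/2)\<^sup>2 \<le> mass p s / (s/2)\<^sup>2" by (intro divide_right_mono mass_mono sub) simp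
    also have "\<dots> = 4 * (mass p s / s\<^sup>2)" using s by (simp add: power2_eq_square field_simps)
    finally have "total q (s/2) \<le> 4 * total p s"
      using energy_mono[OF sub] energy_nonneg[of p s] by (simp add: total_def)
    then show "total q (s/2) \<le> e0 * (s/2) powr m" using tp by linarith
  qed (use s r in auto)
  then show ?thesis using s by (intro exI[of _ "s/2"]) auto
qed

end

theorem theorem1p1:
  fixes \<epsilon>\<^sub>0 \<gamma> :: real and n k :: nat
    and I :: "'n::finite set" and u :: "real^'n \<Rightarrow> real"
  assumes "0 < \<epsilon>\<^sub>0"
    and "CARD('n) = n" and "2 \<le> n"
    and "card I = k" and "k \<le> n - 1"
    and "0 < \<gamma>"
    and "local_minimizer \<epsilon>\<^sub>0 (Q_power I \<gamma>) (ball 0 2) u"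
    and "continuous_on (ball 0 2) u"
  shows "Sigma_set (ball 0 2) u = {}"
proof (rule ccontr)
  let ?\<Omega> = "ball 0 2 :: (real^'n) set"
  assume "Sigma_set ?\<Omega> u \<noteq> {}"
  then obtain p where p: "p \<in> frontier (pos_set ?\<Omega> u)" "p \<in> ?\<Omega>" "has_density (pos_set ?\<Omega> u) p 0"
    by (auto simp: Sigma_set_def)
  have "card I < CARD('n)" using assms by linarith
  then have "I \<noteq> UNIV" by auto
  then obtain i where i: "i \<notin> I" by blast
  \<comment> \<open>The index \<open>i\<close> exists because \<open>k < n\<close>. The values of \<open>u\<close> outside the ball are replaced by zero.\<close>
  define v where "v = (\<lambda>x. if x \<in> ?\<Omega> then u x else 0)"
  obtain g where g: "weak_pair ?\<Omega> v g"
    and min: "\<And>w G. approximable ?\<Omega> w G \<Longrightarrow> (\<And>x. x \<notin> ?\<Omega> \<Longrightarrow> G x = 0) \<Longrightarrow>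
       sqnorm G + (\<integral>\<^sup>+x. ennreal \<bar>indicator {z. v z > 0} x - indicator {z. v z - w z > 0} x\<bar> \<partial>lborel) < ennreal \<epsilon>\<^sub>0 \<Longrightarrow>
       (\<integral>\<^sup>+x. ennreal ((norm (g x))\<^sup>2 + (Q_power I \<gamma> x)\<^sup>2 * indicator {z. v z > 0} x) \<partial>lborel) \<le>
       (\<integral>\<^sup>+x. ennreal ((norm (g x - G x))\<^sup>2 + (Q_power I \<gamma> x)\<^sup>2 * indicator {z. v z - w z > 0} x) \<partial>lborel)"
    using minimality[OF assms(7,8)] unfolding v_def by blast
  have vc: "continuous_on ?\<Omega> v"
    using assms(8) by (rule continuous_on_eq) (simp add: v_def)
  interpret power_minimizer ?\<Omega> \<epsilon>\<^sub>0 I \<gamma> v g "2 powr \<gamma>" i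
  proof (unfold_locales; (rule g vc Q_power_measurable assms(1) min i assms(6))?)
    show "\<bar>Q_power I \<gamma> x\<bar> \<le> 2 powr \<gamma>" if "x \<in> ?\<Omega>" for x
      using that assms(6) by (intro Q_power_le) auto
  qed (use assms in auto)
  have "Pos = {x. v x > 0}" by (rule Pos_def)
  then have Pos: "Pos = pos_set ?\<Omega> u" by (auto simp: pos_set_def v_def split: if_splits)
  have "vol p s = measure lebesgue (pos_set ?\<Omega> u \<inter> ball p s)" for s
    unfolding vol_def Pos[symmetric] by (intro measure_completion[symmetric]) simp
  then have "\<exists>r>0. ball p r \<inter> Pos = {}"
    using p(3) by (intro density_zero_imp_locally_zero p(2)) (simp add: has_density_def)
  then obtain r where r: "r > 0" "ball p r \<inter> pos_set ?\<Omega> u = {}" unfolding Pos by blast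
  have "p \<in> closure (pos_set ?\<Omega> u)" using p(1) by (simp add: frontier_def)
  then obtain x where "x \<in> pos_set ?\<Omega> u" "dist x p < r" using r(1) by (auto simp: closure_approachable)
  then show False using r(2) by (auto simp: dist_commute)
qed

end
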